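(* Let $n \ge 2$ be an integer and let $f : S^{n-1} \to \mathbb{R}$ be a Lipschitz function. Assume that, for almost all $\xi \in S^{n-1}$, the function $$ z \mapsto \int_{S^{n-1} \cap C(\xi, z)} f(x)\, dx , \qquad z \in (-1,1), $$ has a critical point at $z = 0$ (that is, its derivative at $z=0$ exists and equals $0$). Then $f$ is an even function, i.e. $f(x) = f(-x)$ for all $x \in S^{n-1}$.
   Context: $S^{n-1}$ denotes the unit sphere of Euclidean space $\mathbb{R}^n$, $n \ge 2$. Lipschitz is meant with respect to the geodesic metric on $S^{n-1}$. For $\xi \in S^{n-1}$ and $z \in (-1,1)$, $C(\xi, z)$ denotes the cone $\{0\} \cup \{ x \in \mathbb{R}^n \setminus \{0\} \mid \cos(\angle \xi 0 x) = z \}$, where $\angle \xi 0 x$ is the angle at the origin between $\xi$ and $x$; thus $S^{n-1} \cap C(\xi,z) = \{ x \in S^{n-1} \mid \langle x, \xi\rangle = z\}$, an $(n-2)$-dimensional sphere of radius $\sqrt{1-z^2}$. The integral over it is taken with respect to its $(n-2)$-dimensional volume (i.e. $(n-2)$-dimensional Hausdorff measure; for $n=2$ this is counting measure on the two points). "Almost all $\xi \in S^{n-1}$" is with respect to the usual surface measure on $S^{n-1}$. A critical point of a function is a point at which the derivative of the function exists and equals $0$. *)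

theory Defs
  imports "HOL-Analysis.Analysis"
begin

text \<open>
  The s-dimensional Hausdorff measure, for a natural number \<open>s\<close>. The factor
  \<open>unit_ball_vol s / 2 ^ s\<close> normalises it so that it agrees with s-dimensional volume; for
  \<open>s = 0\<close> it is counting measure. Empty covering sets are treated separately because
  \<open>diameter {} ^ 0 = 1\<close>, and boundedness is required explicitly because \<^const>\<open>diameter\<close>
  is an unspecified real number on unbounded sets.
\<close>

definition hausdorff_gauge :: "nat \<Rightarrow> 'a::metric_space set \<Rightarrow> ennreal" where
  "hausdorff_gauge s U =
     (if U = {} then 0 else ennreal (unit_ball_vol (real s) * (diameter U / 2) ^ s))"

definition hausdorff_content :: "nat \<Rightarrow> real \<Rightarrow> 'a::metric_space set \<Rightarrow> ennreal" where
  "hausdorff_content s \<delta> A =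
     (INF U \<in> {U :: nat \<Rightarrow> 'a set. A \<subseteq> (\<Union>i. U i) \<and> (\<forall>i. bounded (U i) \<and> diameter (U i) \<le> \<delta>)}.
        \<Sum>i. hausdorff_gauge s (U i))"

definition hausdorff_outer :: "nat \<Rightarrow> 'a::metric_space set \<Rightarrow> ennreal" where
  "hausdorff_outer s A = (SUP \<delta> \<in> {0<..}. hausdorff_content s \<delta> A)"

text \<open>
  By Caratheodory's criterion for metric outer measures, \<open>hausdorff_outer s\<close> is countably
  additive on the Borel sets, so \<^const>\<open>measure_of\<close> does not degenerate to the zero measure.
\<close>

definition hausdorff_measure :: "nat \<Rightarrow> 'a::metric_space measure" where
  "hausdorff_measure s = measure_of UNIV (sets borel) (hausdorff_outer s)"

definition angle :: "'a::real_inner \<Rightarrow> 'a \<Rightarrow> real" where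
  "angle x y = arccos (x \<bullet> y / (norm x * norm y))"

definition angular_cone :: "'a::real_inner \<Rightarrow> real \<Rightarrow> 'a set" where
  "angular_cone \<xi> z = {0} \<union> {x. x \<noteq> 0 \<and> cos (angle \<xi> x) = z}"

text \<open>On the unit sphere the geodesic (great-circle) distance of two points is their angle.\<close>

definition geodesic_lipschitz :: "('a::real_inner \<Rightarrow> real) \<Rightarrow> bool" where
  "geodesic_lipschitz f \<longleftrightarrow>
     (\<exists>L\<ge>0. \<forall>x\<in>sphere 0 1. \<forall>y\<in>sphere 0 1. \<bar>f x - f y\<bar> \<le> L * angle x y)"

definition sphere_measure :: "(real ^ 'n) measure" where
  "sphere_measure = restrict_space (hausdorff_measure (CARD('n) - 1)) (sphere 0 1)"

definition section_integral :: "(real ^ 'n \<Rightarrow> real) \<Rightarrow> real ^ 'n \<Rightarrow> real \<Rightarrow> real" where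
  "section_integral f \<xi> z =
     (LINT x:(sphere 0 1 \<inter> angular_cone \<xi> z)|hausdorff_measure (CARD('n) - 2). f x)"

end

theory Submission
  imports Defs
begin

text \<open>
  Only the odd part \<open>g\<close> of \<open>f\<close> matters: up to the factor \<open>(1 - z\<^sup>2) powr ((n - 2) / 2)\<close>, the section
  integral at \<open>z\<close> minus the one at \<open>- z\<close> is the slice integral \<open>T z g\<close> of \<open>g\<close> over points
  \<open>z \<xi> + sqrt (1 - z\<^sup>2) u\<close> with \<open>u\<close> in the equator of \<open>\<xi>\<close>, so \<open>T z g \<xi> / z \<longlonglongrightarrow> 0\<close> as \<open>z \<longlonglongrightarrow> 0\<close>, for almost
  all \<open>\<xi>\<close> and with a uniform bound. The operator \<open>T z\<close> is self-adjoint, being a limit of integral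
  operators with symmetric kernels \<open>indicator (\<bar>\<xi> \<bullet> x - z\<bar> < \<epsilon>)\<close>. Testing against \<open>(\<xi> \<bullet> a) ^ (2 j + 1)\<close>,
  whose slice integrals have derivative \<open>const * t * (1 - t\<^sup>2) ^ j\<close> with \<open>t = \<xi> \<bullet> a\<close> and a positive
  constant, shows that \<open>g\<close> is orthogonal to all these functions of \<open>t\<close>, hence by Weierstrass to odd
  zonal functions concentrated near \<open>a\<close> and \<open>- a\<close>. This forces \<open>g a = 0\<close>.
\<close>

section \<open>Hausdorff measure\<close>

text \<open>Since \<open>g\<close> is merely Lipschitz, the limit of \<open>T z g / z\<close> cannot
  be computed from derivatives of \<open>g\<close>. Self-adjointness moves the difference quotient
  to a polynomial, where it can be computed; on the side of \<open>g\<close> the Lipschitz constant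
  supplies the dominating function. The integration theory behind self-adjointness comes from
  symmetry alone. A finite measure on a compact set that gives equal mass to balls of equal radius
  is unique up to a factor. The measure on an equator and the projection of a thin band to that
  equator are both of this kind, hence proportional, with a factor that does not depend on
  \<open>\<xi>\<close>. So only positivity and finiteness of the Hausdorff measures of spheres
  enter, never their values, and the only isometries required are reflections and the antipodal map.
  The exponent \<open>2 * j + 1\<close> is odd to make the test function odd; its derivative then
  brings in an even moment of an equatorial coordinate, and this is why the constant is
  positive.\<close>

lemma hausdorff_gauge_empty [simp]: "hausdorff_gauge s {} = 0"
  by (simp add: hausdorff_gauge_def)

lemma hausdorff_gauge_le:
  assumes "bounded U" "diameter U \<le> d"
  shows "hausdorff_gauge s U \<le> ennreal (unit_ball_vol (real s) * (d / 2) ^ s)"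
  unfolding hausdorff_gauge_def using assms diameter_ge_0[OF assms(1)]
  by (auto intro!: ennreal_leI mult_left_mono power_mono divide_right_mono)

lemma hausdorff_content_le:
  assumes "A \<subseteq> (\<Union>i. U i)" "\<And>i. bounded (U i)" "\<And>i. diameter (U i) \<le> \<delta>"
  shows "hausdorff_content s \<delta> A \<le> (\<Sum>i. hausdorff_gauge s (U i))"
  unfolding hausdorff_content_def using assms by (intro INF_lower) auto

lemma hausdorff_content_less_cover:
  assumes "hausdorff_content s \<delta> A < c"
  obtains U :: "nat \<Rightarrow> 'a::metric_space set" where "A \<subseteq> (\<Union>i. U i)" "\<And>i. bounded (U i)"
    "\<And>i. diameter (U i) \<le> \<delta>" "(\<Sum>i. hausdorff_gauge s (U i)) < c"
  using assms unfolding hausdorff_content_def INF_less_iff by blast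

section \<open>Monotonicity, subadditivity and additivity on separated sets\<close>

lemma hausdorff_content_mono: "A \<subseteq> B \<Longrightarrow> hausdorff_content s \<delta> A \<le> hausdorff_content s \<delta> B"
  unfolding hausdorff_content_def by (intro INF_superset_mono) auto

lemma hausdorff_content_antimono: "\<delta> \<le> \<delta>' \<Longrightarrow> hausdorff_content s \<delta>' A \<le> hausdorff_content s \<delta> A"
  unfolding hausdorff_content_def by (intro INF_superset_mono) (auto intro: order_trans)

lemma hausdorff_outer_mono: "A \<subseteq> B \<Longrightarrow> hausdorff_outer s A \<le> hausdorff_outer s B"
  unfolding hausdorff_outer_def by (intro SUP_mono) (auto intro: hausdorff_content_mono)

lemma hausdorff_content_le_outer: "0 < \<delta> \<Longrightarrow> hausdorff_content s \<delta> A \<le> hausdorff_outer s A"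
  unfolding hausdorff_outer_def by (intro SUP_upper) auto

lemma hausdorff_content_empty:
  assumes "0 \<le> \<delta>"
  shows "hausdorff_content s \<delta> ({} :: 'a::metric_space set) = 0"
proof -
  have "hausdorff_content s \<delta> ({} :: 'a set) \<le> (\<Sum>i::nat. hausdorff_gauge s ({} :: 'a set))"
    using assms by (intro hausdorff_content_le) auto
  then show ?thesis by simp
qed

lemma hausdorff_outer_empty [simp]: "hausdorff_outer s {} = 0"
  unfolding hausdorff_outer_def by (auto simp: hausdorff_content_empty intro!: antisym SUP_least)

lemma hausdorff_content_finite_cover:
  assumes "finite F" "A \<subseteq> \<Union>F" "\<And>U. U \<in> F \<Longrightarrow> bounded U \<and> diameter U \<le> \<delta>" "0 \<le> \<delta>"
  shows "hausdorff_content s \<delta> A \<le> (\<Sum>U\<in>F. hausdorff_gauge s U)"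
proof -
  obtain h where h: "bij_betw h {..<card F} F"
    using ex_bij_betw_nat_finite[OF assms(1)] by (auto simp: atLeast0LessThan)
  \<comment> \<open>Padding the cover with empty sets costs nothing, since their gauge is 0 even for
    \<open>s = 0\<close>.\<close>
  define V where "V i = (if i < card F then h i else {})" for i
  have VF: "V i \<in> F" if "i < card F" for i using h that by (auto simp: V_def bij_betw_def)
  have Veq: "V i = {}" if "\<not> i < card F" for i using that by (simp add: V_def)
  have "A \<subseteq> (\<Union>i. V i)"
  proof
    fix x assume "x \<in> A"
    then obtain U where "U \<in> F" "x \<in> U" using assms(2) by blast
    then obtain i where "i < card F" "h i = U" using bij_betw_imp_surj_on[OF h] by (metis imageE lessThan_iff)
    with \<open>x \<in> U\<close> show "x \<in> (\<Union>i. V i)" by (auto simp: V_def)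
  qed
  moreover have "bounded (V i) \<and> diameter (V i) \<le> \<delta>" for i
    using assms(3)[OF VF, of i] Veq[of i] assms(4) by (cases "i < card F") auto
  ultimately have "hausdorff_content s \<delta> A \<le> (\<Sum>i. hausdorff_gauge s (V i))"
    by (intro hausdorff_content_le) auto
  also have "\<dots> = (\<Sum>i<card F. hausdorff_gauge s (V i))"
    by (rule suminf_finite) (auto simp: V_def)
  also have "\<dots> = (\<Sum>i<card F. hausdorff_gauge s (h i))" by (simp add: V_def)
  also have "\<dots> = (\<Sum>U\<in>F. hausdorff_gauge s U)" by (rule sum.reindex_bij_betw[OF h])
  finally show ?thesis .
qed

text \<open>Covers of \<open>A n\<close> that are optimal up to \<open>e / 2 ^ (n + 1)\<close> are
  merged into a single sequence along \<open>prod_decode\<close>; the errors add up to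
  \<open>e\<close>.\<close>

lemma hausdorff_content_countably_subadditive:
  fixes A :: "nat \<Rightarrow> 'a::metric_space set"
  shows "hausdorff_content s \<delta> (\<Union>i. A i) \<le> (\<Sum>i. hausdorff_content s \<delta> (A i))"
proof (rule ennreal_le_epsilon)
  let ?H = "hausdorff_content s \<delta> :: 'a set \<Rightarrow> ennreal"
  fix e :: real assume "0 < e" "(\<Sum>n. ?H (A n)) < top"
  then have *: "\<And>n. ?H (A n) < ?H (A n) + e * (1/2)^Suc n"
    by (auto simp add: less_top dest!: ennreal_suminf_lessD)
  have "\<forall>n. \<exists>U :: nat \<Rightarrow> 'a set. A n \<subseteq> (\<Union>i. U i) \<and> (\<forall>i. bounded (U i) \<and> diameter (U i) \<le> \<delta>)
      \<and> (\<Sum>i. hausdorff_gauge s (U i)) \<le> ?H (A n) + e * (1/2)^Suc n"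
    using hausdorff_content_less_cover[OF *] by (metis less_imp_le)
  then obtain B :: "nat \<Rightarrow> nat \<Rightarrow> 'a set" where B: "\<And>n. A n \<subseteq> (\<Union>i. B n i)"
    "\<And>n i. bounded (B n i) \<and> diameter (B n i) \<le> \<delta>"
    "\<And>n. (\<Sum>i. hausdorff_gauge s (B n i)) \<le> ?H (A n) + e * (1/2)^Suc n"
    by metis
  define C where "C = case_prod B o prod_decode"
  have A_C: "(\<Union>i. A i) \<subseteq> (\<Union>i. C i)"
    using B(1) by (auto simp add: C_def subset_eq) (metis prod.case prod_encode_inverse)
  have "?H (\<Union>i. A i) \<le> (\<Sum>i. hausdorff_gauge s (C i))"
    using A_C B(2) by (intro hausdorff_content_le) (auto simp: C_def split_def)
  also have "\<dots> = (\<Sum>n. \<Sum>i. hausdorff_gauge s (B n i))"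
    unfolding C_def comp_def
    using suminf_ennreal_2dimen[of "\<lambda>n. \<Sum>i. hausdorff_gauge s (B n i)" "\<lambda>p. hausdorff_gauge s (case_prod B p)"]
    by simp
  also have "\<dots> \<le> (\<Sum>n. ?H (A n) + e * (1/2) ^ Suc n)"
    by (intro suminf_le B(3)) auto
  also have "\<dots> = (\<Sum>n. ?H (A n)) + (\<Sum>n. ennreal e * ennreal ((1/2) ^ Suc n))"
    using \<open>0 < e\<close> by (subst suminf_add[symmetric])
                     (auto simp del: ennreal_suminf_cmult simp add: ennreal_mult[symmetric])
  also have "\<dots> = (\<Sum>n. ?H (A n)) + e"
    unfolding ennreal_suminf_cmult
    by (subst suminf_ennreal_eq[OF zero_le_power power_half_series]) auto
  finally show "?H (\<Union>i. A i) \<le> (\<Sum>n. ?H (A n)) + e" .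
qed

lemma hausdorff_outer_countably_subadditive:
  "hausdorff_outer s (\<Union>i::nat. A i) \<le> (\<Sum>i. hausdorff_outer s (A i))"
proof -
  have "hausdorff_content s \<delta> (\<Union>i. A i) \<le> (\<Sum>i. hausdorff_outer s (A i))" if "0 < \<delta>" for \<delta>
  proof -
    have "hausdorff_content s \<delta> (\<Union>i. A i) \<le> (\<Sum>i. hausdorff_content s \<delta> (A i))"
      by (rule hausdorff_content_countably_subadditive)
    also have "\<dots> \<le> (\<Sum>i. hausdorff_outer s (A i))"
      using that by (intro suminf_le hausdorff_content_le_outer) auto
    finally show ?thesis .
  qed
  then show ?thesis unfolding hausdorff_outer_def[of s "\<Union>i. A i"] by (auto intro: SUP_least)
qed

lemma hausdorff_outer_Un: "hausdorff_outer s (A \<union> B) \<le> hausdorff_outer s A + hausdorff_outer s B"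
proof -
  let ?C = "\<lambda>i::nat. if i = 0 then A else if i = 1 then B else {}"
  have "A \<union> B = (\<Union>i. ?C i)" by (auto split: if_splits)
  then have "hausdorff_outer s (A \<union> B) \<le> (\<Sum>i. hausdorff_outer s (?C i))"
    using hausdorff_outer_countably_subadditive[of s ?C] by simp
  also have "\<dots> = (\<Sum>i<2. hausdorff_outer s (?C i))"
    by (rule suminf_finite) auto
  also have "\<dots> = hausdorff_outer s A + hausdorff_outer s B"
    by (simp add: numeral_2_eq_2)
  finally show ?thesis .
qed

lemma hausdorff_outer_UN_le:
  assumes "finite I"
  shows "hausdorff_outer s (\<Union>i\<in>I. A i) \<le> (\<Sum>i\<in>I. hausdorff_outer s (A i))"
  using assms
proof induction
  case (insert i I)
  have "hausdorff_outer s (\<Union>j\<in>insert i I. A j) \<le> hausdorff_outer s (A i) + hausdorff_outer s (\<Union>j\<in>I. A j)"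
    using hausdorff_outer_Un[of s "A i" "\<Union>j\<in>I. A j"] by simp
  also have "\<dots> \<le> hausdorff_outer s (A i) + (\<Sum>i\<in>I. hausdorff_outer s (A i))"
    using insert.IH by (intro add_left_mono)
  finally show ?case using insert.hyps by simp
qed simp

text \<open>A covering set of diameter at most \<open>\<delta> < d\<close> cannot meet both
  \<open>A\<close> and \<open>B\<close>, so every cover of the union splits into disjoint
  subfamilies that cover \<open>A\<close> and \<open>B\<close>.\<close>

lemma hausdorff_content_separated:
  fixes A B :: "'a::metric_space set"
  assumes "\<delta> < d" and sep: "\<And>x y. x \<in> A \<Longrightarrow> y \<in> B \<Longrightarrow> d \<le> dist x y" and "0 \<le> \<delta>"
  shows "hausdorff_content s \<delta> A + hausdorff_content s \<delta> B \<le> hausdorff_content s \<delta> (A \<union> B)"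
  unfolding hausdorff_content_def[of s \<delta> "A \<union> B"]
proof (rule INF_greatest)
  fix U :: "nat \<Rightarrow> 'a set"
  assume "U \<in> {U. A \<union> B \<subseteq> (\<Union>i. U i) \<and> (\<forall>i. bounded (U i) \<and> diameter (U i) \<le> \<delta>)}"
  then have U: "A \<union> B \<subseteq> (\<Union>i. U i)" "\<And>i. bounded (U i)" "\<And>i. diameter (U i) \<le> \<delta>" by auto
  define V where "V C i = (if U i \<inter> C = {} then {} else U i)" for C i
  have V: "hausdorff_content s \<delta> C \<le> (\<Sum>i. hausdorff_gauge s (V C i))" if "C \<subseteq> A \<union> B" for C
  proof (rule hausdorff_content_le)
    show "C \<subseteq> (\<Union>i. V C i)"
    proof
      fix x assume "x \<in> C"
      with that U(1) obtain i where "x \<in> U i" by blast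
      with \<open>x \<in> C\<close> have "x \<in> V C i" by (auto simp: V_def)
      then show "x \<in> (\<Union>i. V C i)" by blast
    qed
  qed (use U assms(3) in \<open>auto simp: V_def\<close>)
  have disj: "V A i = {} \<or> V B i = {}" for i
  proof (rule ccontr)
    assume "\<not> ?thesis"
    then obtain x y where "x \<in> U i" "x \<in> A" "y \<in> U i" "y \<in> B" by (auto simp: V_def split: if_splits)
    then have "dist x y \<le> \<delta>" "d \<le> dist x y"
      using diameter_bounded_bound[OF U(2)] U(3) sep order_trans by blast+
    then show False using assms by simp
  qed
  have "hausdorff_content s \<delta> A + hausdorff_content s \<delta> B
      \<le> (\<Sum>i. hausdorff_gauge s (V A i)) + (\<Sum>i. hausdorff_gauge s (V B i))"
    by (intro add_mono V) auto
  also have "\<dots> = (\<Sum>i. hausdorff_gauge s (V A i) + hausdorff_gauge s (V B i))"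
    by (rule suminf_add) auto
  also have "\<dots> \<le> (\<Sum>i. hausdorff_gauge s (U i))"
  proof (intro suminf_le)
    show "hausdorff_gauge s (V A i) + hausdorff_gauge s (V B i) \<le> hausdorff_gauge s (U i)" for i
    proof (cases "V A i = {}")
      case True
      then show ?thesis by (simp add: V_def)
    next
      case False
      then have "V A i = U i" "V B i = {}" using disj[of i] by (auto simp: V_def split: if_splits)
      then show ?thesis by simp
    qed
  qed auto
  finally show "hausdorff_content s \<delta> A + hausdorff_content s \<delta> B \<le> (\<Sum>i. hausdorff_gauge s (U i))" .
qed

text \<open>The content grows as \<open>\<delta>\<close> shrinks. Hence the two suprema can be taken
  jointly, and any scale may be replaced by one below \<open>d\<close>, where the content is
  superadditive.\<close>

lemma hausdorff_outer_separated:
  assumes "0 < d" and sep: "\<And>x y. x \<in> A \<Longrightarrow> y \<in> B \<Longrightarrow> d \<le> dist x y"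
  shows "hausdorff_outer s A + hausdorff_outer s B \<le> hausdorff_outer s (A \<union> B)"
proof -
  have "hausdorff_outer s A + hausdorff_outer s B
      = (SUP \<delta>\<in>{0<..}. hausdorff_content s \<delta> A + hausdorff_content s \<delta> B)"
    unfolding hausdorff_outer_def
  proof (rule SUP_add_directed_ennreal[symmetric])
    fix i j :: real assume "i \<in> {0<..}" "j \<in> {0<..}"
    then show "\<exists>k\<in>{0<..}. hausdorff_content s i A + hausdorff_content s j B
        \<le> hausdorff_content s k A + hausdorff_content s k B"
      by (intro bexI[of _ "min i j"] add_mono hausdorff_content_antimono) auto
  qed
  also have "\<dots> \<le> hausdorff_outer s (A \<union> B)"
  proof (rule SUP_least)
    fix \<delta> :: real assume \<delta>: "\<delta> \<in> {0<..}"
    have "hausdorff_content s \<delta> A + hausdorff_content s \<delta> B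
       \<le> hausdorff_content s (min \<delta> (d/2)) A + hausdorff_content s (min \<delta> (d/2)) B"
      by (intro add_mono hausdorff_content_antimono) auto
    also have "\<dots> \<le> hausdorff_content s (min \<delta> (d/2)) (A \<union> B)"
      using assms \<delta> by (intro hausdorff_content_separated[of _ d]) auto
    also have "\<dots> \<le> hausdorff_outer s (A \<union> B)"
      using assms \<delta> by (intro hausdorff_content_le_outer) auto
    finally show "hausdorff_content s \<delta> A + hausdorff_content s \<delta> B \<le> hausdorff_outer s (A \<union> B)" .
  qed
  finally show ?thesis .
qed

text \<open>
  Caratheodory's criterion. With \<open>T n\<close> the part of \<open>B\<close> at distance more than \<open>1 / (n + 1)\<close> from the
  closed set \<open>C\<close>, the shells \<open>T (k + 1) - T k\<close> with \<open>k\<close> of the same parity are mutually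
  separated, so their measures are summable and \<open>B - C\<close> is exhausted by the \<open>T n\<close> in measure.
\<close>

lemma closed_in_hausdorff_lambda_system:
  fixes C :: "'a::metric_space set"
  assumes "closed C"
  shows "C \<in> lambda_system UNIV (Pow UNIV) (hausdorff_outer s)"
proof -
  let ?f = "hausdorff_outer s :: 'a set \<Rightarrow> ennreal"
  have "?f (C \<inter> X) + ?f ((UNIV - C) \<inter> X) \<le> ?f X" for X
  \<comment> \<open>\<open>infdist\<close> to the empty set is 0, which would make every
    \<open>T n\<close> below empty; infinite \<open>?f X\<close> leaves nothing to prove.\<close>
  proof (cases "C = {} \<or> ?f X = \<infinity>")
    case False
    then have C: "C \<noteq> {}" and fin: "?f X < \<infinity>" by (auto simp: less_top)
    define T where "T n = {x \<in> X. 1 / real (Suc n) < infdist x C}" for n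
    have Tsub: "T n \<subseteq> X" for n by (auto simp: T_def)
    have Tmono: "T n \<subseteq> T m" if "n \<le> m" for n m
    proof -
      have "1 / real (Suc m) \<le> 1 / real (Suc n)" using that by (simp add: field_simps)
      then show ?thesis by (auto simp: T_def)
    qed
    have sepT: "?f A + ?f (T n) \<le> ?f X" if "A = C \<inter> X" for A n
    proof -
      have "?f A + ?f (T n) \<le> ?f (A \<union> T n)"
      proof (rule hausdorff_outer_separated[of "1 / real (Suc n)"])
        fix x y assume "x \<in> A" "y \<in> T n"
        then have "1 / real (Suc n) < infdist y C" "infdist y C \<le> dist y x"
          using that by (auto simp: T_def intro!: infdist_le)
        then show "1 / real (Suc n) \<le> dist x y" by (simp add: dist_commute)
      qed simp
      also have "\<dots> \<le> ?f X" using that Tsub by (intro hausdorff_outer_mono) auto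
      finally show ?thesis .
    qed
    define R where "R n = T (Suc n) - T n" for n
    have sepR: "?f (R (Suc n)) + ?f (T n) \<le> ?f (T (Suc (Suc n)))" for n
    proof -
      let ?d = "1 / real (Suc n) - 1 / real (Suc (Suc n))"
      have "?f (R (Suc n)) + ?f (T n) \<le> ?f (R (Suc n) \<union> T n)"
      proof (rule hausdorff_outer_separated[of ?d])
        show "0 < ?d" by (simp add: frac_less2)
        fix x y assume "x \<in> R (Suc n)" "y \<in> T n"
        then have "infdist x C \<le> 1 / real (Suc (Suc n))" "1 / real (Suc n) < infdist y C"
          by (auto simp: R_def T_def)
        moreover have "infdist y C \<le> infdist x C + dist y x" by (rule infdist_triangle)
        ultimately show "?d \<le> dist x y" by (simp add: dist_commute)
      qed
      also have "\<dots> \<le> ?f (T (Suc (Suc n)))"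
        using Tmono[of n "Suc (Suc n)"] by (intro hausdorff_outer_mono) (auto simp: R_def)
      finally show ?thesis .
    qed
    \<comment> \<open>One induction serves both parities: \<open>sepR\<close> merges a new shell
      with the \<open>T\<close> two levels below it, so the last two sets \<open>T\<close> take
      turns as accumulators.\<close>
    have sumR: "(\<Sum>k<n. ?f (R (Suc k))) \<le> ?f (T n) + ?f (T (Suc n))" for n
    proof (induction n)
      case (Suc n)
      have "(\<Sum>k<Suc n. ?f (R (Suc k))) \<le> ?f (T n) + ?f (T (Suc n)) + ?f (R (Suc n))"
        using Suc by (simp add: add_right_mono)
      also have "\<dots> = ?f (T (Suc n)) + (?f (R (Suc n)) + ?f (T n))" by (simp add: ac_simps)
      also have "\<dots> \<le> ?f (T (Suc n)) + ?f (T (Suc (Suc n)))" by (intro add_left_mono sepR)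
      finally show ?case .
    qed simp
    have "(\<Sum>k. ?f (R (Suc k))) \<le> ?f X + ?f X"
    proof (rule suminf_le_const)
      fix n show "(\<Sum>k<n. ?f (R (Suc k))) \<le> ?f X + ?f X"
        using sumR[of n] add_mono[OF hausdorff_outer_mono[OF Tsub] hausdorff_outer_mono[OF Tsub]] order_trans
        by blast
    qed simp
    also have "\<dots> < \<infinity>" using fin by simp
    finally have fin_sum: "(\<Sum>k. ?f (R (Suc k))) \<noteq> \<infinity>" by simp
    have tail: "(\<lambda>n. \<Sum>k. ?f (R (Suc (k + n)))) \<longlonglongrightarrow> 0"
    proof -
      have fR: "?f (R (Suc k)) = ennreal (enn2real (?f (R (Suc k))))" for k
      proof -
        have "?f (R (Suc k)) \<le> ?f X" by (intro hausdorff_outer_mono) (auto simp: R_def T_def)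
        then have "?f (R (Suc k)) < top" using fin by (simp add: order_le_less_trans)
        then show ?thesis by simp
      qed
      let ?g = "\<lambda>k. enn2real (?f (R (Suc k)))"
      have "(\<Sum>k. ennreal (?g k)) \<noteq> top" using fin_sum unfolding fR[symmetric] by simp
      then have sg: "summable ?g" by (rule summable_suminf_not_top[rotated]) simp
      have "(\<lambda>n. \<Sum>k. ?g (k + n)) \<longlonglongrightarrow> 0" using suminf_exist_split2[OF sg] .
      then have "(\<lambda>n. ennreal (\<Sum>k. ?g (k + n))) \<longlonglongrightarrow> ennreal 0" by (rule tendsto_ennrealI)
      moreover have "ennreal (\<Sum>k. ?g (k + n)) = (\<Sum>k. ?f (R (Suc (k + n))))" for n
      proof -
        have "summable (\<lambda>k. ?g (k + n))" using sg by (rule summable_ignore_initial_segment)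
        then have "(\<Sum>k. ennreal (?g (k + n))) = ennreal (\<Sum>k. ?g (k + n))"
          by (intro suminf_ennreal2) auto
        then show ?thesis unfolding fR[symmetric] by simp
      qed
      ultimately show ?thesis by simp
    qed
    have cover: "(UNIV - C) \<inter> X \<subseteq> T (Suc n) \<union> (\<Union>k. R (Suc (k + n)))" for n
    proof
      fix x assume x: "x \<in> (UNIV - C) \<inter> X"
      then have "0 < infdist x C"
        using assms C infdist_nonneg[of x C] in_closed_iff_infdist_zero[of C x] by fastforce
      then obtain m where "1 / real (Suc m) < infdist x C"
        using nat_approx_posE by blast
      then have ex: "\<exists>m. x \<in> T m" using x by (auto simp: T_def)
      \<comment> \<open>With the least index, \<open>x\<close> lies in the shell
        \<open>R (m - 1)\<close> unless \<open>m \<le> Suc n\<close>.\<close>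
      define m where "m = (LEAST m. x \<in> T m)"
      have m: "x \<in> T m" "\<And>k. k < m \<Longrightarrow> x \<notin> T k"
        using ex LeastI_ex[of "\<lambda>m. x \<in> T m"] not_less_Least unfolding m_def by blast+
      show "x \<in> T (Suc n) \<union> (\<Union>k. R (Suc (k + n)))"
      proof (cases "m \<le> Suc n")
        case True then show ?thesis using m Tmono[OF True] by auto
      next
        case False
        then obtain k where "m = Suc (Suc (k + n))"
          by (metis add.commute add_Suc_right less_imp_Suc_add not_le)
        then have "x \<in> R (Suc (k + n))" using m by (auto simp: R_def)
        then show ?thesis by blast
      qed
    qed
    have "?f (C \<inter> X) + ?f ((UNIV - C) \<inter> X) \<le> ?f X + (\<Sum>k. ?f (R (Suc (k + n))))" for n
    proof -
      have "?f ((UNIV - C) \<inter> X) \<le> ?f (T (Suc n)) + ?f (\<Union>k. R (Suc (k + n)))"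
        using order_trans[OF hausdorff_outer_mono[OF cover] hausdorff_outer_Un] .
      also have "\<dots> \<le> ?f (T (Suc n)) + (\<Sum>k. ?f (R (Suc (k + n))))"
        by (intro add_left_mono hausdorff_outer_countably_subadditive)
      finally have "?f (C \<inter> X) + ?f ((UNIV - C) \<inter> X)
          \<le> ?f (C \<inter> X) + (?f (T (Suc n)) + (\<Sum>k. ?f (R (Suc (k + n)))))"
        by (intro add_left_mono)
      also have "\<dots> \<le> ?f X + (\<Sum>k. ?f (R (Suc (k + n))))"
        unfolding add.assoc[symmetric] by (intro add_right_mono sepT) simp
      finally show ?thesis .
    qed
    moreover have "(\<lambda>n. ?f X + (\<Sum>k. ?f (R (Suc (k + n))))) \<longlonglongrightarrow> ?f X + 0"
      by (intro tendsto_add tendsto_const tail)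
    ultimately have "?f (C \<inter> X) + ?f ((UNIV - C) \<inter> X) \<le> ?f X + 0"
      by (intro LIMSEQ_le_const) blast+
    then show ?thesis by simp
  next
    case True
    then show ?thesis by (elim disjE) simp_all
  qed
  moreover have "?f X \<le> ?f (C \<inter> X) + ?f ((UNIV - C) \<inter> X)" for X
  proof -
    have "C \<inter> X \<union> (UNIV - C) \<inter> X = X" by blast
    then show ?thesis using hausdorff_outer_Un[of s "C \<inter> X" "(UNIV - C) \<inter> X"] by simp
  qed
  ultimately have "?f (C \<inter> X) + ?f ((UNIV - C) \<inter> X) = ?f X" for X
    by (rule antisym)
  then show ?thesis unfolding lambda_system_def by blast
qed

text \<open>The Caratheodory measurable sets form a sigma algebra that contains the closed sets,
  hence all Borel sets.\<close>

lemma measure_space_hausdorff_outer: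
  "measure_space UNIV (sets (borel :: 'a::metric_space measure)) (hausdorff_outer s)"
proof -
  let ?f = "hausdorff_outer s :: 'a set \<Rightarrow> ennreal"
  interpret sigma_algebra UNIV "Pow UNIV :: 'a set set" by (rule sigma_algebra_Pow)
  have "outer_measure_space (Pow UNIV) ?f"
    by (auto simp: outer_measure_space_def positive_def increasing_def countably_subadditive_def
        intro: hausdorff_outer_mono hausdorff_outer_countably_subadditive)
  from caratheodory_lemma[OF this]
  have ms: "measure_space UNIV (lambda_system UNIV (Pow UNIV) ?f) ?f" .
  then have sa: "sigma_algebra UNIV (lambda_system UNIV (Pow UNIV) ?f)"
    by (simp add: measure_space_def)
  have "sets (borel :: 'a measure) = sigma_sets UNIV (Collect closed)"
    by (simp add: borel_eq_closed)
  also have "\<dots> \<subseteq> lambda_system UNIV (Pow UNIV) ?f"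
    using closed_in_hausdorff_lambda_system by (intro sigma_algebra.sigma_sets_subset[OF sa]) auto
  finally show ?thesis
    by (rule measure_down[OF ms, rotated]) (metis sets.sigma_algebra_axioms space_borel)
qed

section \<open>Hausdorff measure on Borel sets, and its behaviour under Lipschitz maps\<close>

lemma sets_hausdorff_measure [simp, measurable_cong]: "sets (hausdorff_measure s :: 'a::metric_space measure) = sets borel"
  using sets.sigma_sets_eq[of "borel :: 'a::metric_space measure"]
  by (simp add: hausdorff_measure_def sets_measure_of)

lemma space_hausdorff_measure [simp]: "space (hausdorff_measure s) = UNIV"
  unfolding hausdorff_measure_def by (simp add: space_measure_of_conv)

text \<open>\<open>measure_of\<close> returns the zero measure unless the given set function is a
  measure; countable additivity on the Borel sets rules this out.\<close>

lemma emeasure_hausdorff_measure: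
  assumes "A \<in> sets borel"
  shows "emeasure (hausdorff_measure s) A = hausdorff_outer s A"
  using measure_space_hausdorff_outer[of s] assms
  by (intro emeasure_measure_of[OF hausdorff_measure_def]) (auto simp: measure_space_def hausdorff_measure_def[symmetric])

text \<open>A cover of \<open>A\<close> at scale \<open>\<delta> / c\<close> is pushed forward to a
  cover of the image at scale \<open>\<delta>\<close>, and each gauge grows at most by the factor
  \<open>c ^ s\<close>.\<close>

lemma hausdorff_outer_lipschitz_image:
  fixes h :: "'a::metric_space \<Rightarrow> 'b::metric_space"
  assumes "0 < c" and lip: "\<And>x y. x \<in> A \<Longrightarrow> y \<in> A \<Longrightarrow> dist (h x) (h y) \<le> c * dist x y"
  shows "hausdorff_outer s (h ` A) \<le> ennreal (c ^ s) * hausdorff_outer s A"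
  unfolding hausdorff_outer_def[of s "h ` A"]
proof (rule SUP_least)
  fix \<delta> :: real assume "\<delta> \<in> {0<..}"
  then have \<delta>: "0 < \<delta> / c" using assms by auto
  have "hausdorff_content s \<delta> (h ` A) \<le> ennreal (c ^ s) * hausdorff_content s (\<delta> / c) A"
  proof (rule ennreal_le_epsilon)
    fix e :: real assume "0 < e" and top: "ennreal (c ^ s) * hausdorff_content s (\<delta> / c) A < top"
    have c: "0 < c ^ s" using assms by simp
    \<comment> \<open>As \<open>0 * top = 0\<close> in \<open>ennreal\<close>, a finite product
      gives a finite content only because \<open>c ^ s\<close> is not 0.\<close>
    have "hausdorff_content s (\<delta> / c) A < top"
    proof (rule ccontr)
      assume "\<not> ?thesis"
      then have "hausdorff_content s (\<delta> / c) A = top" by (metis less_top)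
      moreover have "ennreal (c ^ s) \<noteq> 0" using c by (simp add: ennreal_eq_0_iff)
      ultimately show False using top by (simp only: ennreal_mult_top if_False less_irrefl)
    qed
    then have "hausdorff_content s (\<delta> / c) A < hausdorff_content s (\<delta> / c) A + ennreal (e / c ^ s)"
      using \<open>0 < e\<close> c by (simp add: less_top)
    then obtain U :: "nat \<Rightarrow> 'a set" where U: "A \<subseteq> (\<Union>i. U i)" "\<And>i. bounded (U i)"
        "\<And>i. diameter (U i) \<le> \<delta> / c"
        "(\<Sum>i. hausdorff_gauge s (U i)) < hausdorff_content s (\<delta> / c) A + ennreal (e / c ^ s)"
      by (rule hausdorff_content_less_cover) blast
    \<comment> \<open>The covering sets may leave \<open>A\<close>, but the Lipschitz bound holds on
      \<open>A\<close> only.\<close>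
    define V where "V i = h ` (U i \<inter> A)" for i
    have dV: "dist x y \<le> c * diameter (U i)" if "x \<in> V i" "y \<in> V i" for x y i
    proof -
      obtain x' y' where x': "x' \<in> U i" "x' \<in> A" "y' \<in> U i" "y' \<in> A" "x = h x'" "y = h y'"
        using \<open>x \<in> V i\<close> \<open>y \<in> V i\<close> unfolding V_def by blast
      have "dist x y \<le> c * dist x' y'" using lip x' by simp
      also have "\<dots> \<le> c * diameter (U i)"
        using assms(1) U(2) x' by (intro mult_left_mono diameter_bounded_bound) auto
      finally show ?thesis .
    qed
    have diamV: "diameter (V i) \<le> c * diameter (U i)" for i
      unfolding diameter_def[of "V i"]
      using dV assms(1) diameter_ge_0[OF U(2)] by (auto intro!: cSUP_least)
    have bV: "bounded (V i)" for i
      using dV unfolding bounded_two_points by blast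
    have "hausdorff_content s \<delta> (h ` A) \<le> (\<Sum>i. hausdorff_gauge s (V i))"
    proof (rule hausdorff_content_le)
      show "h ` A \<subseteq> (\<Union>i. V i)" using U(1) by (fastforce simp: V_def)
      show "diameter (V i) \<le> \<delta>" for i
        using order_trans[OF diamV mult_left_mono[OF U(3)]] assms(1) by simp
    qed (rule bV)
    also have "\<dots> \<le> (\<Sum>i. ennreal (c ^ s) * hausdorff_gauge s (U i))"
    proof (intro suminf_le)
      fix i
      show "hausdorff_gauge s (V i) \<le> ennreal (c ^ s) * hausdorff_gauge s (U i)"
      proof (cases "V i = {}")
        case False
        then have "U i \<noteq> {}" by (auto simp: V_def)
        have "hausdorff_gauge s (V i) \<le> ennreal (unit_ball_vol (real s) * (c * diameter (U i) / 2) ^ s)"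
          by (rule hausdorff_gauge_le[OF bV diamV])
        also have "\<dots> = ennreal (c ^ s) * hausdorff_gauge s (U i)"
          using \<open>U i \<noteq> {}\<close> c diameter_ge_0[OF U(2), of i]
          by (simp add: hausdorff_gauge_def ennreal_mult[symmetric] power_mult_distrib power_divide mult_ac)
        finally show ?thesis .
      qed simp
    qed auto
    also have "\<dots> = ennreal (c ^ s) * (\<Sum>i. hausdorff_gauge s (U i))"
      by simp
    also have "\<dots> \<le> ennreal (c ^ s) * (hausdorff_content s (\<delta> / c) A + ennreal (e / c ^ s))"
      using U(4) by (intro mult_left_mono) auto
    also have "\<dots> = ennreal (c ^ s) * hausdorff_content s (\<delta> / c) A + ennreal e"
    proof -
      have "ennreal (c ^ s) * ennreal (e / c ^ s) = ennreal (c ^ s * (e / c ^ s))"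
        using c \<open>0 < e\<close> by (intro ennreal_mult[symmetric]) auto
      also have "c ^ s * (e / c ^ s) = e" using assms(1) by simp
      finally show ?thesis by (simp only: distrib_left)
    qed
    finally show "hausdorff_content s \<delta> (h ` A)
      \<le> ennreal (c ^ s) * hausdorff_content s (\<delta> / c) A + ennreal e" .
  qed
  also have "\<dots> \<le> ennreal (c ^ s) * hausdorff_outer s A"
    by (intro mult_left_mono hausdorff_content_le_outer \<delta>) auto
  finally show "hausdorff_content s \<delta> (h ` A) \<le> ennreal (c ^ s) * hausdorff_outer s A" .
qed

text \<open>The Lipschitz bound is applied to \<open>h\<close> and, with constant
  \<open>1 / c\<close>, to its inverse on the image.\<close>

lemma hausdorff_outer_similarity_image:
  fixes h :: "'a::metric_space \<Rightarrow> 'b::metric_space"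
  assumes "0 < c" and sim: "\<And>x y. x \<in> A \<Longrightarrow> y \<in> A \<Longrightarrow> dist (h x) (h y) = c * dist x y"
  shows "hausdorff_outer s (h ` A) = ennreal (c ^ s) * hausdorff_outer s A"
proof (rule antisym)
  show "hausdorff_outer s (h ` A) \<le> ennreal (c ^ s) * hausdorff_outer s A"
    using assms by (intro hausdorff_outer_lipschitz_image) auto
  have inj: "inj_on h A"
  proof (rule inj_onI)
    fix x y assume "x \<in> A" "y \<in> A" "h x = h y"
    then show "x = y" using sim[of x y] assms(1) by simp
  qed
  have "hausdorff_outer s (inv_into A h ` h ` A) \<le> ennreal ((1 / c) ^ s) * hausdorff_outer s (h ` A)"
  proof (rule hausdorff_outer_lipschitz_image)
    fix x y assume "x \<in> h ` A" "y \<in> h ` A"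
    then show "dist (inv_into A h x) (inv_into A h y) \<le> 1 / c * dist x y"
      using sim assms(1) inj by auto
  qed (use assms in auto)
  then have "hausdorff_outer s A \<le> ennreal ((1 / c) ^ s) * hausdorff_outer s (h ` A)"
    using inj by simp
  then have "ennreal (c ^ s) * hausdorff_outer s A
      \<le> ennreal (c ^ s) * (ennreal ((1 / c) ^ s) * hausdorff_outer s (h ` A))"
    by (intro mult_left_mono) auto
  also have "\<dots> = hausdorff_outer s (h ` A)"
    using assms(1) by (simp add: mult.assoc[symmetric] ennreal_mult[symmetric] power_mult_distrib[symmetric])
  finally show "ennreal (c ^ s) * hausdorff_outer s A \<le> hausdorff_outer s (h ` A)" .
qed

section \<open>The Hausdorff measure of spheres\<close>

text \<open>A cube of dimension \<open>card (- D)\<close> kept inside the full space, so that the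
  dimension can vary while the type stays fixed.\<close>

definition flat_cube :: "'n set \<Rightarrow> real \<Rightarrow> (real ^ 'n) set" where
  "flat_cube D a = {x. (\<forall>l\<in>D. x $ l = 0) \<and> (\<forall>l. \<bar>x $ l\<bar> \<le> a)}"

text \<open>A grid of \<open>N ^ m\<close> cells of side \<open>2 / N\<close>, with
  \<open>m = card (- D)\<close>, has total gauge at most
  \<open>N ^ m * unit_ball_vol m * (n / N) ^ m\<close>, where \<open>n = CARD('n)\<close>. The
  powers of \<open>N\<close> cancel, so the bound does not depend on the scale.\<close>

lemma hausdorff_outer_flat_cube_finite:
  fixes D :: "'n::finite set"
  shows "hausdorff_outer (card (- D)) (flat_cube D 1) < \<infinity>"
proof -
  let ?n = "real CARD('n)" and ?m = "card (- D)"
  let ?c = "unit_ball_vol (real ?m) * ?n ^ ?m"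
  have "hausdorff_content ?m \<delta> (flat_cube D 1) \<le> ennreal ?c" if "0 < \<delta>" for \<delta>
  proof -
    obtain N :: nat where N: "2 * ?n / \<delta> < real N" using reals_Archimedean2 by blast
    have "0 \<le> 2 * ?n / \<delta>" using that by simp
    then have N0: "0 < real N" using N by linarith
    have Nd: "2 * ?n / real N \<le> \<delta>" using N N0 that by (simp add: field_simps)
    let ?I = "PiE (- D) (\<lambda>_. {..<N})"
    define cell :: "('n \<Rightarrow> nat) \<Rightarrow> (real ^ 'n) set" where "cell k = {x \<in> flat_cube D 1. \<forall>l\<in>-D. x $ l \<in> {-1 + 2 * real (k l) / N .. -1 + 2 * (real (k l) + 1) / N}}" for k
    have dist_cell: "dist x y \<le> 2 * ?n / real N" if "x \<in> cell k" "y \<in> cell k" for x y k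
    proof -
      have "\<bar>(x - y) $ l\<bar> \<le> 2 / real N" for l
      proof (cases "l \<in> D")
        case True then show ?thesis using that by (simp add: cell_def flat_cube_def)
      next
        case False
        then have "x $ l \<in> {-1 + 2 * real (k l) / N .. -1 + 2 * (real (k l) + 1) / N}"
          "y $ l \<in> {-1 + 2 * real (k l) / N .. -1 + 2 * (real (k l) + 1) / N}" using that unfolding cell_def by blast+
        moreover have "-1 + 2 * (real (k l) + 1) / N = -1 + 2 * real (k l) / N + 2 / N"
          by (simp add: add_divide_distrib distrib_left)
        ultimately show ?thesis unfolding vector_minus_component atLeastAtMost_iff by linarith
      qed
      then have "(\<Sum>l\<in>UNIV. \<bar>(x - y) $ l\<bar>) \<le> ?n * (2 / real N)"
        by (intro sum_bounded_above) auto
      then show ?thesis using norm_le_l1_cart[of "x - y"] by (simp add: dist_norm mult.commute)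
    qed
    have bcell: "bounded (cell k)" for k
      unfolding bounded_two_points using dist_cell by blast
    have dcell: "diameter (cell k) \<le> 2 * ?n / real N" for k
      using dist_cell[of _ k] by (intro diameter_le) (auto simp: dist_norm)
    have cover: "flat_cube D 1 \<subseteq> \<Union> (cell ` ?I)"
    proof
      fix x assume x: "x \<in> flat_cube D 1"
      have "\<exists>i<N. x $ l \<in> {-1 + 2 * real i / N .. -1 + 2 * (real i + 1) / N}" for l
      proof -
        have xl: "-1 \<le> x $ l" "x $ l \<le> 1" using x by (auto simp: flat_cube_def abs_le_iff minus_le_iff)
        let ?t = "(x $ l + 1) * N / 2"
        show ?thesis
        proof (cases "x $ l = 1")
          \<comment> \<open>At the right end point the floor would give the index \<open>N\<close>,
            outside the grid; the point belongs to the last cell.\<close>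
          case True
          have "N - 1 < N" using N0 by simp
          moreover have "real (N - 1) + 1 = N" using N0 by simp
          ultimately show ?thesis using True N0
            by (intro exI[of _ "N - 1"]) (auto simp: field_simps)
        next
          case False
          have "0 \<le> x $ l + 1" "x $ l + 1 < 2" using xl False by linarith+
          then have t: "0 \<le> ?t" "?t < N" using N0 by (simp_all add: mult.commute)
          define i where "i = nat \<lfloor>?t\<rfloor>"
          have "real i \<le> ?t" "?t < real i + 1" using t(1) unfolding i_def by linarith+
          moreover have "i < N" using calculation t by linarith
          ultimately show ?thesis using N0 by (intro exI[of _ i]) (auto simp: field_simps)
        qed
      qed
      then obtain k where k: "\<And>l. k l < N" "\<And>l. x $ l \<in> {-1 + 2 * real (k l) / N .. -1 + 2 * (real (k l) + 1) / N}"
        by metis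
      have "restrict k (- D) \<in> ?I" "x \<in> cell (restrict k (- D))"
        using k x by (auto simp: cell_def)
      then show "x \<in> \<Union> (cell ` ?I)" by blast
    qed
    have cardI: "card (cell ` ?I) \<le> N ^ ?m"
      using card_image_le[of ?I cell] by (simp add: card_PiE finite_PiE)
    have "hausdorff_content ?m \<delta> (flat_cube D 1) \<le> (\<Sum>U\<in>cell ` ?I. hausdorff_gauge ?m U)"
      using cover bcell order_trans[OF dcell Nd] that
      by (intro hausdorff_content_finite_cover) (auto intro!: finite_PiE)
    also have "\<dots> \<le> of_nat (card (cell ` ?I)) * ennreal (unit_ball_vol (real ?m) * (2 * ?n / N / 2) ^ ?m)"
    proof (rule sum_bounded_above)
      fix U assume "U \<in> cell ` ?I"
      then obtain k where "U = cell k" by blast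
      then show "hausdorff_gauge ?m U \<le> ennreal (unit_ball_vol (real ?m) * (2 * ?n / N / 2) ^ ?m)"
        using hausdorff_gauge_le[OF bcell dcell] by simp
    qed
    also have "\<dots> \<le> of_nat (N ^ ?m) * ennreal (unit_ball_vol (real ?m) * (2 * ?n / N / 2) ^ ?m)"
      using cardI by (intro mult_right_mono) (auto simp: of_nat_le_iff simp del: of_nat_power)
    also have "\<dots> = ennreal (real N ^ ?m) * ennreal (unit_ball_vol (real ?m) * (2 * ?n / N / 2) ^ ?m)"
      by (simp add: ennreal_of_nat_eq_real_of_nat del: of_nat_power) simp
    also have "\<dots> = ennreal (real N ^ ?m * (unit_ball_vol (real ?m) * (2 * ?n / N / 2) ^ ?m))"
      by (intro ennreal_mult[symmetric]) auto
    also have "real N ^ ?m * (unit_ball_vol (real ?m) * (2 * ?n / N / 2) ^ ?m) = ?c"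
      using N0 by (simp add: power_divide)
    finally show ?thesis .
  qed
  then have "hausdorff_outer ?m (flat_cube D 1) \<le> ennreal ?c"
    unfolding hausdorff_outer_def by (auto intro!: SUP_least)
  then show ?thesis using ennreal_less_top[of ?c] unfolding infinity_ennreal_def by (rule order_le_less_trans)
qed

text \<open>
  Thickening each covering set of the flat cube by \<open>a\<close> in the directions of \<open>D\<close> gives boxes that
  cover a full-dimensional cube, whose Lebesgue measure bounds the sum of the gauges from below.
\<close>

lemma hausdorff_outer_flat_cube_pos:
  fixes D :: "'n::finite set"
  assumes "0 < a"
  shows "0 < hausdorff_outer (card (- D)) (flat_cube D a)"
proof (rule ccontr)
  let ?m = "card (- D)"
  \<comment> \<open>The box around \<open>U i\<close> has sides \<open>2 * a\<close> in the
    directions of \<open>D\<close> and \<open>2 * diameter (U i) = 4 * (diameter (U i) / 2)\<close>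
    in the others, so its volume is \<open>C\<close> times the gauge of \<open>U i\<close>.\<close>
  define C where "C = (2 * a) ^ card D * 4 ^ ?m / unit_ball_vol (real ?m)"
  have ub: "0 < unit_ball_vol (real ?m)" by simp
  then have ubn: "unit_ball_vol (real ?m) \<noteq> 0" by (rule less_imp_neq[symmetric])
  have C: "0 < C" using assms ub by (simp add: C_def)
  \<comment> \<open>Chosen such that \<open>C * e\<close> is half the volume of the full cube
    \<open>?Q\<close> below.\<close>
  define e where "e = (2 * a) ^ CARD('n) / (2 * C)"
  have e: "0 < e" using C assms by (simp add: e_def)
  assume "\<not> ?thesis"
  then have "hausdorff_outer ?m (flat_cube D a) = 0" by (simp add: not_less)
  then have "hausdorff_content ?m 1 (flat_cube D a) \<le> 0"
    using hausdorff_content_le_outer[of 1 ?m "flat_cube D a"] by simp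
  then have "hausdorff_content ?m 1 (flat_cube D a) < ennreal e"
    using e by (simp add: order_le_less_trans)
  then obtain U :: "nat \<Rightarrow> (real ^ 'n) set" where U: "flat_cube D a \<subseteq> (\<Union>i. U i)"
    "\<And>i. bounded (U i)" "(\<Sum>i. hausdorff_gauge ?m (U i)) < ennreal e"
    by (rule hausdorff_content_less_cover) blast
  define x where "x i = (SOME x. x \<in> U i)" for i
  have x: "x i \<in> U i" if "U i \<noteq> {}" for i using that unfolding x_def by (simp add: some_in_eq)
  define B where "B i = (if U i = {} then {} else
     cbox (\<chi> l. if l \<in> D then - a else x i $ l - diameter (U i)) (\<chi> l. if l \<in> D then a else x i $ l + diameter (U i)))" for i
  let ?Q = "cbox (\<chi> l. - a) (\<chi> l. a) :: (real ^ 'n) set"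
  have cover: "?Q \<subseteq> (\<Union>i. B i)"
  proof
    fix y assume "y \<in> ?Q"
    then have y: "\<And>l. - a \<le> y $ l \<and> y $ l \<le> a" by (simp add: mem_box_cart)
    define y' :: "real ^ 'n" where "y' = (\<chi> l. if l \<in> D then 0 else y $ l)"
    have "y' \<in> flat_cube D a" using y assms by (auto simp: flat_cube_def y'_def abs_le_iff minus_le_iff)
    then obtain i where i: "y' \<in> U i" using U(1) by blast
    then have "dist y' (x i) \<le> diameter (U i)" using U(2) x by (intro diameter_bounded_bound) auto
    then have *: "\<bar>(y' - x i) $ l\<bar> \<le> diameter (U i)" for l
      using component_le_norm_cart[of "y' - x i" l] unfolding dist_norm by linarith
    have "\<bar>y $ l - x i $ l\<bar> \<le> diameter (U i)" if "l \<notin> D" for l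
      using that *[of l] by (simp add: y'_def)
    then have "y \<in> B i" using i y by (force simp: B_def mem_box_cart abs_le_iff)
    then show "y \<in> (\<Union>i. B i)" by blast
  qed
  have fin_cbox: "emeasure lborel (cbox u v) \<noteq> top" for u v :: "real ^ 'n"
    using emeasure_lborel_cbox_finite[of u v] by (metis infinity_ennreal_def less_irrefl)
  have vol_B: "emeasure lborel (B i) = ennreal C * hausdorff_gauge ?m (U i)" for i
  proof (cases "U i = {}")
    case False
    have d: "0 \<le> diameter (U i)" by (rule diameter_ge_0[OF U(2)])
    let ?a = "\<chi> l. if l \<in> D then - a else x i $ l - diameter (U i)" and ?b = "\<chi> l. if l \<in> D then a else x i $ l + diameter (U i)"
    have ne: "cbox ?a ?b \<noteq> {}" using d assms by (auto simp: interval_ne_empty_cart)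
    have "measure lborel (cbox ?a ?b) = (\<Prod>l\<in>UNIV. ?b $ l - ?a $ l)"
      by (rule content_cbox_cart[OF ne])
    also have "\<dots> = (\<Prod>l\<in>UNIV. if l \<in> D then 2 * a else 2 * diameter (U i))"
      by (intro prod.cong) auto
    also have "\<dots> = (2 * a) ^ card D * (2 * diameter (U i)) ^ ?m"
      by (subst prod.If_cases) (auto simp: Compl_eq)
    also have "\<dots> = C * (unit_ball_vol (real ?m) * (diameter (U i) / 2) ^ ?m)"
    proof -
      have "(2 * diameter (U i)) ^ ?m = (4 * (diameter (U i) / 2)) ^ ?m" by simp
      also have "\<dots> = 4 ^ ?m * (diameter (U i) / 2) ^ ?m" by (rule power_mult_distrib)
      finally show ?thesis using ubn by (simp add: C_def)
    qed
    finally have "emeasure lborel (cbox ?a ?b) = ennreal (C * (unit_ball_vol (real ?m) * (diameter (U i) / 2) ^ ?m))"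
      using fin_cbox by (subst emeasure_eq_ennreal_measure) simp_all
    then show ?thesis using False C d by (simp add: B_def hausdorff_gauge_def ennreal_mult)
  qed (simp add: B_def)
  have neQ: "?Q \<noteq> {}" using assms by (auto simp: interval_ne_empty_cart)
  have "ennreal ((2 * a) ^ CARD('n)) = emeasure lborel ?Q"
    using content_cbox_cart[OF neQ] fin_cbox
    by (subst emeasure_eq_ennreal_measure) simp_all
  also have "\<dots> \<le> emeasure lborel (\<Union>i. B i)"
    using cover by (intro emeasure_mono) (auto simp: B_def)
  also have "\<dots> \<le> (\<Sum>i. emeasure lborel (B i))"
    by (intro emeasure_subadditive_countably) (auto simp: B_def)
  also have "\<dots> = ennreal C * (\<Sum>i. hausdorff_gauge ?m (U i))"
    unfolding vol_B by simp
  also have "\<dots> \<le> ennreal C * ennreal e"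
    using U(3) by (intro mult_left_mono) auto
  also have "\<dots> = ennreal ((2 * a) ^ CARD('n) / 2)"
    using C e assms ubn by (subst ennreal_mult[symmetric]) (auto simp: e_def)
  finally have "(2 * a) ^ CARD('n) \<le> (2 * a) ^ CARD('n) / 2"
    using assms by (subst (asm) ennreal_le_iff) auto
  moreover have "0 < (2 * a) ^ CARD('n)" using assms by simp
  ultimately show False by linarith
qed

text \<open>The difference splits into \<open>(p - q) / norm p\<close> and a multiple of
  \<open>q\<close> that corrects the length; each part has norm at most
  \<open>norm (p - q) / norm p\<close>. Thus radial projection is Lipschitz outside the open unit
  ball.\<close>

lemma dist_sgn_le:
  fixes p q :: "'a::real_normed_vector"
  assumes "1 \<le> norm p" "1 \<le> norm q"
  shows "dist (sgn p) (sgn q) \<le> 2 * dist p q"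
proof -
  have p: "0 < norm p" and q: "0 < norm q" using assms by linarith+
  have q1: "q \<noteq> 0" using q by auto
  have "sgn p - sgn q = (p - q) /\<^sub>R norm p + (inverse (norm p) - inverse (norm q)) *\<^sub>R q"
    by (simp add: sgn_div_norm algebra_simps)
  then have "norm (sgn p - sgn q) \<le> norm (p - q) / norm p + \<bar>inverse (norm p) - inverse (norm q)\<bar> * norm q"
    using norm_triangle_ineq[of "(p - q) /\<^sub>R norm p" "(inverse (norm p) - inverse (norm q)) *\<^sub>R q"]
    by (simp add: divide_inverse_commute)
  also have "inverse (norm p) - inverse (norm q) = (norm q - norm p) / (norm p * norm q)"
    using p q by (simp add: divide_simps)
  also have "\<bar>(norm q - norm p) / (norm p * norm q)\<bar> * norm q = \<bar>norm q - norm p\<bar> / norm p"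
    using p q by (simp add: abs_mult)
  also have "norm (p - q) / norm p + \<bar>norm q - norm p\<bar> / norm p \<le> norm (p - q) / norm p + norm (p - q) / norm p"
    using p norm_triangle_ineq3[of q p] by (intro add_left_mono divide_right_mono) (auto simp: norm_minus_commute)
  also have "\<dots> \<le> norm (p - q) + norm (p - q)"
    using assms(1) by (intro add_mono) (auto simp: divide_le_eq mult_le_cancel_left1 p)
  finally show ?thesis by (simp add: dist_norm)
qed

text \<open>The whole sphere for \<open>D = {}\<close> and an equator for a singleton, so that one
  argument covers the surface and the sections.\<close>

definition coordinate_sphere :: "'n set \<Rightarrow> (real ^ 'n) set" where
  "coordinate_sphere D = {x. norm x = 1 \<and> (\<forall>l\<in>D. x $ l = 0)}"

text \<open>Dividing a point by its coordinate of largest modulus moves it to a face of the cube.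
  The sphere is therefore covered by the radial projections of finitely many faces, which are
  Lipschitz images of flat cubes of one dimension less.\<close>

lemma hausdorff_outer_coordinate_sphere_finite:
  fixes D :: "'n::finite set"
  shows "hausdorff_outer (CARD('n) - card D - 1) (coordinate_sphere D) < \<infinity>"
proof -
  let ?m = "CARD('n) - card D - 1"
  let ?g = "\<lambda>p y. sgn (y + snd p *\<^sub>R axis (fst p) 1) :: real ^ 'n"
  let ?K = "\<lambda>p. flat_cube (insert (fst p) D) 1"
  let ?I = "(- D) \<times> {-1, 1 :: real}"
  have cover: "coordinate_sphere D \<subseteq> (\<Union>p\<in>?I. ?g p ` ?K p)"
  proof
    fix x :: "real ^ 'n" assume x: "x \<in> coordinate_sphere D"
      have "\<exists>j. \<forall>l. \<bar>x $ l\<bar> \<le> \<bar>x $ j\<bar>"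
    proof -
      have "Max (range (\<lambda>l. \<bar>x $ l\<bar>)) \<in> range (\<lambda>l. \<bar>x $ l\<bar>)" by (rule Max_in) auto
      then obtain j where "Max (range (\<lambda>l. \<bar>x $ l\<bar>)) = \<bar>x $ j\<bar>" by blast
      then show ?thesis by (metis Max_ge finite finite_imageI rangeI)
    qed
    then obtain j where j: "\<And>l. \<bar>x $ l\<bar> \<le> \<bar>x $ j\<bar>" by blast
    have xj: "x $ j \<noteq> 0"
    proof
      assume "x $ j = 0"
      then have "x = 0" using j by (simp add: vec_eq_iff)
      then show False using x by (simp add: coordinate_sphere_def)
    qed
    then have jD: "j \<notin> D" using x by (auto simp: coordinate_sphere_def)
    \<comment> \<open>The position within the face: the coordinate \<open>j\<close>, which is now 1
      or -1, is removed and restored by \<open>?g\<close>.\<close>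
    define y where "y = x /\<^sub>R \<bar>x $ j\<bar> - sgn (x $ j) *\<^sub>R axis j 1"
    have yj: "y $ j = 0" using xj by (simp add: y_def axis_def sgn_real_def)
    have yl: "y $ l = x $ l / \<bar>x $ j\<bar>" if "l \<noteq> j" for l
      using that by (simp add: y_def axis_def field_simps)
    have "\<bar>y $ l\<bar> \<le> 1" for l
      using j[of l] xj yj yl[of l] by (cases "l = j") auto
    moreover have "y $ l = 0" if "l \<in> insert j D" for l
      using that yj yl[of l] x by (cases "l = j") (auto simp: coordinate_sphere_def)
    ultimately have "y \<in> ?K (j, sgn (x $ j))" by (auto simp: flat_cube_def)
    moreover have "?g (j, sgn (x $ j)) y = x"
      using x xj by (simp add: y_def coordinate_sphere_def sgn_scaleR) (simp add: sgn_div_norm)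
    moreover have "(j, sgn (x $ j)) \<in> ?I" using jD xj by (auto simp: sgn_real_def)
    ultimately show "x \<in> (\<Union>p\<in>?I. ?g p ` ?K p)" by (metis (no_types, lifting) UN_I imageI)
  qed
  have fin: "hausdorff_outer ?m (?g p ` ?K p) < \<infinity>" if "p \<in> ?I" for p
  proof -
    have "hausdorff_outer ?m (?g p ` ?K p) \<le> ennreal (2 ^ ?m) * hausdorff_outer ?m (?K p)"
    proof (rule hausdorff_outer_lipschitz_image)
      fix x y assume "x \<in> ?K p" "y \<in> ?K p"
      then have "\<bar>(x + snd p *\<^sub>R axis (fst p) 1) $ fst p\<bar> = 1" "\<bar>(y + snd p *\<^sub>R axis (fst p) 1) $ fst p\<bar> = 1"
        using that by (auto simp: flat_cube_def axis_def)
      then have "1 \<le> norm (x + snd p *\<^sub>R axis (fst p) 1)" "1 \<le> norm (y + snd p *\<^sub>R axis (fst p) 1)"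
        using component_le_norm_cart by metis+
      from dist_sgn_le[OF this] show "dist (?g p x) (?g p y) \<le> 2 * dist x y" by (simp add: dist_norm)
    qed simp
    also have "\<dots> < \<infinity>"
    proof -
      have "card (- insert (fst p) D) = ?m" using that by (auto simp: Compl_eq_Diff_UNIV card_Diff_subset card_insert_if)
      then have "hausdorff_outer ?m (?K p) < \<infinity>"
        using hausdorff_outer_flat_cube_finite[of "insert (fst p) D"] by simp
      then show ?thesis by (simp add: ennreal_mult_less_top)
    qed
    finally show ?thesis .
  qed
  have "hausdorff_outer ?m (coordinate_sphere D) \<le> (\<Sum>p\<in>?I. hausdorff_outer ?m (?g p ` ?K p))"
    using order_trans[OF hausdorff_outer_mono[OF cover] hausdorff_outer_UN_le] by simp
  also have "\<dots> < \<infinity>" using fin by simp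
  finally show ?thesis .
qed

text \<open>Dropping a coordinate \<open>j\<close> outside \<open>D\<close> is a Lipschitz map whose
  image of the sphere contains a small flat cube of the right dimension, so the sphere cannot be
  null.\<close>

lemma hausdorff_outer_coordinate_sphere_pos:
  fixes D :: "'n::finite set"
  assumes "D \<noteq> UNIV"
  shows "0 < hausdorff_outer (CARD('n) - card D - 1) (coordinate_sphere D)"
proof -
  let ?m = "CARD('n) - card D - 1" and ?n = "real CARD('n)"
  obtain j where j: "j \<notin> D" using assms by blast
  let ?p = "\<lambda>x. x - x $ j *\<^sub>R axis j 1 :: real ^ 'n"
  \<comment> \<open>With half side \<open>1 / ?n\<close> the l1 bound puts the cube inside the unit
    ball, and each of its points lifts to the sphere along axis \<open>j\<close>.\<close>
  let ?K = "flat_cube (insert j D) (1 / ?n)"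
  have "?K \<subseteq> ?p ` coordinate_sphere D"
  proof
    fix y assume y: "y \<in> ?K"
    have "norm y \<le> (\<Sum>l\<in>UNIV. \<bar>y $ l\<bar>)" by (rule norm_le_l1_cart)
    also have "\<dots> \<le> ?n * (1 / ?n)" using y by (intro sum_bounded_above) (auto simp: flat_cube_def)
    finally have y1: "norm y \<le> 1" by simp
    then have y2: "0 \<le> 1 - (norm y)\<^sup>2" by (simp add: power_le_one)
    have yj: "y $ j = 0" using y by (simp add: flat_cube_def)
    define x where "x = y + sqrt (1 - (norm y)\<^sup>2) *\<^sub>R axis j 1"
    have "y \<bullet> axis j 1 = 0" using yj by (simp add: inner_axis)
    then have "(norm x)\<^sup>2 = (norm y)\<^sup>2 + (1 - (norm y)\<^sup>2)"
      using y2 by (simp add: x_def power2_norm_eq_inner inner_add_left inner_add_right inner_commute axis_def[symmetric] inner_axis_axis)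
    then have "norm x = 1 \<or> norm x = - 1" by (simp add: power2_eq_1_iff)
    then have "norm x = 1" using norm_ge_zero[of x] by linarith
    moreover have "x $ l = 0" if "l \<in> D" for l
      using that y j by (auto simp: x_def flat_cube_def axis_def)
    ultimately have "x \<in> coordinate_sphere D" by (simp add: coordinate_sphere_def)
    moreover have "y = ?p x" using yj by (simp add: x_def axis_def[symmetric])
    ultimately show "y \<in> ?p ` coordinate_sphere D" by blast
  qed
  moreover have "hausdorff_outer ?m (?p ` coordinate_sphere D) \<le> ennreal (2 ^ ?m) * hausdorff_outer ?m (coordinate_sphere D)"
  proof (rule hausdorff_outer_lipschitz_image)
    fix x y :: "real ^ 'n"
    have eq: "?p x - ?p y = (x - y) - (x - y) $ j *\<^sub>R axis j 1" by (simp add: algebra_simps)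
    have "norm (?p x - ?p y) \<le> norm (x - y) + \<bar>(x - y) $ j\<bar>"
      unfolding eq using norm_triangle_ineq4[of "x - y" "(x - y) $ j *\<^sub>R axis j 1"] by simp
    also have "\<dots> \<le> 2 * norm (x - y)" using component_le_norm_cart[of "x - y" j] by simp
    finally show "dist (?p x) (?p y) \<le> 2 * dist x y" by (simp add: dist_norm)
  qed simp
  ultimately have K: "hausdorff_outer ?m ?K \<le> ennreal (2 ^ ?m) * hausdorff_outer ?m (coordinate_sphere D)"
    by (rule order_trans[OF hausdorff_outer_mono])
  have "card (- insert j D) = ?m" using j by (auto simp: Compl_eq_Diff_UNIV card_Diff_subset card_insert_if)
  then have "0 < hausdorff_outer ?m ?K"
    using hausdorff_outer_flat_cube_pos[of "1 / ?n" "insert j D"] by simp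
  with K show ?thesis by (metis mult_zero_right not_gr_zero not_less)
qed

section \<open>Reflections and great spheres\<close>

text \<open>The Householder reflection in the hyperplane orthogonal to \<open>w\<close>. For
  \<open>w = 0\<close> it is the identity, so \<open>reflection (u - v)\<close> makes sense also
  when \<open>u = v\<close>.\<close>

definition reflection :: "'a::real_inner \<Rightarrow> 'a \<Rightarrow> 'a" where
  "reflection w x = x - (2 * (x \<bullet> w) / (w \<bullet> w)) *\<^sub>R w"

lemma linear_reflection: "linear (reflection w)"
proof (rule linearI)
  show "reflection w (x + y) = reflection w x + reflection w y" for x y
    unfolding reflection_def by (simp add: inner_add_left distrib_left add_divide_distrib scaleR_add_left)
  show "reflection w (c *\<^sub>R x) = c *\<^sub>R reflection w x" for c x
    unfolding reflection_def by (simp add: scaleR_diff_right)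
qed

lemma inner_reflection [simp]: "reflection w x \<bullet> reflection w y = x \<bullet> y"
proof (cases "w = 0")
  case False
  define W where "W = w \<bullet> w"
  have "W \<noteq> 0" using False by (simp add: W_def)
  have "reflection w x \<bullet> reflection w y
      = x \<bullet> y - 2 * (y \<bullet> w) / W * (x \<bullet> w) - 2 * (x \<bullet> w) / W * (y \<bullet> w)
        + 2 * (x \<bullet> w) / W * (2 * (y \<bullet> w) / W) * W"
    by (simp add: reflection_def inner_diff_left inner_diff_right inner_commute[of w x] inner_commute[of w y] W_def)
  also have "\<dots> = x \<bullet> y" using \<open>W \<noteq> 0\<close> by (simp add: field_simps)
  finally show ?thesis .
qed (simp add: reflection_def)

lemma norm_reflection [simp]: "norm (reflection w x) = norm x"
  unfolding norm_eq_sqrt_inner by simp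

lemma dist_reflection [simp]: "dist (reflection w x) (reflection w y) = dist x y"
proof -
  have "reflection w x - reflection w y = reflection w (x - y)"
    using linear_diff[OF linear_reflection] by metis
  then show ?thesis by (simp add: dist_norm)
qed

lemma reflection_reflection [simp]: "reflection w (reflection w x) = x"
  by (cases "w = 0") (simp_all add: reflection_def inner_diff_left)

lemma inner_reflection_left: "reflection w x \<bullet> y = x \<bullet> reflection w y"
  by (metis inner_reflection reflection_reflection)

text \<open>Equal norms give \<open>(u - v) \<bullet> (u - v) = 2 * (u \<bullet> (u - v))\<close>.
  Together with \<open>reflection_diff_fixes\<close> this moves any point of an equator to any other
  while its pole stays fixed, which is all the transitivity that is required of the rotation
  group.\<close>

lemma reflection_diff:
  assumes "norm u = norm v"
  shows "reflection (u - v) u = v"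
proof (cases "u = v")
  case False
  then have "(u - v) \<bullet> (u - v) \<noteq> 0" by simp
  moreover have "u \<bullet> u = v \<bullet> v" using assms by (metis power2_norm_eq_inner)
  then have "(u - v) \<bullet> (u - v) = 2 * (u \<bullet> (u - v))"
    by (simp add: inner_diff_left inner_diff_right inner_commute)
  ultimately show ?thesis by (simp add: reflection_def)
qed (simp add: reflection_def)

lemma reflection_diff_fixes: "x \<bullet> u = x \<bullet> v \<Longrightarrow> reflection (u - v) x = x"
  by (simp add: reflection_def inner_diff_right)

text \<open>The choice \<open>\<xi> = 0\<close> is allowed and yields the whole unit sphere.\<close>

definition great_sphere :: "'a::real_inner \<Rightarrow> 'a set" where
  "great_sphere \<xi> = {u. norm u = 1 \<and> u \<bullet> \<xi> = 0}"

lemma great_sphere_0: "great_sphere 0 = sphere 0 1"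
  by (auto simp: great_sphere_def)

lemma compact_great_sphere: "compact (great_sphere (\<xi> :: 'a::euclidean_space))"
proof -
  have "great_sphere \<xi> = sphere 0 1 \<inter> {u. \<xi> \<bullet> u = 0}"
    by (auto simp: great_sphere_def inner_commute)
  then show ?thesis by (simp add: compact_Int_closed closed_hyperplane)
qed

lemma reflection_image_great_sphere: "reflection w ` great_sphere \<xi> = great_sphere (reflection w \<xi>)"
proof -
  have "x \<in> reflection w ` great_sphere \<xi>" if "x \<in> great_sphere (reflection w \<xi>)" for x
    using that by (intro image_eqI[of _ _ "reflection w x"]) (auto simp: great_sphere_def inner_reflection_left)
  then show ?thesis by (auto simp: great_sphere_def)
qed

lemma hausdorff_outer_reflection_image:
  "hausdorff_outer s (reflection w ` A) = hausdorff_outer s A"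
  using hausdorff_outer_similarity_image[of 1 A "reflection w" s] by simp

definition great_sphere_dim :: "real ^ 'n \<Rightarrow> nat" where
  "great_sphere_dim \<xi> = CARD('n) - (if \<xi> = 0 then 1 else 2)"

lemma hausdorff_outer_great_sphere_eq:
  fixes \<xi> \<eta> :: "'a::real_inner"
  assumes "norm \<xi> = norm \<eta>"
  shows "hausdorff_outer s (great_sphere \<xi>) = hausdorff_outer s (great_sphere \<eta>)"
  using hausdorff_outer_reflection_image[of s "\<xi> - \<eta>" "great_sphere \<xi>"]
    reflection_image_great_sphere[of "\<xi> - \<eta>" \<xi>] reflection_diff[OF assms] by simp

text \<open>A reflection carries \<open>\<xi>\<close> to a coordinate axis, which reduces the claim
  to coordinate spheres. In the plane the equator is a pair of points and the dimension is
  0.\<close>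

lemma hausdorff_outer_great_sphere:
  fixes \<xi> :: "real ^ 'n"
  assumes "\<xi> = 0 \<or> norm \<xi> = 1" and "CARD('n) \<ge> 2"
  shows "0 < hausdorff_outer (great_sphere_dim \<xi>) (great_sphere \<xi>)"
    and "hausdorff_outer (great_sphere_dim \<xi>) (great_sphere \<xi>) < \<infinity>"
proof -
  obtain D :: "'n set" where D: "card D = (if \<xi> = 0 then 0 else 1)"
    "hausdorff_outer (great_sphere_dim \<xi>) (great_sphere \<xi>) = hausdorff_outer (great_sphere_dim \<xi>) (coordinate_sphere D)"
  proof (cases "\<xi> = 0")
    case True
    then have "great_sphere \<xi> = coordinate_sphere {}"
      by (auto simp: great_sphere_def coordinate_sphere_def)
    with True show ?thesis by (intro that[of "{}"]) auto
  next
    case False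
    fix i :: 'n
    have "hausdorff_outer (great_sphere_dim \<xi>) (great_sphere \<xi>)
        = hausdorff_outer (great_sphere_dim \<xi>) (great_sphere (axis i 1 :: real ^ 'n))"
      using False assms(1) by (intro hausdorff_outer_great_sphere_eq) simp
    moreover have "great_sphere (axis i 1 :: real ^ 'n) = coordinate_sphere {i}"
      by (auto simp: great_sphere_def coordinate_sphere_def inner_axis)
    ultimately show ?thesis using False by (intro that[of "{i}"]) auto
  qed
  have "D \<noteq> UNIV" using D(1) assms(2) by (auto split: if_splits)
  moreover have "great_sphere_dim \<xi> = CARD('n) - card D - 1"
    using D(1) by (auto simp: great_sphere_dim_def)
  ultimately show "0 < hausdorff_outer (great_sphere_dim \<xi>) (great_sphere \<xi>)"
    and "hausdorff_outer (great_sphere_dim \<xi>) (great_sphere \<xi>) < \<infinity>"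
    using hausdorff_outer_coordinate_sphere_pos[of D] hausdorff_outer_coordinate_sphere_finite[of D] D(2)
    by simp_all
qed

section \<open>Uniformly distributed measures\<close>

text \<open>A substitute for rotation invariance: it determines the measure up to a factor
  (\<open>uniformly_distributed_unique\<close>) and is easy to check for measures that arise from
  different constructions on the same sphere.\<close>

locale uniformly_distributed = finite_measure M
  for M :: "'a::{metric_space, second_countable_topology} measure" +
  fixes X :: "'a set"
  assumes sets_eq: "sets M = sets (restrict_space borel X)"
    and compact: "compact X"
    and uniform: "\<And>x y r. x \<in> X \<Longrightarrow> y \<in> X \<Longrightarrow> measure M (X \<inter> ball x r) = measure M (X \<inter> ball y r)"
begin

lemma space_eq: "space M = X"
  using sets_eq_imp_space_eq[OF sets_eq] by (simp add: space_restrict_space)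

lemma borel_measurable_id: "(\<lambda>x. x) \<in> borel_measurable M"
  unfolding measurable_cong_sets[OF sets_eq refl]
  by (rule measurable_restrict_space1) simp

lemma borel_measurable_continuous:
  assumes "continuous_on X (h :: 'a \<Rightarrow> 'b::topological_space)"
  shows "h \<in> borel_measurable M"
  unfolding measurable_cong_sets[OF sets_eq refl]
  using assms by (rule borel_measurable_continuous_on_restrict)

lemma integrable_continuous:
  fixes h :: "'a \<Rightarrow> real"
  assumes "continuous_on X h"
  shows "integrable M h"
proof -
  have "bounded (h ` X)" using assms compact by (intro compact_imp_bounded compact_continuous_image)
  then obtain B where "\<And>x. x \<in> X \<Longrightarrow> norm (h x) \<le> B" by (auto simp: bounded_iff)
  then show ?thesis
    using assms space_eq by (intro integrable_const_bound[of _ B, OF AE_I2] borel_measurable_continuous) simp_all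
qed

lemma ball_sets: "X \<inter> ball x r \<in> sets M"
  unfolding sets_eq sets_restrict_space by (intro image_eqI[of _ _ "ball x r"]) simp_all

text \<open>Finitely many balls of radius \<open>r\<close> cover the compact set \<open>X\<close>,
  all of the same measure, so a null ball would make \<open>X\<close> null.\<close>

lemma measure_ball_pos:
  assumes "measure M X \<noteq> 0" "x \<in> X" "0 < r"
  shows "0 < measure M (X \<inter> ball x r)"
proof (rule ccontr)
  assume "\<not> ?thesis"
  then have z: "measure M (X \<inter> ball y r) = 0" if "y \<in> X" for y
    using uniform[OF that assms(2), of r] measure_nonneg[of M "X \<inter> ball x r"] by linarith
  obtain F where F: "F \<subseteq> X" "finite F" "X \<subseteq> (\<Union>y\<in>F. ball y r)"
  proof (rule compactE_image[OF compact, of X "\<lambda>y. ball y r"])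
    show "X \<subseteq> (\<Union>c\<in>X. ball c r)" using assms(3) by force
  qed auto
  have "X = (\<Union>y\<in>F. X \<inter> ball y r)" using F by blast
  then have "measure M X \<le> (\<Sum>y\<in>F. measure M (X \<inter> ball y r))"
    using finite_measure_subadditive_finite[of F "\<lambda>y. X \<inter> ball y r"] F(2) ball_sets by auto
  also have "\<dots> = 0" using z F(1) by (intro sum.neutral) auto
  finally show False using assms(1) measure_nonneg[of M X] by linarith
qed

end

text \<open>The library version of this bound is restricted to Euclidean domains.\<close>

lemma integral_abs_le_integral:
  fixes f g :: "'a \<Rightarrow> real"
  assumes "integrable M f" "integrable M g" "\<And>x. x \<in> space M \<Longrightarrow> \<bar>f x\<bar> \<le> g x"
  shows "\<bar>LINT x|M. f x\<bar> \<le> (LINT x|M. g x)"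
proof -
  have "\<bar>LINT x|M. f x\<bar> \<le> (LINT x|M. \<bar>f x\<bar>)"
    using integral_norm_bound[of M f] by simp
  also have "\<dots> \<le> (LINT x|M. g x)"
    using assms by (intro integral_mono) auto
  finally show ?thesis .
qed

text \<open>
  Double integration of \<open>indicator (dist x y < r) * h y\<close> against \<open>M \<Otimes> N\<close>: one order of
  integration gives a multiple of \<open>LINT y|N. h y\<close>, the other one, up to the oscillation of \<open>h\<close>
  on balls of radius \<open>r\<close>, a multiple of \<open>LINT x|M. h x\<close>.
\<close>

lemma uniformly_distributed_unique:
  fixes h :: "'a::{metric_space, second_countable_topology} \<Rightarrow> real"
  assumes "uniformly_distributed M X" "uniformly_distributed N X" "continuous_on X h"
  shows "measure N X * (LINT x|M. h x) = measure M X * (LINT x|N. h x)"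
proof (cases "measure N X = 0 \<or> X = {}")
  case True
  interpret N: uniformly_distributed N X by fact
  interpret M: uniformly_distributed M X by fact
  have z: "measure N X = 0" using True by auto
  then have "emeasure N (space N) = 0" by (simp add: N.space_eq N.emeasure_eq_measure)
  then have "AE x in N. False" by (simp add: AE_iff_measurable[of "space N"])
  then have "(LINT x|N. h x) = (LINT x|N. 0)"
    by (intro integral_cong_AE) (auto intro: N.borel_measurable_continuous assms)
  then show ?thesis using z by simp
next
  case False
  then have N0: "measure N X \<noteq> 0" "X \<noteq> {}" by auto
  interpret N: uniformly_distributed N X by fact
  interpret M: uniformly_distributed M X by fact
  interpret P: pair_sigma_finite M N ..
  interpret PF: finite_measure "M \<Otimes>\<^sub>M N"
    by (rule finite_measure_pair_measure) (unfold_locales)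
  note [measurable] = M.borel_measurable_id N.borel_measurable_id
  obtain a where a: "a \<in> X" using N0 by blast
  define k :: "real \<Rightarrow> 'a \<Rightarrow> 'a \<Rightarrow> real" where "k r x y = indicator (ball x r) y" for r x y
  define I where "I h = (LINT y|N. h y)" for h :: "'a \<Rightarrow> real"
  define J where "J h = (LINT x|M. h x)" for h :: "'a \<Rightarrow> real"
  define m where "m r = measure M (X \<inter> ball a r)" for r
  define n where "n r = measure N (X \<inter> ball a r)" for r
  have dist_meas: "(\<lambda>p. dist (fst p) (snd p)) \<in> borel_measurable (M \<Otimes>\<^sub>M N)"
    by measurable
  have k_meas: "(\<lambda>p. k r (fst p) (snd p)) \<in> borel_measurable (M \<Otimes>\<^sub>M N)" for r
    unfolding k_def indicator_def mem_ball using dist_meas by measurable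
  have kN: "(\<lambda>y. k r x y) \<in> borel_measurable N" for r x
    unfolding k_def indicator_def mem_ball by measurable
  have kM: "(\<lambda>x. k r x y) \<in> borel_measurable M" for r y
    unfolding k_def indicator_def mem_ball by measurable
  have Ik: "(LINT y|N. k r x y) = n r" if "x \<in> X" for r x
  proof -
    have "(LINT y|N. k r x y) = (LINT y|N. indicator (X \<inter> ball x r) y)"
      by (intro Bochner_Integration.integral_cong) (auto simp: k_def N.space_eq split: split_indicator)
    also have "\<dots> = measure N (X \<inter> ball x r)"
      using N.ball_sets N.space_eq by (simp add: Int_commute Int_left_absorb)
    finally show ?thesis using N.uniform[OF that a] by (simp add: n_def)
  qed
  have Jk: "(LINT x|M. k r x y) = m r" if "y \<in> X" for r y
  proof -
    have "(LINT x|M. k r x y) = (LINT x|M. indicator (X \<inter> ball y r) x)"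
      by (intro Bochner_Integration.integral_cong) (auto simp: k_def M.space_eq dist_commute split: split_indicator)
    also have "\<dots> = measure M (X \<inter> ball y r)"
      using M.ball_sets M.space_eq by (simp add: Int_commute Int_left_absorb)
    finally show ?thesis using M.uniform[OF that a] by (simp add: m_def)
  qed
  have n_pos: "0 < n r" if "0 < r" for r
    unfolding n_def using N.measure_ball_pos[OF N0(1) a that] .
  have bdd: "\<exists>B. \<forall>x\<in>X. \<bar>h x\<bar> \<le> B" if "continuous_on X h" for h :: "'a \<Rightarrow> real"
    using compact_imp_bounded[OF compact_continuous_image[OF that M.compact]] by (auto simp: bounded_iff)
  have swap: "m r * I h = (LINT x|M. (LINT y|N. k r x y * h y))" if hc: "continuous_on X h" for h r
  proof -
    obtain B where B: "\<And>x. x \<in> X \<Longrightarrow> \<bar>h x\<bar> \<le> B" using bdd[OF hc] by auto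
    have [measurable]: "h \<in> borel_measurable N" using hc by (rule N.borel_measurable_continuous)
    have "integrable (M \<Otimes>\<^sub>M N) (\<lambda>p. k r (fst p) (snd p) * h (snd p))"
    proof (rule PF.integrable_const_bound[of _ B])
      show "(\<lambda>p. k r (fst p) (snd p) * h (snd p)) \<in> borel_measurable (M \<Otimes>\<^sub>M N)"
        using k_meas by measurable
      show "AE p in M \<Otimes>\<^sub>M N. norm (k r (fst p) (snd p) * h (snd p)) \<le> B"
      proof (rule AE_I2)
        fix p assume "p \<in> space (M \<Otimes>\<^sub>M N)"
        then have "\<bar>h (snd p)\<bar> \<le> B" using B by (auto simp: space_pair_measure N.space_eq)
        then show "norm (k r (fst p) (snd p) * h (snd p)) \<le> B"
          by (auto simp: k_def split: split_indicator)
      qed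
    qed
    then have "integrable (M \<Otimes>\<^sub>M N) (case_prod (\<lambda>x y. k r x y * h y))"
      by (simp add: case_prod_beta')
    from P.Fubini_integral[OF this]
    have "(LINT x|M. (LINT y|N. k r x y * h y)) = (LINT y|N. (LINT x|M. k r x y * h y))" by simp
    also have "\<dots> = (LINT y|N. m r * h y)"
      by (intro Bochner_Integration.integral_cong) (auto simp: Jk N.space_eq)
    finally show ?thesis by (simp add: I_def)
  qed
  \<comment> \<open>The case \<open>h = 1\<close> ties the ratio of the ball measures to that of the
    total masses, so that \<open>approx\<close> compares normalised integrals.\<close>
  have total: "m r * measure N X = n r * measure M X" for r
  proof -
    have "(LINT x|M. (LINT y|N. k r x y * 1)) = (LINT x|M. n r)"
      by (intro Bochner_Integration.integral_cong) (auto simp: Ik M.space_eq)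
    then show ?thesis using swap[of "\<lambda>_. 1" r] N.space_eq M.space_eq by (simp add: I_def mult.commute)
  qed
  have approx: "\<bar>m r * I h - n r * J h\<bar> \<le> e * n r * measure M X"
    if e: "\<And>x y. x \<in> X \<Longrightarrow> y \<in> X \<Longrightarrow> dist x y < r \<Longrightarrow> \<bar>h y - h x\<bar> \<le> e" for e r
  proof -
    obtain B where B: "\<And>x. x \<in> X \<Longrightarrow> \<bar>h x\<bar> \<le> B" using bdd[OF assms(3)] by auto
    have [measurable]: "h \<in> borel_measurable N" "h \<in> borel_measurable M"
      using assms(3) by (auto intro: N.borel_measurable_continuous M.borel_measurable_continuous)
    have k1: "norm (k r x y) \<le> 1" for x y by (simp add: k_def split: split_indicator)
    have int_k: "integrable N (\<lambda>y. k r x y)" for x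
      using k1 kN by (intro N.integrable_const_bound[of _ 1]) auto
    have int_kh: "integrable N (\<lambda>y. k r x y * h y)" for x
    proof (rule N.integrable_const_bound[of _ B])
      show "AE y in N. norm (k r x y * h y) \<le> B"
        using B by (intro AE_I2) (force simp: k_def N.space_eq split: split_indicator)
      show "(\<lambda>y. k r x y * h y) \<in> borel_measurable N" using kN by measurable
    qed
    have inner: "\<bar>(LINT y|N. k r x y * h y) - n r * h x\<bar> \<le> e * n r" if x: "x \<in> X" for x
    proof -
      have "(LINT y|N. k r x y * h y) - n r * h x = (LINT y|N. k r x y * h y) - (LINT y|N. k r x y * h x)"
        using Ik[OF x] by simp
      also have "\<dots> = (LINT y|N. k r x y * h y - k r x y * h x)"
        using int_kh int_k by (intro Bochner_Integration.integral_diff[symmetric]) auto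
      also have "\<bar>\<dots>\<bar> \<le> (LINT y|N. e * k r x y)"
      proof (intro integral_abs_le_integral)
        show "integrable N (\<lambda>y. k r x y * h y - k r x y * h x)" "integrable N (\<lambda>y. e * k r x y)"
          using int_kh int_k by auto
        fix y assume "y \<in> space N"
        then show "\<bar>k r x y * h y - k r x y * h x\<bar> \<le> e * k r x y"
          using e[of x y] x by (auto simp: k_def N.space_eq split: split_indicator)
      qed
      also have "\<dots> = e * n r" using Ik[OF x] by simp
      finally show ?thesis .
    qed
    have meas: "(\<lambda>x. LINT y|N. k r x y * h y) \<in> borel_measurable M"
      using k_meas by (intro N.borel_measurable_lebesgue_integral) (simp add: split_beta')
    have intM: "integrable M (\<lambda>x. LINT y|N. k r x y * h y)"
    proof (rule M.integrable_const_bound[OF AE_I2 meas])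
      fix x assume "x \<in> space M"
      then have x: "x \<in> X" by (simp add: M.space_eq)
      have "\<bar>n r * h x\<bar> \<le> n r * B" using B[OF x] by (simp add: abs_mult n_def mult_left_mono)
      then show "norm (LINT y|N. k r x y * h y) \<le> e * n r + n r * B" using inner[OF x] by simp
    qed
    have inth: "integrable M h" using assms(3) by (rule M.integrable_continuous)
    have "m r * I h - n r * J h = (LINT x|M. (LINT y|N. k r x y * h y) - n r * h x)"
      unfolding swap[OF assms(3)] J_def using intM inth by (subst Bochner_Integration.integral_diff) auto
    also have "\<bar>\<dots>\<bar> \<le> (LINT x|M. e * n r)"
      using intM inth inner by (intro integral_abs_le_integral) (auto simp: M.space_eq)
    also have "\<dots> = e * n r * measure M X" by (simp add: M.space_eq)
    finally show ?thesis .
  qed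
  have "\<bar>measure M X * I h - measure N X * J h\<bar> \<le> e * (measure N X * measure M X)" if "0 < e" for e
  proof -
    have "uniformly_continuous_on X h" by (rule compact_uniformly_continuous[OF assms(3) M.compact])
    then obtain r where r: "0 < r" "\<And>x y. x \<in> X \<Longrightarrow> y \<in> X \<Longrightarrow> dist x y < r \<Longrightarrow> \<bar>h y - h x\<bar> \<le> e"
      using \<open>0 < e\<close> unfolding uniformly_continuous_on_def dist_real_def
      by (metis dist_commute less_imp_le)
    \<comment> \<open>The error is proportional to \<open>n r > 0\<close>, so this factor cancels
      although it may tend to 0 with \<open>r\<close>.\<close>
    have "n r * \<bar>measure M X * I h - measure N X * J h\<bar> = \<bar>n r * measure M X * I h - n r * measure N X * J h\<bar>"
      using n_pos[OF r(1)] by (simp add: abs_mult right_diff_distrib[symmetric] mult.assoc)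
    also have "\<dots> = \<bar>measure N X * (m r * I h - n r * J h)\<bar>"
      unfolding total[symmetric] by (simp add: algebra_simps)
    also have "\<dots> \<le> measure N X * (e * n r * measure M X)"
      using approx[OF r(2)] by (simp add: abs_mult mult_left_mono)
    also have "\<dots> = n r * (e * (measure N X * measure M X))" by (simp add: mult_ac)
    finally show ?thesis using n_pos[OF r(1)] by simp
  qed
  then have "\<bar>measure M X * I h - measure N X * J h\<bar> \<le> 0"
  proof -
    assume *: "\<And>e. 0 < e \<Longrightarrow> \<bar>measure M X * I h - measure N X * J h\<bar> \<le> e * (measure N X * measure M X)"
    let ?c = "measure N X * measure M X + 1"
    have c: "0 < ?c" by (simp add: add_nonneg_pos)
    show ?thesis
    proof (rule field_le_epsilon)
      fix e :: real assume "0 < e"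
      have "\<bar>measure M X * I h - measure N X * J h\<bar> \<le> e / ?c * (measure N X * measure M X)"
        using c \<open>0 < e\<close> by (intro *) simp
      also have "\<dots> \<le> e / ?c * ?c" using c \<open>0 < e\<close> by (intro mult_left_mono) auto
      finally show "\<bar>measure M X * I h - measure N X * J h\<bar> \<le> 0 + e" using c by simp
    qed
  qed
  then show ?thesis by (simp add: I_def J_def)
qed

section \<open>Surface measure and section integrals\<close>

definition surface :: "real ^ 'n \<Rightarrow> (real ^ 'n) measure" where
  "surface \<xi> = restrict_space (hausdorff_measure (great_sphere_dim \<xi>)) (great_sphere \<xi>)"

lemma great_sphere_borel [measurable]: "great_sphere (\<xi> :: 'a::euclidean_space) \<in> sets borel"
  by (intro borel_closed compact_imp_closed compact_great_sphere)

lemma sets_surface: "sets (surface \<xi>) = sets (restrict_space borel (great_sphere \<xi>))"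
  unfolding surface_def by (rule sets_restrict_space_cong) simp

lemma space_surface [simp]: "space (surface \<xi>) = great_sphere \<xi>"
  by (simp add: surface_def space_restrict_space)

lemma sets_surface_iff: "A \<in> sets (surface \<xi>) \<longleftrightarrow> A \<in> sets borel \<and> A \<subseteq> great_sphere \<xi>"
  unfolding sets_surface by (subst sets_restrict_space_iff) auto

lemma emeasure_surface:
  assumes "A \<in> sets borel" "A \<subseteq> great_sphere \<xi>"
  shows "emeasure (surface \<xi>) A = hausdorff_outer (great_sphere_dim \<xi>) A"
  unfolding surface_def using assms
  by (subst emeasure_restrict_space) (simp_all add: emeasure_hausdorff_measure)

lemma sphere_measure_eq_surface: "sphere_measure = surface 0"
  by (simp add: sphere_measure_def surface_def great_sphere_dim_def great_sphere_0)

text \<open>For an involution preimages are images, so invariance of the outer measure under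
  isometries gives invariance of \<open>surface\<close>. Reflections and the antipodal map are both
  instances.\<close>

lemma distr_surface_involution:
  fixes h :: "real ^ 'n \<Rightarrow> real ^ 'n"
  assumes dist: "\<And>x y. dist (h x) (h y) = dist x y" and inv: "\<And>x. h (h x) = x"
    and image: "h ` great_sphere \<xi> = great_sphere \<eta>" and dim: "great_sphere_dim \<xi> = great_sphere_dim \<eta>"
  shows "distr (surface \<xi>) (surface \<eta>) h = surface \<eta>" and "h \<in> measurable (surface \<xi>) (surface \<eta>)"
proof -
  have cont: "continuous_on UNIV h"
    unfolding continuous_on_iff using dist by metis
  have pre: "h -` A \<inter> great_sphere \<xi> = h ` A" if "A \<subseteq> great_sphere \<eta>" for A
  proof -
    have "h x \<in> great_sphere \<xi>" if "x \<in> A" for x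
      using that \<open>A \<subseteq> great_sphere \<eta>\<close> image inv by (metis imageE subsetD)
    moreover have "x \<in> h ` A" if "h x \<in> A" for x using that inv by (metis imageI)
    ultimately show ?thesis using inv by auto
  qed
  have bor: "h ` A \<in> sets borel" if "A \<in> sets borel" for A
  proof -
    have "h ` A = h -` A" using inv by (auto intro: image_eqI[of _ h "h x" for x])
    then show ?thesis
      using measurable_sets[OF borel_measurable_continuous_onI[OF cont] that] by simp
  qed
  show meas: "h \<in> measurable (surface \<xi>) (surface \<eta>)"
  proof (rule measurableI)
    show "h x \<in> space (surface \<eta>)" if "x \<in> space (surface \<xi>)" for x using that image by auto
    show "h -` A \<inter> space (surface \<xi>) \<in> sets (surface \<xi>)" if "A \<in> sets (surface \<eta>)" for A
    proof -
      have "A \<in> sets borel" "A \<subseteq> great_sphere \<eta>" using that by (auto simp: sets_surface_iff)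
      then show ?thesis using pre[of A] bor[of A] by (auto simp: sets_surface_iff)
    qed
  qed
  show "distr (surface \<xi>) (surface \<eta>) h = surface \<eta>"
  proof (rule measure_eqI)
    fix A assume "A \<in> sets (distr (surface \<xi>) (surface \<eta>) h)"
    then have A: "A \<in> sets (surface \<eta>)" "A \<in> sets borel" "A \<subseteq> great_sphere \<eta>"
      by (auto simp: sets_surface_iff)
    have "emeasure (distr (surface \<xi>) (surface \<eta>) h) A = emeasure (surface \<xi>) (h ` A)"
      using A meas pre[OF A(3)] by (simp add: emeasure_distr)
    also have "\<dots> = hausdorff_outer (great_sphere_dim \<xi>) (h ` A)"
      using bor[OF A(2)] pre[OF A(3)] by (intro emeasure_surface) auto
    also have "\<dots> = hausdorff_outer (great_sphere_dim \<xi>) A"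
      using hausdorff_outer_similarity_image[of 1 A h "great_sphere_dim \<xi>"] dist by simp
    also have "\<dots> = emeasure (surface \<eta>) A"
      using A dim by (simp add: emeasure_surface)
    finally show "emeasure (distr (surface \<xi>) (surface \<eta>) h) A = emeasure (surface \<eta>) A" .
  qed simp
qed

lemma great_sphere_dim_eq:
  fixes \<xi> \<eta> :: "real ^ 'n"
  shows "norm \<xi> = norm \<eta> \<Longrightarrow> great_sphere_dim \<xi> = great_sphere_dim \<eta>"
  by (cases "\<xi> = 0") (auto simp: great_sphere_dim_def)

lemma distr_surface_reflection:
  "distr (surface \<xi>) (surface (reflection w \<xi>)) (reflection w) = surface (reflection w \<xi>)"
  "reflection w \<in> measurable (surface \<xi>) (surface (reflection w \<xi>))"
proof -
  have "great_sphere_dim \<xi> = great_sphere_dim (reflection w \<xi>)"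
    by (rule great_sphere_dim_eq) simp
  then show "distr (surface \<xi>) (surface (reflection w \<xi>)) (reflection w) = surface (reflection w \<xi>)"
    "reflection w \<in> measurable (surface \<xi>) (surface (reflection w \<xi>))"
    using distr_surface_involution[of "reflection w" \<xi> "reflection w \<xi>"] reflection_image_great_sphere[of w \<xi>]
    by simp_all
qed

lemma distr_surface_uminus:
  "distr (surface \<xi>) (surface \<xi>) uminus = surface \<xi>" "uminus \<in> measurable (surface \<xi>) (surface \<xi>)"
proof -
  have "uminus ` great_sphere \<xi> = great_sphere \<xi>"
  proof -
    have "x \<in> uminus ` great_sphere \<xi>" if "x \<in> great_sphere \<xi>" for x
      using that by (intro image_eqI[of _ _ "- x"]) (auto simp: great_sphere_def)
    then show ?thesis by (auto simp: great_sphere_def)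
  qed
  then show "distr (surface \<xi>) (surface \<xi>) uminus = surface \<xi>" "uminus \<in> measurable (surface \<xi>) (surface \<xi>)"
    using distr_surface_involution[of uminus \<xi> \<xi>] by (simp_all add: dist_minus)
qed

text \<open>The reflection that swaps \<open>x\<close> and \<open>y\<close> fixes
  \<open>\<xi>\<close>, because both are orthogonal to it. It preserves the measure and carries one
  ball to the other.\<close>

lemma uniformly_distributed_surface:
  fixes \<xi> :: "real ^ 'n"
  assumes "\<xi> = 0 \<or> norm \<xi> = 1" "CARD('n) \<ge> 2"
  shows "uniformly_distributed (surface \<xi>) (great_sphere \<xi>)"
proof (intro uniformly_distributed.intro uniformly_distributed_axioms.intro)
  have "emeasure (surface \<xi>) (space (surface \<xi>)) < \<infinity>"
    using hausdorff_outer_great_sphere(2)[OF assms] by (simp add: emeasure_surface)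
  then show "finite_measure (surface \<xi>)" by (intro finite_measureI) simp
  show "sets (surface \<xi>) = sets (restrict_space borel (great_sphere \<xi>))" by (rule sets_surface)
  show "compact (great_sphere \<xi>)" by (rule compact_great_sphere)
  fix x y r assume x: "x \<in> great_sphere \<xi>" and y: "y \<in> great_sphere \<xi>"
  define T where "T = reflection (x - y)"
  have T: "T x = y" "T \<xi> = \<xi>" "\<And>u. T (T u) = u" "\<And>u v. dist (T u) (T v) = dist u v"
    using x y by (auto simp: T_def great_sphere_def inner_commute intro!: reflection_diff reflection_diff_fixes)
  have dT: "distr (surface \<xi>) (surface \<xi>) T = surface \<xi>" "T \<in> measurable (surface \<xi>) (surface \<xi>)"
    using distr_surface_reflection(1)[of \<xi> "x - y"] distr_surface_reflection(2)[of "x - y" \<xi>] T(2) by (simp_all add: T_def)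
  have "emeasure (surface \<xi>) (great_sphere \<xi> \<inter> ball y r) = emeasure (distr (surface \<xi>) (surface \<xi>) T) (great_sphere \<xi> \<inter> ball y r)"
    using dT by simp
  also have "\<dots> = emeasure (surface \<xi>) (T -` (great_sphere \<xi> \<inter> ball y r) \<inter> great_sphere \<xi>)"
    using dT(2) by (subst emeasure_distr) (auto simp: sets_surface_iff)
  also have "T -` (great_sphere \<xi> \<inter> ball y r) \<inter> great_sphere \<xi> = great_sphere \<xi> \<inter> ball x r"
  proof -
    have "T u \<in> great_sphere \<xi>" if "u \<in> great_sphere \<xi>" for u
      using measurable_space[OF dT(2)] that by simp
    moreover have "dist y (T u) = dist x u" for u using T(4)[of x u] T(1) by simp
    ultimately show ?thesis by auto
  qed
  finally show "measure (surface \<xi>) (great_sphere \<xi> \<inter> ball x r) = measure (surface \<xi>) (great_sphere \<xi> \<inter> ball y r)"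
    by (simp add: measure_def)
qed

lemma measure_surface_pos:
  fixes \<xi> :: "real ^ 'n"
  assumes "\<xi> = 0 \<or> norm \<xi> = 1" "CARD('n) \<ge> 2"
  shows "0 < measure (surface \<xi>) (great_sphere \<xi>)"
proof -
  have "emeasure (surface \<xi>) (great_sphere \<xi>) = hausdorff_outer (great_sphere_dim \<xi>) (great_sphere \<xi>)"
    by (rule emeasure_surface) auto
  then show ?thesis
    using hausdorff_outer_great_sphere[OF assms] unfolding measure_def enn2real_positive_iff by simp
qed

text \<open>The part of the section integral that remains after rescaling each section to unit radius.\<close>

definition slice :: "real \<Rightarrow> (real ^ 'n \<Rightarrow> real) \<Rightarrow> real ^ 'n \<Rightarrow> real" where
  "slice z g \<xi> = (LINT u|surface \<xi>. g (z *\<^sub>R \<xi> + sqrt (1 - z\<^sup>2) *\<^sub>R u))"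

lemma slice_point_norm:
  assumes "norm \<xi> = 1" "u \<in> great_sphere \<xi>" "\<bar>z\<bar> \<le> 1"
  shows "norm (z *\<^sub>R \<xi> + sqrt (1 - z\<^sup>2) *\<^sub>R u) = 1"
proof -
  have "z\<^sup>2 \<le> 1" using assms(3) by (simp only: abs_square_le_1)
  moreover have "\<xi> \<bullet> \<xi> = 1" "u \<bullet> u = 1" "u \<bullet> \<xi> = 0"
    using assms unfolding great_sphere_def norm_eq_1 by simp_all
  ultimately show ?thesis
    unfolding norm_eq_1
    by (simp add: inner_add_left inner_add_right inner_commute[of \<xi> u]) (simp add: power2_eq_square)
qed

text \<open>The map \<open>h\<close> is a similarity of ratio \<open>sqrt (1 - z\<^sup>2)\<close>
  from the equator onto the section, so it scales the Hausdorff measure by this ratio to the power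
  \<open>CARD('n) - 2\<close>.\<close>

lemma section_integral_eq_slice:
  fixes f :: "real ^ 'n \<Rightarrow> real"
  assumes "norm \<xi> = 1" "\<bar>z\<bar> < 1" "continuous_on (sphere 0 1) f" "CARD('n) \<ge> 2"
  shows "section_integral f \<xi> z = sqrt (1 - z\<^sup>2) ^ (CARD('n) - 2) * slice z f \<xi>"
proof -
  let ?m = "CARD('n) - 2"
  let ?H = "hausdorff_measure ?m :: (real ^ 'n) measure"
  define s where "s = sqrt (1 - z\<^sup>2)"
  define h where "h u = z *\<^sub>R \<xi> + s *\<^sub>R u" for u
  have z1: "z\<^sup>2 < 1" using assms(2) by (simp only: abs_square_less_1)
  then have s: "0 < s" "s\<^sup>2 = 1 - z\<^sup>2" by (auto simp: s_def)
  have dim: "great_sphere_dim \<xi> = ?m" using assms(1) by (auto simp: great_sphere_dim_def)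
  define Sl where "Sl = sphere 0 1 \<inter> angular_cone \<xi> z"
  have xi: "\<xi> \<bullet> \<xi> = 1" using assms(1) unfolding norm_eq_1 .
  have Sl: "Sl = {x. norm x = 1 \<and> x \<bullet> \<xi> = z}"
  proof -
    have "cos (angle \<xi> x) = x \<bullet> \<xi>" if "norm x = 1" for x
    proof -
      have "\<bar>\<xi> \<bullet> x\<bar> \<le> 1" using Cauchy_Schwarz_ineq2[of \<xi> x] that assms(1) by simp
      then have "cos (arccos (\<xi> \<bullet> x)) = \<xi> \<bullet> x" by (rule cos_arccos_abs)
      then show ?thesis unfolding angle_def assms(1) that inner_commute[of x \<xi>] by simp
    qed
    then show ?thesis unfolding Sl_def angular_cone_def by force
  qed
  have hS: "h u \<in> Sl" if "u \<in> great_sphere \<xi>" for u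
  proof -
    have "norm (h u) = 1" using slice_point_norm[OF assms(1) that, of z] assms(2) by (simp add: h_def s_def)
    moreover have "h u \<bullet> \<xi> = z" using that xi by (simp add: h_def inner_add_left great_sphere_def)
    ultimately show ?thesis by (simp add: Sl)
  qed
  have pre: "x \<in> h ` (h -` A \<inter> great_sphere \<xi>)" if "x \<in> A" "A \<subseteq> Sl" for x A
  proof -
    have x: "x \<bullet> x = 1" "x \<bullet> \<xi> = z" using that unfolding Sl norm_eq_1 by blast+
    define u where "u = (x - z *\<^sub>R \<xi>) /\<^sub>R s"
    have "h u = x" using s by (simp add: h_def u_def)
    moreover have "(x - z *\<^sub>R \<xi>) \<bullet> (x - z *\<^sub>R \<xi>) = s\<^sup>2"
      using x xi s(2) by (simp add: inner_diff_left inner_diff_right inner_commute[of \<xi> x] power2_eq_square)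
    then have "norm (x - z *\<^sub>R \<xi>) = s" using s(1) by (simp only: norm_eq_sqrt_inner real_sqrt_abs abs_of_pos)
    then have "norm u = 1" using s(1) by (simp add: u_def)
    moreover have "u \<bullet> \<xi> = 0" using x xi by (simp add: u_def inner_diff_left)
    ultimately show ?thesis using that(1) by (intro image_eqI[of _ _ u]) (auto simp: great_sphere_def)
  qed
  have dh: "dist (h x) (h y) = s * dist x y" for x y
    using s(1) by (simp add: h_def dist_norm scaleR_diff_right[symmetric])
  have Slb: "Sl \<in> sets borel"
  proof -
    have "Sl = sphere 0 1 \<inter> {x. \<xi> \<bullet> x = z}" by (auto simp: Sl inner_commute)
    then have "closed Sl" by (simp add: closed_Int closed_hyperplane)
    then show ?thesis by simp
  qed
  let ?R = "restrict_space ?H Sl"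
  have setsR: "A \<in> sets ?R \<longleftrightarrow> A \<in> sets borel \<and> A \<subseteq> Sl" for A
    using Slb by (subst sets_restrict_space_iff) auto
  have hm: "h \<in> borel_measurable borel" unfolding h_def by measurable
  have preb: "h -` A \<inter> great_sphere \<xi> \<in> sets borel" if "A \<in> sets borel" for A
    using measurable_sets[OF hm that] by simp
  have meas: "h \<in> measurable (surface \<xi>) ?R"
  proof (rule measurableI)
    show "h u \<in> space ?R" if "u \<in> space (surface \<xi>)" for u
      using that hS by (simp add: space_restrict_space)
    show "h -` A \<inter> space (surface \<xi>) \<in> sets (surface \<xi>)" if "A \<in> sets ?R" for A
      using that preb[of A] by (simp add: setsR sets_surface_iff)
  qed
  have "distr (surface \<xi>) ?R h = density ?R (\<lambda>_. ennreal ((1 / s) ^ ?m))"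
  proof (rule measure_eqI)
    fix A assume "A \<in> sets (distr (surface \<xi>) ?R h)"
    then have A: "A \<in> sets ?R" "A \<in> sets borel" "A \<subseteq> Sl" by (auto simp: setsR)
    let ?B = "h -` A \<inter> great_sphere \<xi>"
    have hB: "h ` ?B = A" using pre[OF _ A(3)] by blast
    have "hausdorff_outer ?m A = ennreal (s ^ ?m) * hausdorff_outer ?m ?B"
      using hausdorff_outer_similarity_image[OF s(1), of ?B h ?m] dh hB by simp
    moreover have "ennreal ((1 / s) ^ ?m) * ennreal (s ^ ?m) = 1"
      using s(1) by (simp add: ennreal_mult[symmetric] power_mult_distrib[symmetric])
    ultimately have "ennreal ((1 / s) ^ ?m) * hausdorff_outer ?m A = hausdorff_outer ?m ?B"
      by (metis mult.assoc mult_1)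
    moreover have "emeasure (distr (surface \<xi>) ?R h) A = hausdorff_outer ?m ?B"
      using A meas preb[OF A(2)] by (simp add: emeasure_distr emeasure_surface dim)
    moreover have "emeasure (density ?R (\<lambda>_. ennreal ((1 / s) ^ ?m))) A = ennreal ((1 / s) ^ ?m) * hausdorff_outer ?m A"
      using A Slb by (simp add: emeasure_density_const emeasure_restrict_space emeasure_hausdorff_measure)
    ultimately show "emeasure (distr (surface \<xi>) ?R h) A = emeasure (density ?R (\<lambda>_. ennreal ((1 / s) ^ ?m))) A"
      by simp
  qed simp
  have "sets ?R = sets (restrict_space borel Sl)"
    by (rule sets_restrict_space_cong) simp
  moreover have "continuous_on Sl f"
    by (rule continuous_on_subset[OF assms(3)]) (auto simp: Sl)
  ultimately have fm: "f \<in> borel_measurable ?R"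
    using borel_measurable_continuous_on_restrict[of Sl f] measurable_cong_sets by blast
  have "section_integral f \<xi> z = integral\<^sup>L ?R f"
    unfolding section_integral_def set_lebesgue_integral_def Sl_def[symmetric]
    using Slb by (subst integral_restrict_space) simp_all
  moreover have "slice z f \<xi> = integral\<^sup>L (distr (surface \<xi>) ?R h) f"
    using integral_distr[OF meas fm] by (simp add: slice_def h_def s_def)
  moreover have "\<dots> = (1 / s) ^ ?m * integral\<^sup>L ?R f"
    unfolding \<open>distr (surface \<xi>) ?R h = _\<close> using fm s(1) by (subst integral_density) simp_all
  ultimately show ?thesis
    using s(1) by (simp add: s_def[symmetric] power_divide)
qed

section \<open>Self-adjointness of the slice operators\<close>

lemma mem_great_sphere_0: "x \<in> great_sphere 0 \<longleftrightarrow> norm x = 1"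
  by (simp add: great_sphere_def)

lemma emeasure_surface_0_reflection:
  assumes "A \<in> sets (surface 0)"
  shows "emeasure (surface 0) (reflection w -` A \<inter> great_sphere 0) = emeasure (surface 0) A"
proof -
  have w: "reflection w 0 = 0" by (simp add: reflection_def)
  have "emeasure (surface 0) A = emeasure (distr (surface 0) (surface 0) (reflection w)) A"
    using distr_surface_reflection(1)[of 0 w] unfolding w by simp
  also have "\<dots> = emeasure (surface 0) (reflection w -` A \<inter> space (surface 0))"
    using distr_surface_reflection(2)[of w 0] assms unfolding w by (rule emeasure_distr)
  finally show ?thesis by simp
qed

section \<open>Bands around a section and their projection to the equator\<close>

definition band :: "real ^ 'n \<Rightarrow> real \<Rightarrow> real \<Rightarrow> (real ^ 'n) set" where
  "band \<xi> z \<epsilon> = {x \<in> great_sphere 0. \<bar>x \<bullet> \<xi> - z\<bar> < \<epsilon>}"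

lemma band_sets [measurable]: "band \<xi> z \<epsilon> \<in> sets (surface 0)"
proof -
  have "band \<xi> z \<epsilon> = great_sphere 0 \<inter> {x. \<bar>x \<bullet> \<xi> - z\<bar> < \<epsilon>}" by (auto simp: band_def)
  moreover have "{x :: real ^ 'a. \<bar>x \<bullet> \<xi> - z\<bar> < \<epsilon>} \<in> sets borel"
    by (intro borel_open open_Collect_less continuous_intros)
  ultimately show ?thesis by (simp add: sets_surface_iff)
qed

text \<open>A reflection carries \<open>\<xi>\<close> to \<open>\<eta>\<close>. The common value
  makes the normalisation of band integrals a constant that can be pulled out of integrals over
  \<open>\<xi>\<close>.\<close>

lemma measure_band_eq:
  fixes \<xi> \<eta> :: "real ^ 'n"
  assumes "norm \<xi> = 1" "norm \<eta> = 1"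
  shows "measure (surface 0) (band \<xi> z \<epsilon>) = measure (surface 0) (band \<eta> z \<epsilon>)"
proof -
  define T where "T = reflection (\<xi> - \<eta>)"
  have T: "T \<xi> = \<eta>" "\<And>x y. T x \<bullet> T y = x \<bullet> y" "\<And>x. norm (T x) = norm x"
    using assms by (simp_all add: T_def reflection_diff)
  have "T x \<bullet> \<eta> = x \<bullet> \<xi>" for x using T(2)[of x \<xi>] T(1) by simp
  then have "T -` band \<eta> z \<epsilon> \<inter> great_sphere 0 = band \<xi> z \<epsilon>"
    using T(3) by (auto simp: band_def mem_great_sphere_0)
  then show ?thesis
    using emeasure_surface_0_reflection[OF band_sets[of \<eta> z \<epsilon>], of "\<xi> - \<eta>"] by (simp add: T_def measure_def)
qed

lemma great_sphere_volume:
  assumes "CARD('n) \<ge> 2"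
  obtains \<kappa> where "0 < \<kappa>" "\<And>\<xi> :: real ^ 'n. norm \<xi> = 1 \<Longrightarrow> measure (surface \<xi>) (great_sphere \<xi>) = \<kappa>"
proof -
  define \<xi>0 :: "real ^ 'n" where "\<xi>0 = axis undefined 1"
  have n: "norm \<xi>0 = 1" by (simp add: \<xi>0_def)
  have "measure (surface \<xi>) (great_sphere \<xi>) = measure (surface \<xi>0) (great_sphere \<xi>0)"
    if "norm \<xi> = 1" for \<xi> :: "real ^ 'n"
  proof -
    have "norm \<xi> = norm \<xi>0" using that n by simp
    from hausdorff_outer_great_sphere_eq[OF this] great_sphere_dim_eq[OF this]
    show ?thesis by (simp add: measure_def emeasure_surface)
  qed
  then show ?thesis using that[of "measure (surface \<xi>0) (great_sphere \<xi>0)"] measure_surface_pos[of \<xi>0] n assms by blast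
qed

text \<open>The band contains the part of the sphere within distance \<open>\<epsilon>\<close> of a
  point of the section.\<close>

lemma measure_band_pos:
  fixes \<xi> :: "real ^ 'n"
  assumes "CARD('n) \<ge> 2" "norm \<xi> = 1" "\<bar>z\<bar> < 1" "0 < \<epsilon>"
  shows "0 < measure (surface 0) (band \<xi> z \<epsilon>)"
proof -
  interpret uniformly_distributed "surface 0" "great_sphere 0 :: (real ^ 'n) set"
    using assms(1) by (intro uniformly_distributed_surface) auto
  have "great_sphere \<xi> \<noteq> {}"
    using measure_surface_pos[of \<xi>] assms by auto
  then obtain u where u: "u \<in> great_sphere \<xi>" by blast
  define x0 where "x0 = z *\<^sub>R \<xi> + sqrt (1 - z\<^sup>2) *\<^sub>R u"
  have x0: "x0 \<in> great_sphere 0"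
    using slice_point_norm[OF assms(2) u, of z] assms(3) by (simp add: mem_great_sphere_0 x0_def)
  have "\<xi> \<bullet> \<xi> = 1" using assms(2) unfolding norm_eq_1 .
  then have x0z: "x0 \<bullet> \<xi> = z" using u by (simp add: x0_def inner_add_left great_sphere_def)
  have "great_sphere 0 \<inter> ball x0 \<epsilon> \<subseteq> band \<xi> z \<epsilon>"
  proof
    fix x assume x: "x \<in> great_sphere 0 \<inter> ball x0 \<epsilon>"
    have "\<bar>x \<bullet> \<xi> - z\<bar> = \<bar>(x - x0) \<bullet> \<xi>\<bar>" using x0z by (simp add: inner_diff_left)
    also have "\<dots> \<le> norm (x - x0)" using Cauchy_Schwarz_ineq2[of "x - x0" \<xi>] assms(2) by simp
    also have "\<dots> < \<epsilon>" using x by (simp add: dist_norm norm_minus_commute)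
    finally show "x \<in> band \<xi> z \<epsilon>" using x by (simp add: band_def)
  qed
  then have "measure (surface 0) (great_sphere 0 \<inter> ball x0 \<epsilon>) \<le> measure (surface 0) (band \<xi> z \<epsilon>)"
    by (intro finite_measure_mono band_sets)
  moreover have "0 < measure (surface 0) (great_sphere 0 \<inter> ball x0 \<epsilon>)"
    using measure_surface_pos[of "0 :: real ^ 'n"] assms x0 by (intro measure_ball_pos) simp_all
  ultimately show ?thesis by linarith
qed

text \<open>The longitude of \<open>x\<close> with respect to the pole \<open>\<xi>\<close>. At the
  poles its value is 0; bands with \<open>\<bar>z\<bar> + \<epsilon> \<le> 1\<close> avoid
  them.\<close>

definition equator_proj :: "real ^ 'n \<Rightarrow> real ^ 'n \<Rightarrow> real ^ 'n" where
  "equator_proj \<xi> x = (x - (x \<bullet> \<xi>) *\<^sub>R \<xi>) /\<^sub>R norm (x - (x \<bullet> \<xi>) *\<^sub>R \<xi>)"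

lemma norm_equator_component:
  assumes "norm \<xi> = 1" "norm x = 1"
  shows "norm (x - (x \<bullet> \<xi>) *\<^sub>R \<xi>) = sqrt (1 - (x \<bullet> \<xi>)\<^sup>2)"
proof -
  have xi: "\<xi> \<bullet> \<xi> = 1" and x: "x \<bullet> x = 1" using assms unfolding norm_eq_1 by auto
  have "(x - (x \<bullet> \<xi>) *\<^sub>R \<xi>) \<bullet> (x - (x \<bullet> \<xi>) *\<^sub>R \<xi>) = 1 - (x \<bullet> \<xi>)\<^sup>2"
    using x xi by (simp add: inner_diff_left inner_diff_right inner_commute[of \<xi> x] power2_eq_square)
  then show ?thesis by (simp only: norm_eq_sqrt_inner)
qed

lemma equator_proj_mem:
  assumes "norm \<xi> = 1" "norm x = 1" "\<bar>x \<bullet> \<xi>\<bar> < 1"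
  shows "equator_proj \<xi> x \<in> great_sphere \<xi>"
proof -
  have xi: "\<xi> \<bullet> \<xi> = 1" using assms(1) unfolding norm_eq_1 .
  have "(x \<bullet> \<xi>)\<^sup>2 < 1" using assms(3) by (simp only: abs_square_less_1)
  then have "0 < norm (x - (x \<bullet> \<xi>) *\<^sub>R \<xi>)"
    unfolding norm_equator_component[OF assms(1,2)] by simp
  then show ?thesis using xi by (simp add: equator_proj_def great_sphere_def inner_diff_left)
qed

text \<open>The reflection that swaps two points of the equator fixes \<open>\<xi>\<close>. It
  therefore preserves the band and commutes with the projection, so the projected measure gives the
  balls around both points the same mass.\<close>

lemma uniformly_distributed_band_proj:
  fixes \<xi> :: "real ^ 'n"
  assumes "CARD('n) \<ge> 2" "norm \<xi> = 1" "\<bar>z\<bar> + \<epsilon> \<le> 1"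
  defines "M \<equiv> distr (restrict_space (surface 0) (band \<xi> z \<epsilon>)) (restrict_space borel (great_sphere \<xi>)) (equator_proj \<xi>)"
  shows "uniformly_distributed M (great_sphere \<xi>)"
    and "equator_proj \<xi> \<in> measurable (restrict_space (surface 0) (band \<xi> z \<epsilon>)) (restrict_space borel (great_sphere \<xi>))"
    and "measure M (great_sphere \<xi>) = measure (surface 0) (band \<xi> z \<epsilon>)"
proof -
  let ?S = "surface 0 :: (real ^ 'n) measure" and ?B = "band \<xi> z \<epsilon>" and ?p = "equator_proj \<xi>"
  let ?R = "restrict_space ?S ?B"
  interpret S: uniformly_distributed "surface 0" "great_sphere 0 :: (real ^ 'n) set"
    using assms(1) by (intro uniformly_distributed_surface) auto
  have BS: "?B \<subseteq> great_sphere 0" by (auto simp: band_def)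
  have spR: "space ?R = ?B" using BS by (auto simp: space_restrict_space)
  have Bsets: "?B \<inter> space ?S \<in> sets ?S" by (rule sets.Int[OF band_sets sets.top])
  have pB: "?p x \<in> great_sphere \<xi>" if "x \<in> ?B" for x
    using that assms(2,3) by (intro equator_proj_mem) (auto simp: band_def mem_great_sphere_0)
  have "?p \<in> borel_measurable borel" unfolding equator_proj_def by measurable
  then have "?p \<in> measurable ?S borel"
    using measurable_compose[OF S.borel_measurable_id] by blast
  then have p_meas: "?p \<in> measurable ?R borel" by (rule measurable_restrict_space1)
  show meas: "?p \<in> measurable ?R (restrict_space borel (great_sphere \<xi>))"
    using p_meas pB spR by (intro measurable_restrict_space2) auto
  have mM: "emeasure M A = emeasure ?S {x \<in> ?B. ?p x \<in> A}"
    if "A \<in> sets borel" "A \<subseteq> great_sphere \<xi>" for A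
  proof -
    have "A \<in> sets (restrict_space borel (great_sphere \<xi>))"
      using that by (subst sets_restrict_space_iff) auto
    then have "emeasure M A = emeasure ?R (?p -` A \<inter> space ?R)"
      unfolding M_def using meas by (intro emeasure_distr)
    also have "?p -` A \<inter> space ?R = {x \<in> ?B. ?p x \<in> A}" unfolding spR by blast
    also have "emeasure ?R {x \<in> ?B. ?p x \<in> A} = emeasure ?S {x \<in> ?B. ?p x \<in> A}"
      using Bsets by (intro emeasure_restrict_space) auto
    finally show ?thesis .
  qed
  have "emeasure M (great_sphere \<xi>) = emeasure ?S {x \<in> ?B. ?p x \<in> great_sphere \<xi>}"
    by (rule mM) auto
  also have "{x \<in> ?B. ?p x \<in> great_sphere \<xi>} = ?B" using pB by blast
  finally show "measure M (great_sphere \<xi>) = measure ?S ?B" by (simp add: measure_def)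
  show "uniformly_distributed M (great_sphere \<xi>)"
  proof (intro uniformly_distributed.intro uniformly_distributed_axioms.intro)
    have "finite_measure ?R"
      by (intro finite_measure_restrict_space S.finite_measure_axioms band_sets)
    then show "finite_measure M" unfolding M_def using meas by (rule finite_measure.finite_measure_distr)
    show "sets M = sets (restrict_space borel (great_sphere \<xi>))" by (simp add: M_def)
    show "compact (great_sphere \<xi>)" by (rule compact_great_sphere)
    fix u v r assume u: "u \<in> great_sphere \<xi>" and v: "v \<in> great_sphere \<xi>"
    define T where "T = reflection (u - v)"
    have T: "T u = v" "T \<xi> = \<xi>" "\<And>x y. dist (T x) (T y) = dist x y" "\<And>x. norm (T x) = norm x"
      "\<And>x y. T x \<bullet> T y = x \<bullet> y" and lin: "linear T"
      using u v by (auto simp: T_def great_sphere_def inner_commute linear_reflection intro!: reflection_diff reflection_diff_fixes)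
    have Tx: "T x \<bullet> \<xi> = x \<bullet> \<xi>" for x using T(5)[of x \<xi>] T(2) by simp
    have Tp: "T x - (x \<bullet> \<xi>) *\<^sub>R \<xi> = T (x - (x \<bullet> \<xi>) *\<^sub>R \<xi>)" for x
      using T(2) by (simp add: linear_diff[OF lin] linear_scale[OF lin])
    have pT: "?p (T x) = T (?p x)" for x
      unfolding equator_proj_def Tx Tp T(4) by (simp add: linear_scale[OF lin])
    have dv: "dist v (T y) = dist u y" for y using T(3)[of u y] T(1) by simp
    let ?A = "\<lambda>v. {x \<in> ?B. ?p x \<in> great_sphere \<xi> \<inter> ball v r}"
    have "T -` ?A v \<inter> great_sphere 0 = ?A u"
    proof (intro set_eqI iffI)
      fix x assume "x \<in> T -` ?A v \<inter> great_sphere 0"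
      then have "x \<in> ?B" "dist v (T (?p x)) < r"
        by (auto simp: band_def Tx pT)
      then show "x \<in> ?A u" using pB[of x] by (simp add: dv)
    next
      fix x assume x: "x \<in> ?A u"
      then have "T x \<in> ?B" by (auto simp: band_def Tx mem_great_sphere_0 T(4))
      moreover have "dist v (?p (T x)) < r" using x by (simp add: pT dv)
      ultimately show "x \<in> T -` ?A v \<inter> great_sphere 0" using x BS pB[of "T x"] by auto
    qed
    moreover have "?A v \<in> sets ?S"
    proof -
      have "?p -` (great_sphere \<xi> \<inter> ball v r) \<inter> space ?R \<in> sets ?R"
        using p_meas by (rule measurable_sets) simp
      then have "?p -` (great_sphere \<xi> \<inter> ball v r) \<inter> ?B \<in> sets ?R" by (simp only: spR)
      then have "?p -` (great_sphere \<xi> \<inter> ball v r) \<inter> ?B \<in> sets ?S"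
        using Bsets by (simp add: sets_restrict_space_iff)
      moreover have "?p -` (great_sphere \<xi> \<inter> ball v r) \<inter> ?B = ?A v" by blast
      ultimately show ?thesis by simp
    qed
    ultimately have "emeasure ?S (?A u) = emeasure ?S (?A v)"
      using emeasure_surface_0_reflection[of "?A v" "u - v"] by (simp add: T_def)
    moreover have "emeasure M (great_sphere \<xi> \<inter> ball v r) = emeasure ?S (?A v)" for v
      by (rule mM) auto
    ultimately show "measure M (great_sphere \<xi> \<inter> ball u r) = measure M (great_sphere \<xi> \<inter> ball v r)"
      by (simp add: measure_def)
  qed
qed

text \<open>Multiplying \<open>\<bar>sqrt a - sqrt b\<bar>\<close> by the larger quantity
  \<open>sqrt a + sqrt b\<close> gives \<open>\<bar>a - b\<bar>\<close>. Unlike a Lipschitz bound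
  this does not degenerate near 0.\<close>

lemma abs_sqrt_diff_le:
  assumes "0 \<le> a" "0 \<le> b"
  shows "\<bar>sqrt a - sqrt b\<bar> \<le> sqrt \<bar>a - b\<bar>"
proof (rule real_le_rsqrt)
  have "\<bar>sqrt a - sqrt b\<bar>\<^sup>2 = \<bar>sqrt a - sqrt b\<bar> * \<bar>sqrt a - sqrt b\<bar>" by (simp add: power2_eq_square)
  also have "\<dots> \<le> \<bar>sqrt a - sqrt b\<bar> * (sqrt a + sqrt b)"
  proof (rule mult_left_mono)
    have "0 \<le> sqrt a" "0 \<le> sqrt b" using assms by auto
    then show "\<bar>sqrt a - sqrt b\<bar> \<le> sqrt a + sqrt b" by linarith
  qed simp
  also have "\<dots> = \<bar>(sqrt a - sqrt b) * (sqrt a + sqrt b)\<bar>"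
    using assms by (simp add: abs_mult)
  also have "(sqrt a - sqrt b) * (sqrt a + sqrt b) = a - b"
    using assms by (simp add: algebra_simps)
  finally show "\<bar>sqrt a - sqrt b\<bar>\<^sup>2 \<le> \<bar>a - b\<bar>" .
qed

text \<open>Both points have the same longitude, so only the coefficients of \<open>\<xi>\<close>
  and of \<open>equator_proj \<xi> x\<close> differ.\<close>

lemma dist_slice_point:
  assumes "norm \<xi> = 1" "norm x = 1" "\<bar>x \<bullet> \<xi>\<bar> < 1" "\<bar>z\<bar> < 1" "\<bar>x \<bullet> \<xi> - z\<bar> < \<epsilon>"
  shows "dist x (z *\<^sub>R \<xi> + sqrt (1 - z\<^sup>2) *\<^sub>R equator_proj \<xi> x) \<le> \<epsilon> + sqrt (2 * \<epsilon>)"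
proof -
  define t where "t = x \<bullet> \<xi>"
  have t: "\<bar>t\<bar> < 1" "\<bar>t - z\<bar> < \<epsilon>" using assms by (simp_all add: t_def)
  have t2: "t\<^sup>2 < 1" "z\<^sup>2 < 1" using t(1) assms(4) by (simp_all only: abs_square_less_1)
  then have r: "0 < sqrt (1 - t\<^sup>2)" by simp
  have p: "equator_proj \<xi> x = (x - t *\<^sub>R \<xi>) /\<^sub>R sqrt (1 - t\<^sup>2)"
    unfolding equator_proj_def norm_equator_component[OF assms(1,2)] t_def ..
  have x: "x = t *\<^sub>R \<xi> + sqrt (1 - t\<^sup>2) *\<^sub>R equator_proj \<xi> x"
    unfolding p using r by simp
  have np: "norm (equator_proj \<xi> x) = 1"
    using equator_proj_mem[OF assms(1-3)] by (simp add: great_sphere_def)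
  have "x - (z *\<^sub>R \<xi> + sqrt (1 - z\<^sup>2) *\<^sub>R equator_proj \<xi> x)
      = (t - z) *\<^sub>R \<xi> + (sqrt (1 - t\<^sup>2) - sqrt (1 - z\<^sup>2)) *\<^sub>R equator_proj \<xi> x"
    by (subst (1) x) (simp add: algebra_simps)
  then have "dist x (z *\<^sub>R \<xi> + sqrt (1 - z\<^sup>2) *\<^sub>R equator_proj \<xi> x)
      \<le> \<bar>t - z\<bar> + \<bar>sqrt (1 - t\<^sup>2) - sqrt (1 - z\<^sup>2)\<bar>"
    using norm_triangle_ineq[of "(t - z) *\<^sub>R \<xi>" "(sqrt (1 - t\<^sup>2) - sqrt (1 - z\<^sup>2)) *\<^sub>R equator_proj \<xi> x"]
    by (simp add: dist_norm assms(1) np)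
  also have "\<bar>sqrt (1 - t\<^sup>2) - sqrt (1 - z\<^sup>2)\<bar> \<le> sqrt \<bar>(1 - t\<^sup>2) - (1 - z\<^sup>2)\<bar>"
    using t2 by (intro abs_sqrt_diff_le) auto
  also have "\<dots> \<le> sqrt (2 * \<epsilon>)"
  proof (rule real_sqrt_le_mono)
    \<comment> \<open>The factor 2 bounds \<open>\<bar>t + z\<bar>\<close>.\<close>
    have "\<bar>(1 - t\<^sup>2) - (1 - z\<^sup>2)\<bar> = \<bar>t + z\<bar> * \<bar>t - z\<bar>"
      unfolding abs_mult[symmetric] by (simp add: abs_minus_commute power2_eq_square algebra_simps)
    also have "\<dots> \<le> 2 * \<epsilon>"
      using t assms(4) by (intro mult_mono) auto
    finally show "\<bar>(1 - t\<^sup>2) - (1 - z\<^sup>2)\<bar> \<le> 2 * \<epsilon>" .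
  qed
  finally show ?thesis using t(2) by linarith
qed

section \<open>Band integrals as approximations of slice integrals\<close>

definition band_integral :: "real \<Rightarrow> real \<Rightarrow> (real ^ 'n \<Rightarrow> real) \<Rightarrow> real ^ 'n \<Rightarrow> real" where
  "band_integral z \<epsilon> g \<xi> = (LINT x|surface 0. (if \<bar>x \<bullet> \<xi> - z\<bar> < \<epsilon> then g x else 0))"

text \<open>
  Projecting the band to the equator of \<open>\<xi>\<close> yields a uniformly distributed measure, hence a
  multiple of the one that defines the slice integral.
\<close>

lemma band_integral_slice:
  fixes \<xi> :: "real ^ 'n"
  assumes n2: "CARD('n) \<ge> 2" and xi: "norm \<xi> = 1" and z: "\<bar>z\<bar> < 1" "\<bar>z\<bar> + \<epsilon> \<le> 1"
    and g: "continuous_on (great_sphere 0) g" and "0 \<le> e"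
    and osc: "\<And>x y. norm x = 1 \<Longrightarrow> norm y = 1 \<Longrightarrow> dist x y \<le> \<epsilon> + sqrt (2 * \<epsilon>) \<Longrightarrow> \<bar>g x - g y\<bar> \<le> e"
    and \<kappa>: "\<kappa> = measure (surface \<xi>) (great_sphere \<xi>)" and b: "b = measure (surface 0) (band \<xi> z \<epsilon>)"
  shows "\<bar>\<kappa> * band_integral z \<epsilon> g \<xi> - b * slice z g \<xi>\<bar> \<le> \<kappa> * e * b"
proof -
  let ?S = "surface 0 :: (real ^ 'n) measure" and ?B = "band \<xi> z \<epsilon>" and ?p = "equator_proj \<xi>"
  let ?R = "restrict_space ?S ?B" and ?E = "restrict_space borel (great_sphere \<xi>)"
  interpret S: uniformly_distributed "surface 0" "great_sphere 0 :: (real ^ 'n) set"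
    using n2 by (intro uniformly_distributed_surface) auto
  have BS: "?B \<subseteq> great_sphere 0" by (auto simp: band_def)
  have spR: "space ?R = ?B" using BS by (auto simp: space_restrict_space)
  have Bsets: "?B \<inter> space ?S \<in> sets ?S" by (rule sets.Int[OF band_sets sets.top])
  define h where "h u = g (z *\<^sub>R \<xi> + sqrt (1 - z\<^sup>2) *\<^sub>R u)" for u
  have h: "continuous_on (great_sphere \<xi>) h"
    unfolding h_def
    by (rule continuous_on_compose2[OF g]) (use slice_point_norm[OF xi] z in \<open>auto intro!: continuous_intros simp: mem_great_sphere_0\<close>)
  note U = uniformly_distributed_band_proj[OF n2 xi z(2)]
  interpret F: finite_measure ?R
    by (intro finite_measure_restrict_space S.finite_measure_axioms band_sets)
  \<comment> \<open>The projected band has total mass \<open>b\<close> and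
    \<open>surface \<xi>\<close> has total mass \<open>\<kappa>\<close>, so uniqueness relates the
    two integrals by these masses.\<close>
  have "measure (surface \<xi>) (great_sphere \<xi>) * (LINT u|distr ?R ?E ?p. h u) = b * (LINT u|surface \<xi>. h u)"
    using uniformly_distributed_unique[OF U(1) uniformly_distributed_surface h] xi n2 U(3) b by simp
  then have eq: "\<kappa> * (LINT u|distr ?R ?E ?p. h u) = b * slice z g \<xi>"
    by (simp add: \<kappa> slice_def h_def)
  have hE: "h \<in> borel_measurable ?E" using h by (rule borel_measurable_continuous_on_restrict)
  have distr: "(LINT u|distr ?R ?E ?p. h u) = (LINT x|?R. h (?p x))"
    using U(2) hE by (rule integral_distr)
  have "bounded (g ` great_sphere 0)"
    using compact_continuous_image[OF g compact_great_sphere] by (rule compact_imp_bounded)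
  then obtain C where "\<forall>y\<in>g ` great_sphere 0. norm y \<le> C" unfolding bounded_iff by (elim exE)
  then have C: "\<bar>g x\<bar> \<le> C" if "norm x = 1" for x
    using that by (simp add: mem_great_sphere_0)
  have xB: "norm x = 1" "\<bar>x \<bullet> \<xi>\<bar> < 1" "\<bar>x \<bullet> \<xi> - z\<bar> < \<epsilon>" if "x \<in> ?B" for x
    using that z by (auto simp: band_def mem_great_sphere_0)
  have pt: "norm (z *\<^sub>R \<xi> + sqrt (1 - z\<^sup>2) *\<^sub>R ?p x) = 1" if "x \<in> ?B" for x
    using z(1) xB[OF that] by (intro slice_point_norm[OF xi] equator_proj_mem[OF xi]) auto
  have gm: "g \<in> borel_measurable ?S" using g by (rule S.borel_measurable_continuous)
  have int_g: "integrable ?R g"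
    using gm C xB by (intro F.integrable_const_bound[of _ C, OF AE_I2] measurable_restrict_space1) (auto simp: spR)
  have int_h: "integrable ?R (\<lambda>x. h (?p x))"
  proof (rule F.integrable_const_bound[of _ C, OF AE_I2])
    show "(\<lambda>x. h (?p x)) \<in> borel_measurable ?R" using U(2) hE by (rule measurable_compose)
    fix x assume "x \<in> space ?R"
    then show "norm (h (?p x)) \<le> C" unfolding h_def real_norm_def spR by (intro C pt)
  qed
  have "\<bar>(LINT x|?R. g x - h (?p x))\<bar> \<le> (LINT x|?R. e)"
  proof (rule integral_abs_le_integral)
    fix x assume "x \<in> space ?R"
    then have "x \<in> ?B" by (simp add: spR)
    then show "\<bar>g x - h (?p x)\<bar> \<le> e"
      unfolding h_def using xB pt z(1) xi by (intro osc dist_slice_point) auto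
  qed (use int_g int_h in auto)
  also have "\<dots> = e * b"
    using Bsets BS by (simp add: spR b measure_restrict_space)
  finally have "\<bar>(LINT x|?R. g x) - (LINT x|?R. h (?p x))\<bar> \<le> e * b"
    using int_g int_h by simp
  moreover have "(LINT x|?R. g x) = band_integral z \<epsilon> g \<xi>"
    unfolding band_integral_def using Bsets
    by (subst integral_restrict_space) (auto intro!: Bochner_Integration.integral_cong simp: band_def)
  ultimately have "\<bar>band_integral z \<epsilon> g \<xi> - (LINT x|?R. h (?p x))\<bar> \<le> e * b" by simp
  then have "\<kappa> * \<bar>band_integral z \<epsilon> g \<xi> - (LINT x|?R. h (?p x))\<bar> \<le> \<kappa> * (e * b)"
    by (intro mult_left_mono) (simp_all add: \<kappa>)
  moreover have "\<kappa> * \<bar>band_integral z \<epsilon> g \<xi> - (LINT x|?R. h (?p x))\<bar> = \<bar>\<kappa> * band_integral z \<epsilon> g \<xi> - b * slice z g \<xi>\<bar>"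
    unfolding eq[symmetric] distr right_diff_distrib[symmetric] abs_mult by (simp add: \<kappa>)
  ultimately show ?thesis by (simp add: mult.assoc)
qed

text \<open>The estimate is uniform in \<open>\<xi>\<close>, as required for integrating it over the
  sphere: uniform continuity gives one width for all poles, and the band measure is taken at a fixed
  pole \<open>\<xi>0\<close>.\<close>

lemma band_integral_approx:
  fixes g :: "real ^ 'n \<Rightarrow> real" and \<xi>0 :: "real ^ 'n"
  assumes n2: "CARD('n) \<ge> 2" and z: "\<bar>z\<bar> < 1" and g: "continuous_on (great_sphere 0) g" and e: "0 < e"
    and \<kappa>: "\<And>\<xi> :: real ^ 'n. norm \<xi> = 1 \<Longrightarrow> measure (surface \<xi>) (great_sphere \<xi>) = \<kappa>"
    and \<xi>0: "norm \<xi>0 = 1"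
  shows "\<exists>\<epsilon>0>0. \<forall>\<epsilon> \<xi>. 0 < \<epsilon> \<and> \<epsilon> \<le> \<epsilon>0 \<and> norm \<xi> = 1 \<longrightarrow>
    \<bar>\<kappa> * band_integral z \<epsilon> g \<xi> - measure (surface 0) (band \<xi>0 z \<epsilon>) * slice z g \<xi>\<bar>
      \<le> \<kappa> * e * measure (surface 0) (band \<xi>0 z \<epsilon>)"
proof -
  have "uniformly_continuous_on (great_sphere 0) g"
    using g compact_great_sphere by (rule compact_uniformly_continuous)
  then obtain d where d: "0 < d"
    "\<forall>x\<in>great_sphere 0. \<forall>y\<in>great_sphere 0. dist y x < d \<longrightarrow> dist (g y) (g x) < e"
    unfolding uniformly_continuous_on_def using e by (elim allE impE exE conjE) auto
  have "((\<lambda>\<epsilon>::real. \<epsilon> + sqrt (2 * \<epsilon>)) \<longlongrightarrow> 0 + sqrt (2 * 0)) (at_right 0)"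
    by (intro tendsto_intros)
  then have "\<forall>\<^sub>F \<epsilon> in at_right 0. \<epsilon> + sqrt (2 * \<epsilon>) < d"
    using d(1) by (intro order_tendstoD(2)) auto
  then obtain r where r: "0 < r" "\<And>\<epsilon>. 0 < \<epsilon> \<Longrightarrow> \<epsilon> < r \<Longrightarrow> \<epsilon> + sqrt (2 * \<epsilon>) < d"
    unfolding eventually_at_right_field by auto
  \<comment> \<open>Half of \<open>r\<close> gives the strict inequality required by
    \<open>r(2)\<close>; \<open>1 - \<bar>z\<bar>\<close> keeps the band away from the
    poles.\<close>
  let ?\<epsilon>0 = "min (r / 2) (1 - \<bar>z\<bar>)"
  have "\<bar>\<kappa> * band_integral z \<epsilon> g \<xi> - measure (surface 0) (band \<xi>0 z \<epsilon>) * slice z g \<xi>\<bar>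
      \<le> \<kappa> * e * measure (surface 0) (band \<xi>0 z \<epsilon>)" if "0 < \<epsilon>" "\<epsilon> \<le> ?\<epsilon>0" "norm \<xi> = 1" for \<epsilon> \<xi>
  proof (rule band_integral_slice[OF n2 that(3) z _ g])
    show "\<bar>z\<bar> + \<epsilon> \<le> 1" using that by linarith
    show "\<kappa> = measure (surface \<xi>) (great_sphere \<xi>)" using \<kappa>[OF that(3)] by simp
    show "measure (surface 0) (band \<xi>0 z \<epsilon>) = measure (surface 0) (band \<xi> z \<epsilon>)"
      using \<xi>0 that(3) by (rule measure_band_eq)
    have *: "\<epsilon> + sqrt (2 * \<epsilon>) < d" using that r by (intro r(2)) linarith+
    show "\<bar>g x - g y\<bar> \<le> e" if "norm x = 1" "norm y = 1" "dist x y \<le> \<epsilon> + sqrt (2 * \<epsilon>)" for x y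
      using d(2) that * by (force simp: dist_real_def mem_great_sphere_0)
  qed (use e in simp)
  moreover have "0 < ?\<epsilon>0" using r z by simp
  ultimately show ?thesis by blast
qed

text \<open>Fubini, with a kernel that is symmetric in its two arguments.\<close>

lemma band_integral_pair:
  fixes g \<phi> :: "real ^ 'n \<Rightarrow> real"
  assumes n2: "CARD('n) \<ge> 2" and g: "continuous_on (great_sphere 0) g" and \<phi>: "continuous_on (great_sphere 0) \<phi>"
  shows "band_integral z \<epsilon> g \<in> borel_measurable (surface 0)"
    and "(LINT \<xi>|surface 0. \<phi> \<xi> * band_integral z \<epsilon> g \<xi>) = (LINT \<xi>|surface 0. g \<xi> * band_integral z \<epsilon> \<phi> \<xi>)"
proof -
  let ?S = "surface 0 :: (real ^ 'n) measure"
  interpret S: uniformly_distributed "surface 0" "great_sphere 0 :: (real ^ 'n) set"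
    using n2 by (intro uniformly_distributed_surface) auto
  interpret P: pair_sigma_finite ?S ?S ..
  interpret PF: finite_measure "?S \<Otimes>\<^sub>M ?S"
    by (rule finite_measure_pair_measure) (unfold_locales)
  note [measurable] = S.borel_measurable_id
  have gm [measurable]: "g \<in> borel_measurable ?S" and \<phi>m [measurable]: "\<phi> \<in> borel_measurable ?S"
    using g \<phi> by (auto intro: S.borel_measurable_continuous)
  define k :: "real ^ 'n \<Rightarrow> real ^ 'n \<Rightarrow> real" where "k \<xi> x = (if \<bar>x \<bullet> \<xi> - z\<bar> < \<epsilon> then 1 else 0)" for \<xi> x
  have k_meas: "(\<lambda>p. k (fst p) (snd p)) \<in> borel_measurable (?S \<Otimes>\<^sub>M ?S)"
    unfolding k_def by measurable
  have k_sym: "k \<xi> x = k x \<xi>" for \<xi> x by (simp add: k_def inner_commute)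
  have bi: "band_integral z \<epsilon> h \<xi> = (LINT x|?S. k \<xi> x * h x)" for h \<xi>
    unfolding band_integral_def by (rule Bochner_Integration.integral_cong) (auto simp: k_def)
  show "band_integral z \<epsilon> g \<in> borel_measurable ?S"
    unfolding bi[abs_def] using k_meas
    by (intro S.borel_measurable_lebesgue_integral) (simp add: split_beta')
  have "\<exists>C. \<forall>x\<in>great_sphere 0. \<bar>h x\<bar> \<le> C" if "continuous_on (great_sphere 0) h" for h :: "real ^ 'n \<Rightarrow> real"
    using compact_imp_bounded[OF compact_continuous_image[OF that compact_great_sphere]] by (auto simp: bounded_iff)
  then obtain C D where C: "\<forall>x\<in>great_sphere 0. \<bar>g x\<bar> \<le> C" and D: "\<forall>x\<in>great_sphere 0. \<bar>\<phi> x\<bar> \<le> D"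
    using g \<phi> by meson
  have int: "integrable (?S \<Otimes>\<^sub>M ?S) (\<lambda>p. \<phi> (fst p) * (k (fst p) (snd p) * g (snd p)))"
  proof (rule PF.integrable_const_bound[of _ "D * (1 * C)", OF AE_I2])
    fix p assume "p \<in> space (?S \<Otimes>\<^sub>M ?S)"
    then have "\<bar>\<phi> (fst p)\<bar> \<le> D" "\<bar>g (snd p)\<bar> \<le> C" using C D by (auto simp: space_pair_measure)
    moreover have "\<bar>k (fst p) (snd p)\<bar> \<le> 1" by (simp add: k_def)
    ultimately show "norm (\<phi> (fst p) * (k (fst p) (snd p) * g (snd p))) \<le> D * (1 * C)"
      unfolding real_norm_def abs_mult by (intro mult_mono) (auto intro: order_trans[OF abs_ge_zero])
  qed (use k_meas in measurable)
  then have "integrable (?S \<Otimes>\<^sub>M ?S) (case_prod (\<lambda>\<xi> x. \<phi> \<xi> * (k \<xi> x * g x)))"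
    by (simp add: case_prod_beta')
  from P.Fubini_integral[OF this]
  have "(LINT \<xi>|?S. LINT x|?S. \<phi> \<xi> * (k \<xi> x * g x)) = (LINT x|?S. LINT \<xi>|?S. \<phi> \<xi> * (k \<xi> x * g x))"
    by simp
  also have "\<dots> = (LINT x|?S. LINT \<xi>|?S. g x * (k x \<xi> * \<phi> \<xi>))"
    by (simp add: k_sym mult_ac)
  finally show "(LINT \<xi>|?S. \<phi> \<xi> * band_integral z \<epsilon> g \<xi>) = (LINT \<xi>|?S. g \<xi> * band_integral z \<epsilon> \<phi> \<xi>)"
    unfolding bi by simp
qed

text \<open>The measure in \<open>slice\<close> varies with \<open>\<xi>\<close>, so measurability
  is not immediate. It is inherited from the normalised band integrals, which converge pointwise to
  a multiple-free limit, the slice integral itself.\<close>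

lemma slice_measurable:
  fixes g :: "real ^ 'n \<Rightarrow> real"
  assumes n2: "CARD('n) \<ge> 2" and z: "\<bar>z\<bar> < 1" and g: "continuous_on (great_sphere 0) g"
  shows "slice z g \<in> borel_measurable (surface 0)"
proof -
  obtain \<kappa> where \<kappa>: "0 < \<kappa>" "\<And>\<xi> :: real ^ 'n. norm \<xi> = 1 \<Longrightarrow> measure (surface \<xi>) (great_sphere \<xi>) = \<kappa>"
    using great_sphere_volume[OF n2] by blast
  define \<xi>0 :: "real ^ 'n" where "\<xi>0 = axis undefined 1"
  have n0: "norm \<xi>0 = 1" by (simp add: \<xi>0_def)
  have "\<exists>\<epsilon>>0. \<forall>\<xi>. norm \<xi> = 1 \<longrightarrow>
    \<bar>\<kappa> * band_integral z \<epsilon> g \<xi> - measure (surface 0) (band \<xi>0 z \<epsilon>) * slice z g \<xi>\<bar>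
      \<le> \<kappa> * (1 / real (Suc i)) * measure (surface 0) (band \<xi>0 z \<epsilon>)" for i
    using band_integral_approx[OF n2 z g _ \<kappa>(2) n0, of "1 / real (Suc i)"] by fastforce
  then obtain \<epsilon> where \<epsilon>: "\<And>i. 0 < \<epsilon> i" "\<And>i \<xi>. norm \<xi> = 1 \<Longrightarrow>
    \<bar>\<kappa> * band_integral z (\<epsilon> i) g \<xi> - measure (surface 0) (band \<xi>0 z (\<epsilon> i)) * slice z g \<xi>\<bar>
      \<le> \<kappa> * (1 / real (Suc i)) * measure (surface 0) (band \<xi>0 z (\<epsilon> i))"
    by metis
  define b where "b i = measure (surface 0) (band \<xi>0 z (\<epsilon> i))" for i
  have b: "0 < b i" for i unfolding b_def using n2 n0 z \<epsilon>(1) by (rule measure_band_pos)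
  show ?thesis
  proof (rule borel_measurable_LIMSEQ_real)
    show "(\<lambda>\<xi>. \<kappa> * band_integral z (\<epsilon> i) g \<xi> / b i) \<in> borel_measurable (surface 0)" for i
      using band_integral_pair(1)[OF n2 g g, of z "\<epsilon> i"] by measurable
    fix \<xi> :: "real ^ 'n" assume "\<xi> \<in> space (surface 0)"
    then have xi: "norm \<xi> = 1" by (simp add: mem_great_sphere_0)
    have le: "norm (\<kappa> * band_integral z (\<epsilon> i) g \<xi> / b i - slice z g \<xi>) \<le> \<kappa> * (1 / real (Suc i))" for i
    proof -
      have "\<kappa> * band_integral z (\<epsilon> i) g \<xi> / b i - slice z g \<xi>
          = (\<kappa> * band_integral z (\<epsilon> i) g \<xi> - b i * slice z g \<xi>) / b i"
        using b[of i] by (simp add: diff_divide_distrib)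
      then have "norm (\<kappa> * band_integral z (\<epsilon> i) g \<xi> / b i - slice z g \<xi>)
          = \<bar>\<kappa> * band_integral z (\<epsilon> i) g \<xi> - b i * slice z g \<xi>\<bar> / b i"
        using b[of i] by simp
      also have "\<dots> \<le> \<kappa> * (1 / real (Suc i))"
        using \<epsilon>(2)[OF xi, of i] b[of i] by (subst pos_divide_le_eq) (simp_all only: b_def)
      finally show ?thesis .
    qed
    have "(\<lambda>i. \<kappa> * (1 / real (Suc i))) \<longlonglongrightarrow> \<kappa> * 0"
      by (intro tendsto_mult tendsto_const LIMSEQ_Suc lim_1_over_n)
    then have "(\<lambda>i. \<kappa> * (1 / real (Suc i))) \<longlonglongrightarrow> 0" by (simp only: mult_zero_right)
    then have "(\<lambda>i. \<kappa> * band_integral z (\<epsilon> i) g \<xi> / b i - slice z g \<xi>) \<longlonglongrightarrow> 0"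
      by (rule Lim_null_comparison[OF always_eventually[OF allI[OF le]]])
    then show "(\<lambda>i. \<kappa> * band_integral z (\<epsilon> i) g \<xi> / b i) \<longlonglongrightarrow> slice z g \<xi>"
      by (simp only: LIM_zero_iff)
  qed
qed

lemma slice_abs_le:
  fixes g :: "real ^ 'n \<Rightarrow> real"
  assumes n2: "CARD('n) \<ge> 2" and z: "\<bar>z\<bar> \<le> 1" and xi: "norm \<xi> = 1"
    and g: "continuous_on (great_sphere 0) g" and C: "\<And>x. norm x = 1 \<Longrightarrow> \<bar>g x\<bar> \<le> C"
  shows "\<bar>slice z g \<xi>\<bar> \<le> C * measure (surface \<xi>) (great_sphere \<xi>)"
proof -
  interpret uniformly_distributed "surface \<xi>" "great_sphere \<xi> :: (real ^ 'n) set"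
    using n2 xi by (intro uniformly_distributed_surface) auto
  have int: "integrable (surface \<xi>) (\<lambda>u. g (z *\<^sub>R \<xi> + sqrt (1 - z\<^sup>2) *\<^sub>R u))"
    by (intro integrable_continuous continuous_on_compose2[OF g])
      (use slice_point_norm[OF xi] z in \<open>auto intro!: continuous_intros simp: mem_great_sphere_0\<close>)
  have "\<bar>slice z g \<xi>\<bar> \<le> (LINT u|surface \<xi>. C)"
    unfolding slice_def using slice_point_norm[OF xi _ z] C
    by (intro integral_abs_le_integral int) auto
  then show "\<bar>slice z g \<xi>\<bar> \<le> C * measure (surface \<xi>) (great_sphere \<xi>)"
    by (simp add: mult.commute)
qed

text \<open>Both pairings, multiplied by the band measure \<open>b\<close>, lie within a constant
  times \<open>e * b\<close> of the same band pairing. Cancelling \<open>b\<close> before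
  \<open>e\<close> tends to 0 gives equality.\<close>

lemma slice_self_adjoint:
  fixes g \<phi> :: "real ^ 'n \<Rightarrow> real"
  assumes n2: "CARD('n) \<ge> 2" and z: "\<bar>z\<bar> < 1" and g: "continuous_on (great_sphere 0) g" and \<phi>: "continuous_on (great_sphere 0) \<phi>"
  shows "(LINT \<xi>|surface 0. \<phi> \<xi> * slice z g \<xi>) = (LINT \<xi>|surface 0. g \<xi> * slice z \<phi> \<xi>)"
proof -
  let ?S = "surface 0 :: (real ^ 'n) measure"
  let ?X = "great_sphere 0 :: (real ^ 'n) set"
  interpret S: uniformly_distributed "surface 0" "great_sphere 0 :: (real ^ 'n) set"
    using n2 by (intro uniformly_distributed_surface) auto
  obtain \<kappa> where \<kappa>: "0 < \<kappa>" "\<And>\<xi> :: real ^ 'n. norm \<xi> = 1 \<Longrightarrow> measure (surface \<xi>) (great_sphere \<xi>) = \<kappa>"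
    using great_sphere_volume[OF n2] by blast
  define \<xi>0 :: "real ^ 'n" where "\<xi>0 = axis undefined 1"
  have n0: "norm \<xi>0 = 1" by (simp add: \<xi>0_def)
  have bdd: "\<exists>C\<ge>0. \<forall>x. norm x = 1 \<longrightarrow> \<bar>h x\<bar> \<le> C" if "continuous_on ?X h" for h :: "real ^ 'n \<Rightarrow> real"
  proof -
    have "bounded (h ` ?X)"
      using compact_continuous_image[OF that compact_great_sphere] by (rule compact_imp_bounded)
    then obtain C where "\<forall>y\<in>h ` ?X. norm y \<le> C" unfolding bounded_iff by (elim exE)
    then have "\<forall>x. norm x = 1 \<longrightarrow> \<bar>h x\<bar> \<le> max C 0" by (auto simp: mem_great_sphere_0 le_max_iff_disj)
    then show ?thesis by (intro exI[of _ "max C 0"]) simp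
  qed
  \<comment> \<open>Stated for arbitrary \<open>p\<close> and \<open>q\<close>, because it is
    applied with the roles of \<open>g\<close> and \<open>\<phi>\<close> exchanged.\<close>
  have est: "\<bar>\<kappa> * (LINT \<xi>|?S. p \<xi> * band_integral z \<epsilon> q \<xi>) - b * (LINT \<xi>|?S. p \<xi> * slice z q \<xi>)\<bar>
      \<le> C * (\<kappa> * e * b) * measure ?S ?X"
    if p: "continuous_on ?X p" and q: "continuous_on ?X q" and C: "\<And>x. norm x = 1 \<Longrightarrow> \<bar>p x\<bar> \<le> C" and "0 \<le> C"
      and close: "\<And>\<xi>. norm \<xi> = 1 \<Longrightarrow> \<bar>\<kappa> * band_integral z \<epsilon> q \<xi> - b * slice z q \<xi>\<bar> \<le> \<kappa> * e * b" and "0 < b"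
    for p q C \<epsilon> e b
  proof -
    obtain D where D: "\<And>x. norm x = 1 \<Longrightarrow> \<bar>q x\<bar> \<le> D" using bdd[OF q] by blast
    have pm: "p \<in> borel_measurable ?S" using p by (rule S.borel_measurable_continuous)
    have sl: "\<bar>slice z q \<xi>\<bar> \<le> D * \<kappa>" if "norm \<xi> = 1" for \<xi>
      using slice_abs_le[OF n2 _ that q D] z \<kappa>(2)[OF that] by simp
    have int_s: "integrable ?S (\<lambda>\<xi>. p \<xi> * slice z q \<xi>)"
    proof (rule S.integrable_const_bound[of _ "C * (D * \<kappa>)", OF AE_I2])
      show "(\<lambda>\<xi>. p \<xi> * slice z q \<xi>) \<in> borel_measurable ?S"
        using pm slice_measurable[OF n2 z q] by measurable
      fix \<xi> assume "\<xi> \<in> space ?S"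
      then have "norm \<xi> = 1" by (simp add: mem_great_sphere_0)
      then show "norm (p \<xi> * slice z q \<xi>) \<le> C * (D * \<kappa>)"
        unfolding real_norm_def abs_mult using C sl \<open>0 \<le> C\<close> by (intro mult_mono) auto
    qed
    have int_d: "integrable ?S (\<lambda>\<xi>. p \<xi> * (\<kappa> * band_integral z \<epsilon> q \<xi> - b * slice z q \<xi>))"
    proof (rule S.integrable_const_bound[of _ "C * (\<kappa> * e * b)", OF AE_I2])
      show "(\<lambda>\<xi>. p \<xi> * (\<kappa> * band_integral z \<epsilon> q \<xi> - b * slice z q \<xi>)) \<in> borel_measurable ?S"
        using pm slice_measurable[OF n2 z q] band_integral_pair(1)[OF n2 q q] by measurable
      fix \<xi> assume "\<xi> \<in> space ?S"
      then have "norm \<xi> = 1" by (simp add: mem_great_sphere_0)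
      then show "norm (p \<xi> * (\<kappa> * band_integral z \<epsilon> q \<xi> - b * slice z q \<xi>)) \<le> C * (\<kappa> * e * b)"
        unfolding real_norm_def abs_mult using C close \<open>0 \<le> C\<close> by (intro mult_mono) auto
    qed
    have "\<bar>LINT \<xi>|?S. p \<xi> * (\<kappa> * band_integral z \<epsilon> q \<xi> - b * slice z q \<xi>)\<bar> \<le> (LINT \<xi>|?S. C * (\<kappa> * e * b))"
    proof (rule integral_abs_le_integral[OF int_d])
      fix \<xi> assume "\<xi> \<in> space ?S"
      then have "norm \<xi> = 1" by (simp add: mem_great_sphere_0)
      then show "\<bar>p \<xi> * (\<kappa> * band_integral z \<epsilon> q \<xi> - b * slice z q \<xi>)\<bar> \<le> C * (\<kappa> * e * b)"
        unfolding abs_mult using C close \<open>0 \<le> C\<close> by (intro mult_mono) auto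
    qed simp
    moreover have "(LINT \<xi>|?S. C * (\<kappa> * e * b)) = C * (\<kappa> * e * b) * measure ?S ?X" by (simp add: mult.commute)
    moreover have "(LINT \<xi>|?S. p \<xi> * (\<kappa> * band_integral z \<epsilon> q \<xi> - b * slice z q \<xi>))
        = \<kappa> * (LINT \<xi>|?S. p \<xi> * band_integral z \<epsilon> q \<xi>) - b * (LINT \<xi>|?S. p \<xi> * slice z q \<xi>)"
    proof -
      \<comment> \<open>Integrability of the band term is recovered from that of the difference and
        of the slice term.\<close>
      have "integrable ?S (\<lambda>\<xi>. p \<xi> * (\<kappa> * band_integral z \<epsilon> q \<xi> - b * slice z q \<xi>) + b * (p \<xi> * slice z q \<xi>))"
        using int_d int_s by simp
      then have "integrable ?S (\<lambda>\<xi>. \<kappa> * (p \<xi> * band_integral z \<epsilon> q \<xi>))"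
        by (rule back_subst[of "integrable ?S"]) (simp add: fun_eq_iff algebra_simps)
      then have "(LINT \<xi>|?S. \<kappa> * (p \<xi> * band_integral z \<epsilon> q \<xi>) - b * (p \<xi> * slice z q \<xi>))
        = \<kappa> * (LINT \<xi>|?S. p \<xi> * band_integral z \<epsilon> q \<xi>) - b * (LINT \<xi>|?S. p \<xi> * slice z q \<xi>)"
        using int_s by (subst Bochner_Integration.integral_diff) auto
      moreover have "p \<xi> * (\<kappa> * band_integral z \<epsilon> q \<xi> - b * slice z q \<xi>)
          = \<kappa> * (p \<xi> * band_integral z \<epsilon> q \<xi>) - b * (p \<xi> * slice z q \<xi>)" for \<xi>
        by (simp add: algebra_simps)
      ultimately show ?thesis by simp
    qed
    ultimately show ?thesis by (simp only:)
  qed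
  obtain C where C: "0 \<le> C" "\<And>x. norm x = 1 \<Longrightarrow> \<bar>g x\<bar> \<le> C" using bdd[OF g] by blast
  obtain D where D: "0 \<le> D" "\<And>x. norm x = 1 \<Longrightarrow> \<bar>\<phi> x\<bar> \<le> D" using bdd[OF \<phi>] by blast
  let ?A = "LINT \<xi>|?S. \<phi> \<xi> * slice z g \<xi>" and ?B = "LINT \<xi>|?S. g \<xi> * slice z \<phi> \<xi>"
  define V where "V = (D + C) * \<kappa> * measure ?S ?X"
  have V: "0 \<le> V" unfolding V_def using C(1) D(1) \<kappa>(1) by simp
  have main: "\<bar>?A - ?B\<bar> \<le> e * V" if e: "0 < e" for e
  proof -
    obtain \<epsilon>1 where \<epsilon>1: "0 < \<epsilon>1" "\<And>\<epsilon> \<xi>. 0 < \<epsilon> \<Longrightarrow> \<epsilon> \<le> \<epsilon>1 \<Longrightarrow> norm \<xi> = 1 \<Longrightarrow>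
      \<bar>\<kappa> * band_integral z \<epsilon> g \<xi> - measure ?S (band \<xi>0 z \<epsilon>) * slice z g \<xi>\<bar> \<le> \<kappa> * e * measure ?S (band \<xi>0 z \<epsilon>)"
      using band_integral_approx[OF n2 z g e \<kappa>(2) n0] by blast
    obtain \<epsilon>2 where \<epsilon>2: "0 < \<epsilon>2" "\<And>\<epsilon> \<xi>. 0 < \<epsilon> \<Longrightarrow> \<epsilon> \<le> \<epsilon>2 \<Longrightarrow> norm \<xi> = 1 \<Longrightarrow>
      \<bar>\<kappa> * band_integral z \<epsilon> \<phi> \<xi> - measure ?S (band \<xi>0 z \<epsilon>) * slice z \<phi> \<xi>\<bar> \<le> \<kappa> * e * measure ?S (band \<xi>0 z \<epsilon>)"
      using band_integral_approx[OF n2 z \<phi> e \<kappa>(2) n0] by blast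
    define \<epsilon> where "\<epsilon> = min \<epsilon>1 \<epsilon>2"
    have \<epsilon>: "0 < \<epsilon>" "\<epsilon> \<le> \<epsilon>1" "\<epsilon> \<le> \<epsilon>2" using \<epsilon>1(1) \<epsilon>2(1) by (auto simp: \<epsilon>_def)
    define b where "b = measure ?S (band \<xi>0 z \<epsilon>)"
    have b: "0 < b" unfolding b_def using n2 n0 z \<epsilon>(1) by (rule measure_band_pos)
    let ?D = "LINT \<xi>|?S. \<phi> \<xi> * band_integral z \<epsilon> g \<xi>"
    have "\<bar>\<kappa> * ?D - b * ?A\<bar> \<le> D * (\<kappa> * e * b) * measure ?S ?X"
      using \<epsilon>1(2)[OF \<epsilon>(1,2)] by (intro est[OF \<phi> g D(2,1) _ b]) (auto simp: b_def)
    moreover have "\<bar>\<kappa> * ?D - b * ?B\<bar> \<le> C * (\<kappa> * e * b) * measure ?S ?X"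
      unfolding band_integral_pair(2)[OF n2 g \<phi>]
      using \<epsilon>2(2)[OF \<epsilon>(1,3)] by (intro est[OF g \<phi> C(2,1) _ b]) (auto simp: b_def)
    ultimately have "\<bar>b * ?A - b * ?B\<bar> \<le> D * (\<kappa> * e * b) * measure ?S ?X + C * (\<kappa> * e * b) * measure ?S ?X"
      by linarith
    also have "\<dots> = b * (e * V)" by (simp add: V_def algebra_simps)
    finally have "b * \<bar>?A - ?B\<bar> \<le> b * (e * V)"
      using b by (simp add: right_diff_distrib[symmetric] abs_mult)
    then show ?thesis using b by simp
  qed
  have "\<bar>?A - ?B\<bar> \<le> 0"
  proof (rule field_le_epsilon)
    fix e :: real assume e: "0 < e"
    have "\<bar>?A - ?B\<bar> \<le> e / (V + 1) * V" using e V by (intro main) simp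
    also have "\<dots> \<le> e / (V + 1) * (V + 1)" using e V by (intro mult_left_mono) auto
    finally show "\<bar>?A - ?B\<bar> \<le> 0 + e" using V by simp
  qed
  then show ?thesis by simp
qed

section \<open>Odd functions and zonal test functions\<close>

text \<open>On a small ball around \<open>a\<close> the function stays above \<open>h a / 2\<close>,
  and this ball has positive measure.\<close>

lemma (in uniformly_distributed) integral_continuous_pos:
  fixes h :: "'a \<Rightarrow> real"
  assumes h: "continuous_on X h" "\<And>x. x \<in> X \<Longrightarrow> 0 \<le> h x" and a: "a \<in> X" "0 < h a" and "measure M X \<noteq> 0"
  shows "0 < (LINT x|M. h x)"
proof -
  obtain r where r: "0 < r" "\<And>x. x \<in> X \<Longrightarrow> dist x a < r \<Longrightarrow> dist (h x) (h a) < h a / 2"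
    using h(1) a unfolding continuous_on_iff by (metis half_gt_zero)
  let ?B = "X \<inter> ball a r"
  have "0 < h a / 2 * measure M ?B"
    using a(2) measure_ball_pos[OF assms(5) a(1) r(1)] by simp
  also have "\<dots> = (LINT x|M. h a / 2 * indicator ?B x)"
    using ball_sets space_eq by (simp add: Int_commute Int_left_absorb)
  also have "\<dots> \<le> (LINT x|M. h x)"
  proof (rule integral_mono)
    show "integrable M h" using h(1) by (rule integrable_continuous)
    show "integrable M (\<lambda>x. h a / 2 * indicator ?B x)"
      using ball_sets by (intro integrable_mult_right integrable_real_indicator) (simp_all add: emeasure_finite less_top[symmetric])
    fix x assume "x \<in> space M"
    then have x: "x \<in> X" by (simp add: space_eq)
    show "h a / 2 * indicator ?B x \<le> h x"
    proof (cases "x \<in> ?B")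
      case True
      then have "\<bar>h x - h a\<bar> < h a / 2" using r(2)[of x] by (simp add: dist_real_def dist_commute)
      then have "h a / 2 \<le> h x" by linarith
      then show ?thesis using True by simp
    next
      case False
      then show ?thesis using h(2)[OF x] by simp
    qed
  qed
  finally show ?thesis .
qed

text \<open>Up to \<open>pi / 3\<close> the derivative of \<open>sin\<close> is at least
  \<open>1 / 2\<close>; beyond that \<open>sin t \<ge> 1 / 2\<close>, whereas
  \<open>t / 4 \<le> pi / 8 < 1 / 2\<close>.\<close>

lemma sin_ge_quarter:
  assumes "0 \<le> t" "t \<le> pi / 2"
  shows "t / 4 \<le> sin t"
proof (cases "t \<le> pi / 3")
  case True
  have "sin 0 - 0 / 4 \<le> sin t - t / 4"
  proof (rule DERIV_nonneg_imp_nondecreasing[OF assms(1)])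
    fix x assume x: "0 \<le> x" "x \<le> t"
    have "cos (pi / 3) \<le> cos x"
      using x True by (intro cos_monotone_0_pi_le) auto
    then have "0 \<le> cos x - 1 / 4" by (simp add: cos_60)
    moreover have "((\<lambda>t. sin t - t / 4) has_real_derivative cos x - 1 / 4) (at x)"
      by (auto intro!: derivative_eq_intros)
    ultimately show "\<exists>y. ((\<lambda>t. sin t - t / 4) has_real_derivative y) (at x) \<and> 0 \<le> y" by blast
  qed
  then show ?thesis by simp
next
  case False
  have "sin (pi / 6) \<le> sin t"
    using False assms by (intro sin_monotone_2pi_le) auto
  then show ?thesis using assms(2) pi_less_4 by (simp add: sin_30)
qed

text \<open>The chord of an arc \<open>\<theta>\<close> has length
  \<open>2 * sin (\<theta> / 2)\<close>, which is at least \<open>\<theta> / 4\<close>. This turns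
  the geodesic Lipschitz condition into a Euclidean one.\<close>

lemma angle_le_dist:
  assumes "norm x = 1" "norm y = 1"
  shows "angle x y \<le> 4 * dist x y"
proof -
  define \<theta> where "\<theta> = arccos (x \<bullet> y)"
  have b: "\<bar>x \<bullet> y\<bar> \<le> 1" using Cauchy_Schwarz_ineq2[of x y] assms by simp
  then have t: "0 \<le> \<theta>" "\<theta> \<le> pi" "cos \<theta> = x \<bullet> y"
    using arccos[of "x \<bullet> y"] by (auto simp: \<theta>_def abs_le_iff)
  have xy: "x \<bullet> x = 1" "y \<bullet> y = 1" using assms unfolding norm_eq_1 by auto
  have "(dist x y)\<^sup>2 = 2 - 2 * (x \<bullet> y)"
    unfolding dist_norm power2_norm_eq_inner by (simp add: inner_diff_left inner_diff_right inner_commute xy)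
  also have "\<dots> = (2 * sin (\<theta> / 2))\<^sup>2"
    using cos_double_sin[of "\<theta> / 2"] t(3) by (simp add: power_mult_distrib)
  finally have "dist x y = 2 * sin (\<theta> / 2)"
  proof (rule power2_eq_imp_eq)
    show "0 \<le> 2 * sin (\<theta> / 2)" using t sin_ge_zero[of "\<theta> / 2"] by simp
  qed simp
  moreover have "\<theta> / 2 / 4 \<le> sin (\<theta> / 2)" using t by (intro sin_ge_quarter) auto
  ultimately show ?thesis using assms by (simp add: angle_def \<theta>_def[symmetric])
qed

lemma lipschitz_sphere_continuous:
  fixes q :: "'a::real_inner \<Rightarrow> real"
  assumes "\<And>x y. norm x = 1 \<Longrightarrow> norm y = 1 \<Longrightarrow> \<bar>q x - q y\<bar> \<le> K * dist x y" and "0 \<le> K"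
  shows "continuous_on (great_sphere 0) q"
  unfolding continuous_on_iff
proof (intro ballI allI impI)
  fix x :: 'a and e :: real assume x: "x \<in> great_sphere 0" and e: "0 < e"
  have "dist (q y) (q x) < e" if "y \<in> great_sphere 0" "dist y x < e / (K + 1)" for y
  proof -
    have "dist (q y) (q x) \<le> K * dist y x"
      using assms(1)[of y x] x that(1) by (simp add: dist_real_def great_sphere_def)
    also have "\<dots> \<le> (K + 1) * dist y x" by (intro mult_right_mono) auto
    also have "\<dots> < e" using that(2) assms(2) by (simp add: pos_less_divide_eq mult.commute)
    finally show ?thesis .
  qed
  then show "\<exists>d>0. \<forall>y\<in>great_sphere 0. dist y x < d \<longrightarrow> dist (q y) (q x) < e"
    using e assms(2) by (intro exI[of _ "e / (K + 1)"]) auto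
qed

section \<open>Slice integrals of odd functions\<close>

lemma integral_surface_uminus:
  assumes "h \<in> borel_measurable (surface \<xi>)"
  shows "(LINT u|surface \<xi>. h (- u)) = (LINT u|surface \<xi>. (h u :: real))"
  using integral_distr[OF distr_surface_uminus(2)[of \<xi>] assms] unfolding distr_surface_uminus(1) by simp

lemma integral_surface_reflection:
  assumes "h \<in> borel_measurable (surface (reflection w \<xi>))"
  shows "(LINT u|surface \<xi>. h (reflection w u)) = (LINT u|surface (reflection w \<xi>). (h u :: real))"
  using integral_distr[OF distr_surface_reflection(2)[of w \<xi>] assms] unfolding distr_surface_reflection(1) by simp

lemma slice_point_dist:
  assumes "norm \<xi> = 1" "norm u = 1" "\<bar>z\<bar> \<le> 1"
  shows "dist (z *\<^sub>R \<xi> + sqrt (1 - z\<^sup>2) *\<^sub>R u) u \<le> 2 * \<bar>z\<bar>"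
proof -
  have z2: "z\<^sup>2 \<le> 1" using assms(3) by (simp only: abs_square_le_1)
  have eq: "z *\<^sub>R \<xi> + sqrt (1 - z\<^sup>2) *\<^sub>R u - u = z *\<^sub>R \<xi> + (sqrt (1 - z\<^sup>2) - 1) *\<^sub>R u"
    by (simp add: algebra_simps)
  have "dist (z *\<^sub>R \<xi> + sqrt (1 - z\<^sup>2) *\<^sub>R u) u \<le> \<bar>z\<bar> + \<bar>sqrt (1 - z\<^sup>2) - 1\<bar>"
    unfolding dist_norm eq
    using norm_triangle_ineq[of "z *\<^sub>R \<xi>" "(sqrt (1 - z\<^sup>2) - 1) *\<^sub>R u"] assms(1,2)
    by (simp only: norm_scaleR mult_1_right)
  moreover have "\<bar>sqrt (1 - z\<^sup>2) - 1\<bar> \<le> \<bar>z\<bar>"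
    using abs_sqrt_diff_le[of "1 - z\<^sup>2" 1] z2 by simp
  ultimately show ?thesis by linarith
qed

text \<open>The equator is invariant under \<open>u \<mapsto> - u\<close>, so an odd
  \<open>q\<close> has integral 0 over it and \<open>q u\<close> may be subtracted freely. This
  makes \<open>slice z q \<xi> / z\<close> a difference quotient at 0.\<close>

lemma slice_odd_eq:
  fixes q :: "real ^ 'n \<Rightarrow> real"
  assumes n2: "CARD('n) \<ge> 2" and xi: "norm \<xi> = 1" and z: "\<bar>z\<bar> \<le> 1"
    and q: "continuous_on (great_sphere 0) q" and odd: "\<And>x. norm x = 1 \<Longrightarrow> q (- x) = - q x"
  shows "integrable (surface \<xi>) (\<lambda>u. q (z *\<^sub>R \<xi> + sqrt (1 - z\<^sup>2) *\<^sub>R u) - q u)"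
    and "slice z q \<xi> = (LINT u|surface \<xi>. q (z *\<^sub>R \<xi> + sqrt (1 - z\<^sup>2) *\<^sub>R u) - q u)"
proof -
  interpret uniformly_distributed "surface \<xi>" "great_sphere \<xi> :: (real ^ 'n) set"
    using n2 xi by (intro uniformly_distributed_surface) auto
  have qc: "continuous_on (great_sphere \<xi>) q"
    by (rule continuous_on_subset[OF q]) (auto simp: great_sphere_def)
  have int_q: "integrable (surface \<xi>) q" using qc by (rule integrable_continuous)
  have int_s: "integrable (surface \<xi>) (\<lambda>u. q (z *\<^sub>R \<xi> + sqrt (1 - z\<^sup>2) *\<^sub>R u))"
    by (intro integrable_continuous continuous_on_compose2[OF q])
      (use slice_point_norm[OF xi] z in \<open>auto intro!: continuous_intros simp: mem_great_sphere_0\<close>)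
  have "(LINT u|surface \<xi>. q u) = (LINT u|surface \<xi>. q (- u))"
    using qc by (intro integral_surface_uminus[symmetric] borel_measurable_continuous)
  also have "\<dots> = (LINT u|surface \<xi>. - q u)"
    by (intro Bochner_Integration.integral_cong) (auto simp: odd great_sphere_def)
  also have "\<dots> = - (LINT u|surface \<xi>. q u)" by simp
  finally have "(LINT u|surface \<xi>. q u) = 0" by linarith
  then show "slice z q \<xi> = (LINT u|surface \<xi>. q (z *\<^sub>R \<xi> + sqrt (1 - z\<^sup>2) *\<^sub>R u) - q u)"
    using int_q int_s by (simp add: slice_def)
  show "integrable (surface \<xi>) (\<lambda>u. q (z *\<^sub>R \<xi> + sqrt (1 - z\<^sup>2) *\<^sub>R u) - q u)"
    using int_q int_s by simp
qed

text \<open>Each slice point is within \<open>2 * \<bar>z\<bar>\<close> of its equatorial point.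
  After division by \<open>z\<close> the bound is uniform in \<open>z\<close> and
  \<open>\<xi>\<close>, which is the domination used for the limits.\<close>

lemma slice_odd_bound:
  fixes q :: "real ^ 'n \<Rightarrow> real"
  assumes n2: "CARD('n) \<ge> 2" and xi: "norm \<xi> = 1" and z: "\<bar>z\<bar> \<le> 1"
    and lip: "\<And>x y. norm x = 1 \<Longrightarrow> norm y = 1 \<Longrightarrow> \<bar>q x - q y\<bar> \<le> K * dist x y" and K: "0 \<le> K"
    and odd: "\<And>x. norm x = 1 \<Longrightarrow> q (- x) = - q x"
  shows "\<bar>slice z q \<xi>\<bar> \<le> 2 * K * \<bar>z\<bar> * measure (surface \<xi>) (great_sphere \<xi>)"
proof -
  interpret uniformly_distributed "surface \<xi>" "great_sphere \<xi> :: (real ^ 'n) set"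
    using n2 xi by (intro uniformly_distributed_surface) auto
  have qc: "continuous_on (great_sphere 0) q" using lip K by (rule lipschitz_sphere_continuous)
  have E: "integrable (surface \<xi>) (\<lambda>u. q (z *\<^sub>R \<xi> + sqrt (1 - z\<^sup>2) *\<^sub>R u) - q u)"
    "slice z q \<xi> = (LINT u|surface \<xi>. q (z *\<^sub>R \<xi> + sqrt (1 - z\<^sup>2) *\<^sub>R u) - q u)"
    by (rule slice_odd_eq[OF n2 xi z qc]; simp add: odd)+
  have "\<bar>slice z q \<xi>\<bar> \<le> (LINT u|surface \<xi>. 2 * K * \<bar>z\<bar>)"
    unfolding E(2)
  proof (rule integral_abs_le_integral)
    show "integrable (surface \<xi>) (\<lambda>u. q (z *\<^sub>R \<xi> + sqrt (1 - z\<^sup>2) *\<^sub>R u) - q u)" by (rule E(1))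
    fix u assume u: "u \<in> space (surface \<xi>)"
    then have u1: "norm u = 1" by (simp add: great_sphere_def)
    have "\<bar>q (z *\<^sub>R \<xi> + sqrt (1 - z\<^sup>2) *\<^sub>R u) - q u\<bar> \<le> K * dist (z *\<^sub>R \<xi> + sqrt (1 - z\<^sup>2) *\<^sub>R u) u"
      using u u1 xi z by (intro lip slice_point_norm) auto
    also have "\<dots> \<le> K * (2 * \<bar>z\<bar>)" using slice_point_dist[OF xi u1 z] K by (rule mult_left_mono)
    finally show "\<bar>q (z *\<^sub>R \<xi> + sqrt (1 - z\<^sup>2) *\<^sub>R u) - q u\<bar> \<le> 2 * K * \<bar>z\<bar>" by simp
  qed (simp_all)
  then show ?thesis by (simp add: mult_ac)
qed

section \<open>Zonal powers and their equatorial moments\<close>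

lemma zonal_power_lipschitz:
  assumes "norm a = 1" "norm x = 1" "norm y = 1"
  shows "\<bar>(x \<bullet> a) ^ k - (y \<bullet> a) ^ k\<bar> \<le> real k * dist x y"
proof -
  have "\<bar>(x \<bullet> a) ^ k - (y \<bullet> a) ^ k\<bar> \<le> real k * \<bar>x \<bullet> a - y \<bullet> a\<bar>"
    using norm_power_diff[of "x \<bullet> a" "y \<bullet> a" k] Cauchy_Schwarz_ineq2[of x a] Cauchy_Schwarz_ineq2[of y a] assms
    by simp
  also have "\<dots> \<le> real k * dist x y"
    using Cauchy_Schwarz_ineq2[of "x - y" a] assms(1) by (intro mult_left_mono) (simp_all add: inner_diff_left dist_norm)
  finally show ?thesis .
qed

lemma great_sphere_nonempty:
  fixes \<xi> :: "real ^ 'n"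
  assumes "CARD('n) \<ge> 2" "norm \<xi> = 1"
  obtains e where "e \<in> great_sphere \<xi>"
  using measure_surface_pos[of \<xi>] assms by (metis all_not_in_conv less_irrefl measure_empty)

text \<open>On the equator of \<open>\<xi>\<close> only the equatorial component of \<open>a\<close>
  is seen. It is \<open>r *\<^sub>R e\<close> with \<open>e\<close> a unit vector of the equator and
  \<open>r\<^sup>2 = 1 - (\<xi> \<bullet> a)\<^sup>2\<close>; the moment in direction
  \<open>e\<close> is the same for all \<open>\<xi>\<close> and \<open>e\<close> by
  reflections.\<close>

lemma equatorial_moment:
  assumes n2: "CARD('n) \<ge> 2"
  obtains c where "0 < c"
    "\<And>\<xi> a :: real ^ 'n. norm \<xi> = 1 \<Longrightarrow> norm a = 1 \<Longrightarrow> (LINT u|surface \<xi>. (u \<bullet> a) ^ (2 * j)) = c * (1 - (\<xi> \<bullet> a)\<^sup>2) ^ j"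
proof -
  define m where "m \<xi> e = (LINT u|surface \<xi>. (u \<bullet> e) ^ (2 * j))" for \<xi> e :: "real ^ 'n"
  have U: "uniformly_distributed (surface \<xi>) (great_sphere \<xi>)" if "norm \<xi> = 1" for \<xi> :: "real ^ 'n"
    using that n2 by (intro uniformly_distributed_surface) auto
  have cont: "continuous_on A (\<lambda>u :: real ^ 'n. (u \<bullet> e) ^ (2 * j))" for A e
    by (intro continuous_intros)
  have refl: "m (reflection w \<xi>) (reflection w e) = m \<xi> e" if "norm \<xi> = 1" for w \<xi> e
  proof -
    have "(\<lambda>u. (u \<bullet> reflection w e) ^ (2 * j)) \<in> borel_measurable (surface (reflection w \<xi>))"
      using that by (intro uniformly_distributed.borel_measurable_continuous[OF U] cont) simp
    from integral_surface_reflection[OF this] show ?thesis by (simp add: m_def)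
  qed
  have const: "m \<xi> e = m \<eta> d" if "norm \<xi> = 1" "norm \<eta> = 1" "e \<in> great_sphere \<xi>" "d \<in> great_sphere \<eta>" for \<xi> \<eta> e d
  proof -
    define e' where "e' = reflection (\<xi> - \<eta>) e"
    have T: "reflection (\<xi> - \<eta>) \<xi> = \<eta>" using that by (intro reflection_diff) simp
    have e': "norm e' = 1" "e' \<bullet> \<eta> = 0"
      using that(3) inner_reflection[of "\<xi> - \<eta>" e \<xi>] T by (auto simp: e'_def great_sphere_def)
    have d: "norm d = 1" "d \<bullet> \<eta> = 0" using that(4) by (auto simp: great_sphere_def)
    have "m \<xi> e = m \<eta> e'" using refl[OF that(1), of "\<xi> - \<eta>" e] by (simp add: T e'_def)
    also have "\<dots> = m (reflection (e' - d) \<eta>) (reflection (e' - d) e')"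
      by (rule refl[symmetric, OF that(2)])
    \<comment> \<open>After the first reflection has moved the pole, the second one moves the
      direction within the new equator and fixes the pole.\<close>
    also have "reflection (e' - d) \<eta> = \<eta>"
      using e' d by (intro reflection_diff_fixes) (simp add: inner_commute)
    also have "reflection (e' - d) e' = d" using e' d by (intro reflection_diff) simp
    finally show ?thesis .
  qed
  define \<xi>0 :: "real ^ 'n" where "\<xi>0 = axis undefined 1"
  have n0: "norm \<xi>0 = 1" by (simp add: \<xi>0_def)
  obtain e0 where e0: "e0 \<in> great_sphere \<xi>0" using great_sphere_nonempty[OF n2 n0] by blast
  have "0 < m \<xi>0 e0"
    unfolding m_def
  proof (rule uniformly_distributed.integral_continuous_pos[OF U[OF n0] cont _ e0])
    show "0 \<le> (x \<bullet> e0) ^ (2 * j)" for x by simp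
    have "e0 \<bullet> e0 = 1" using e0 unfolding great_sphere_def norm_eq_1 by simp
    then show "0 < (e0 \<bullet> e0) ^ (2 * j)" by simp
    show "measure (surface \<xi>0) (great_sphere \<xi>0) \<noteq> 0" using measure_surface_pos[of \<xi>0] n0 n2 by simp
  qed
  moreover have "m \<xi> a = m \<xi>0 e0 * (1 - (\<xi> \<bullet> a)\<^sup>2) ^ j" if xi: "norm \<xi> = 1" and a: "norm a = 1" for \<xi> a
  proof -
    define r where "r = sqrt (1 - (a \<bullet> \<xi>)\<^sup>2)"
    have r: "norm (a - (a \<bullet> \<xi>) *\<^sub>R \<xi>) = r" unfolding r_def by (rule norm_equator_component[OF xi a])
    have "\<bar>a \<bullet> \<xi>\<bar> \<le> 1" using Cauchy_Schwarz_ineq2[of a \<xi>] xi a by simp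
    then have "(a \<bullet> \<xi>)\<^sup>2 \<le> 1" by (simp only: abs_square_le_1)
    then have r2: "r\<^sup>2 = 1 - (\<xi> \<bullet> a)\<^sup>2" by (simp add: r_def inner_commute)
    obtain e where e: "e \<in> great_sphere \<xi>" "a - (a \<bullet> \<xi>) *\<^sub>R \<xi> = r *\<^sub>R e"
    proof (cases "r = 0")
      \<comment> \<open>Here \<open>a\<close> is \<open>\<xi>\<close> or \<open>- \<xi>\<close>, and
        any direction serves.\<close>
      case True
      obtain e where "e \<in> great_sphere \<xi>" using great_sphere_nonempty[OF n2 xi] by blast
      then show ?thesis using that[of e] True r by simp
    next
      case False
      have xx: "\<xi> \<bullet> \<xi> = 1" using xi unfolding norm_eq_1 .
      let ?e = "(a - (a \<bullet> \<xi>) *\<^sub>R \<xi>) /\<^sub>R r"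
      have "norm ?e = 1" using False r norm_ge_zero[of "a - (a \<bullet> \<xi>) *\<^sub>R \<xi>"] by simp
      moreover have "?e \<bullet> \<xi> = 0" using xx by (simp add: inner_diff_left)
      ultimately show ?thesis using that[of ?e] False by (simp add: great_sphere_def)
    qed
    have ua: "u \<bullet> a = r * (u \<bullet> e)" if "u \<in> great_sphere \<xi>" for u
    proof -
      have "u \<bullet> (a - (a \<bullet> \<xi>) *\<^sub>R \<xi>) = u \<bullet> (r *\<^sub>R e)" using e(2) by simp
      then show ?thesis using that by (simp add: great_sphere_def inner_diff_right)
    qed
    have "m \<xi> a = (LINT u|surface \<xi>. r ^ (2 * j) * (u \<bullet> e) ^ (2 * j))"
      unfolding m_def by (intro Bochner_Integration.integral_cong) (auto simp: ua power_mult_distrib)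
    also have "\<dots> = r ^ (2 * j) * m \<xi> e" by (simp add: m_def)
    also have "m \<xi> e = m \<xi>0 e0" using xi n0 e(1) e0 by (rule const)
    also have "r ^ (2 * j) = (1 - (\<xi> \<bullet> a)\<^sup>2) ^ j" by (simp add: power_mult r2)
    finally show ?thesis by simp
  qed
  ultimately show ?thesis using that[of "m \<xi>0 e0"] by (simp add: m_def)
qed

text \<open>Differentiation at \<open>z = 0\<close> under the integral. The factor
  \<open>sqrt (1 - z\<^sup>2)\<close> has derivative 0 there, so only the displacement along
  \<open>\<xi>\<close> contributes.\<close>

lemma slice_odd_zonal_power:
  fixes \<xi> a :: "real ^ 'n"
  assumes n2: "CARD('n) \<ge> 2" and xi: "norm \<xi> = 1" and a: "norm a = 1" and "odd k"
    and z: "z \<longlonglongrightarrow> 0" "\<And>i. z i \<noteq> 0" "\<And>i. \<bar>z i\<bar> \<le> 1"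
  shows "(\<lambda>i. slice (z i) (\<lambda>x. (x \<bullet> a) ^ k) \<xi> / z i)
    \<longlonglongrightarrow> real k * (\<xi> \<bullet> a) * (LINT u|surface \<xi>. (u \<bullet> a) ^ (k - 1))"
proof -
  let ?q = "\<lambda>x. (x \<bullet> a) ^ k"
  interpret uniformly_distributed "surface \<xi>" "great_sphere \<xi> :: (real ^ 'n) set"
    using n2 xi by (intro uniformly_distributed_surface) auto
  have qc: "continuous_on (great_sphere 0) ?q" by (intro continuous_intros)
  have odd: "?q (- x) = - ?q x" for x using \<open>odd k\<close> by (simp add: power_minus_odd)
  let ?d = "\<lambda>i u. (?q (z i *\<^sub>R \<xi> + sqrt (1 - (z i)\<^sup>2) *\<^sub>R u) - ?q u) / z i"
  have eq: "slice (z i) ?q \<xi> / z i = (LINT u|surface \<xi>. ?d i u)" for i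
    unfolding slice_odd_eq(2)[OF n2 xi z(3) qc odd] by simp
  have "(\<lambda>i. LINT u|surface \<xi>. ?d i u) \<longlonglongrightarrow> (LINT u|surface \<xi>. real k * (u \<bullet> a) ^ (k - 1) * (\<xi> \<bullet> a))"
  proof (rule integral_dominated_convergence[where w = "\<lambda>_. 2 * real k"])
    show "(\<lambda>u. real k * (u \<bullet> a) ^ (k - 1) * (\<xi> \<bullet> a)) \<in> borel_measurable (surface \<xi>)"
      by (intro borel_measurable_continuous continuous_intros)
    show "?d i \<in> borel_measurable (surface \<xi>)" for i
      by (intro borel_measurable_continuous continuous_intros) (simp add: z(2))
    show "integrable (surface \<xi>) (\<lambda>_. 2 * real k)" by simp
    show "AE u in surface \<xi>. (\<lambda>i. ?d i u) \<longlonglongrightarrow> real k * (u \<bullet> a) ^ (k - 1) * (\<xi> \<bullet> a)"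
    proof (rule AE_I2)
      fix u
      define h where "h s = (s * (\<xi> \<bullet> a) + sqrt (1 - s\<^sup>2) * (u \<bullet> a)) ^ k" for s
      have "(h has_real_derivative real k * (u \<bullet> a) ^ (k - 1) * (\<xi> \<bullet> a)) (at 0)"
        unfolding h_def by (auto intro!: derivative_eq_intros)
      then have "((\<lambda>s. (h s - h 0) / s) \<longlongrightarrow> real k * (u \<bullet> a) ^ (k - 1) * (\<xi> \<bullet> a)) (at 0)"
        by (simp add: has_field_derivative_iff)
      moreover have "filterlim z (at 0) sequentially"
        using z(1,2) by (simp add: filterlim_at)
      ultimately have "(\<lambda>i. (h (z i) - h 0) / z i) \<longlonglongrightarrow> real k * (u \<bullet> a) ^ (k - 1) * (\<xi> \<bullet> a)"
        by (rule filterlim_compose)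
      then show "(\<lambda>i. ?d i u) \<longlonglongrightarrow> real k * (u \<bullet> a) ^ (k - 1) * (\<xi> \<bullet> a)"
        by (simp add: h_def inner_add_left)
    qed
    show "AE u in surface \<xi>. norm (?d i u) \<le> 2 * real k" for i
    proof (rule AE_I2)
      fix u assume u: "u \<in> space (surface \<xi>)"
      then have u1: "norm u = 1" by (simp add: great_sphere_def)
      have "\<bar>?q (z i *\<^sub>R \<xi> + sqrt (1 - (z i)\<^sup>2) *\<^sub>R u) - ?q u\<bar>
          \<le> real k * dist (z i *\<^sub>R \<xi> + sqrt (1 - (z i)\<^sup>2) *\<^sub>R u) u"
        using u u1 xi a z(3) by (intro zonal_power_lipschitz slice_point_norm) auto
      also have "\<dots> \<le> real k * (2 * \<bar>z i\<bar>)"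
        using slice_point_dist[OF xi u1 z(3)] by (intro mult_left_mono) auto
      finally show "norm (?d i u) \<le> 2 * real k"
        using z(2)[of i] by (simp add: divide_le_eq mult_ac)
    qed
  qed
  also have "(LINT u|surface \<xi>. real k * (u \<bullet> a) ^ (k - 1) * (\<xi> \<bullet> a)) = real k * (\<xi> \<bullet> a) * (LINT u|surface \<xi>. (u \<bullet> a) ^ (k - 1))"
    by (simp add: mult_ac)
  finally show ?thesis unfolding eq .
qed

section \<open>From the critical point hypothesis to orthogonality\<close>

lemma slice_odd_part:
  fixes f :: "real ^ 'n \<Rightarrow> real"
  assumes n2: "CARD('n) \<ge> 2" and xi: "norm \<xi> = 1" and z: "\<bar>z\<bar> \<le> 1" and f: "continuous_on (great_sphere 0) f"
  shows "slice z (\<lambda>x. f x - f (- x)) \<xi> = slice z f \<xi> - slice (- z) f \<xi>"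
proof -
  interpret uniformly_distributed "surface \<xi>" "great_sphere \<xi> :: (real ^ 'n) set"
    using n2 xi by (intro uniformly_distributed_surface) auto
  let ?h = "\<lambda>z u. f (z *\<^sub>R \<xi> + sqrt (1 - z\<^sup>2) *\<^sub>R u)"
  have c: "continuous_on (great_sphere \<xi>) (?h y)" if "\<bar>y\<bar> \<le> 1" for y
    by (rule continuous_on_compose2[OF f])
      (use slice_point_norm[OF xi] that in \<open>auto intro!: continuous_intros simp: mem_great_sphere_0\<close>)
  have c': "continuous_on (great_sphere \<xi>) (\<lambda>u. ?h (- z) (- u))"
    by (rule continuous_on_compose2[OF c]) (use z in \<open>auto intro!: continuous_intros simp: great_sphere_def\<close>)
  have "slice (- z) f \<xi> = (LINT u|surface \<xi>. ?h (- z) u)" by (simp add: slice_def)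
  \<comment> \<open>With both signs changed, the slice point is the antipode of the one for
    \<open>z\<close> and \<open>u\<close>.\<close>
  also have "\<dots> = (LINT u|surface \<xi>. ?h (- z) (- u))"
    using c[of "- z"] z by (intro integral_surface_uminus[symmetric] borel_measurable_continuous) auto
  finally have "slice z f \<xi> - slice (- z) f \<xi> = (LINT u|surface \<xi>. ?h z u) - (LINT u|surface \<xi>. ?h (- z) (- u))"
    by (simp add: slice_def)
  also have "\<dots> = (LINT u|surface \<xi>. ?h z u - ?h (- z) (- u))"
    using integrable_continuous[OF c[OF z]] integrable_continuous[OF c']
    by (rule Bochner_Integration.integral_diff[symmetric])
  also have "\<dots> = slice z (\<lambda>x. f x - f (- x)) \<xi>"
    unfolding slice_def by (rule Bochner_Integration.integral_cong) (simp_all add: algebra_simps)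
  finally show ?thesis by simp
qed

text \<open>In the sum of the difference quotients of the section integral at \<open>z\<close> and
  at \<open>- z\<close> the value at 0 cancels. The even scaling factor is common to both sections
  and tends to 1.\<close>

lemma slice_odd_part_tendsto:
  fixes f :: "real ^ 'n \<Rightarrow> real"
  assumes n2: "CARD('n) \<ge> 2" and xi: "norm \<xi> = 1" and f: "continuous_on (great_sphere 0) f"
    and deriv: "(section_integral f \<xi> has_real_derivative 0) (at 0)"
    and z: "z \<longlonglongrightarrow> 0" "\<And>i. z i \<noteq> 0" "\<And>i. \<bar>z i\<bar> < 1"
  shows "(\<lambda>i. slice (z i) (\<lambda>x. f x - f (- x)) \<xi> / z i) \<longlonglongrightarrow> 0"
proof -
  let ?F = "section_integral f \<xi>" and ?m = "CARD('n) - 2"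
  let ?g = "\<lambda>x. f x - f (- x)"
  have f': "continuous_on (sphere 0 1) f" using f by (simp add: great_sphere_0)
  have D: "((\<lambda>s. (?F s - ?F 0) / s) \<longlongrightarrow> 0) (at 0)"
    using deriv by (simp add: has_field_derivative_iff)
  have "filterlim z (at 0) sequentially" using z(1,2) by (simp add: filterlim_at)
  from filterlim_compose[OF D this] have D1: "(\<lambda>i. (?F (z i) - ?F 0) / z i) \<longlonglongrightarrow> 0" .
  have "filterlim (\<lambda>i. - z i) (at 0) sequentially"
    using tendsto_minus[OF z(1)] z(2) by (simp add: filterlim_at)
  from filterlim_compose[OF D this] have D2: "(\<lambda>i. (?F (- z i) - ?F 0) / (- z i)) \<longlonglongrightarrow> 0" .
  from tendsto_add[OF D1 D2] have A: "(\<lambda>i. (?F (z i) - ?F 0) / z i + (?F (- z i) - ?F 0) / (- z i)) \<longlonglongrightarrow> 0" by simp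
  have "(\<lambda>i. sqrt (1 - (z i)\<^sup>2) ^ ?m) \<longlonglongrightarrow> sqrt (1 - 0\<^sup>2) ^ ?m"
    by (intro tendsto_intros z(1))
  then have B: "(\<lambda>i. sqrt (1 - (z i)\<^sup>2) ^ ?m) \<longlonglongrightarrow> 1" by simp
  have "slice (z i) ?g \<xi> / z i = ((?F (z i) - ?F 0) / z i + (?F (- z i) - ?F 0) / (- z i)) / sqrt (1 - (z i)\<^sup>2) ^ ?m" for i
  proof -
    have "(z i)\<^sup>2 < 1" using z(3)[of i] by (simp only: abs_square_less_1)
    then have s: "sqrt (1 - (z i)\<^sup>2) ^ ?m \<noteq> 0" by simp
    have "?F (z i) - ?F (- z i) = sqrt (1 - (z i)\<^sup>2) ^ ?m * slice (z i) ?g \<xi>"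
      using section_integral_eq_slice[OF xi _ f' n2, of "z i"] section_integral_eq_slice[OF xi _ f' n2, of "- z i"]
        slice_odd_part[OF n2 xi _ f, of "z i"] z(3)[of i] by (simp add: right_diff_distrib)
    then have "slice (z i) ?g \<xi> = (?F (z i) - ?F (- z i)) / sqrt (1 - (z i)\<^sup>2) ^ ?m" using s by simp
    moreover have "(?F (z i) - ?F 0) / z i + (?F (- z i) - ?F 0) / (- z i) = (?F (z i) - ?F (- z i)) / z i"
      by (simp add: minus_divide_right[symmetric] diff_divide_distrib)
    ultimately show ?thesis by simp
  qed
  then show ?thesis using tendsto_divide[OF A B] by simp
qed

text \<open>By self-adjointness the same sequence of integrals has two limits: 0, from the
  hypothesis on \<open>g\<close>, and a positive multiple of the claimed integral, from the explicit
  derivative of the zonal power. Both follow by dominated convergence.\<close>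

lemma zonal_odd_orthogonal:
  fixes g :: "real ^ 'n \<Rightarrow> real"
  assumes n2: "CARD('n) \<ge> 2" and a: "norm a = 1" and K: "0 \<le> K"
    and lip: "\<And>x y. norm x = 1 \<Longrightarrow> norm y = 1 \<Longrightarrow> \<bar>g x - g y\<bar> \<le> K * dist x y"
    and odd: "\<And>x. norm x = 1 \<Longrightarrow> g (- x) = - g x"
    and z: "z \<longlonglongrightarrow> 0" "\<And>i. z i \<noteq> 0" "\<And>i. \<bar>z i\<bar> < 1"
    and lim: "AE \<xi> in surface 0. (\<lambda>i. slice (z i) g \<xi> / z i) \<longlonglongrightarrow> 0"
  shows "(LINT x|surface 0. g x * ((x \<bullet> a) * (1 - (x \<bullet> a)\<^sup>2) ^ j)) = 0"
proof -
  let ?S = "surface 0 :: (real ^ 'n) measure" and ?X = "great_sphere 0 :: (real ^ 'n) set"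
  interpret S: uniformly_distributed "surface 0" "great_sphere 0 :: (real ^ 'n) set"
    using n2 by (intro uniformly_distributed_surface) auto
  obtain \<kappa> where \<kappa>: "0 < \<kappa>" "\<And>\<xi> :: real ^ 'n. norm \<xi> = 1 \<Longrightarrow> measure (surface \<xi>) (great_sphere \<xi>) = \<kappa>"
    using great_sphere_volume[OF n2] by blast
  obtain c where c: "0 < c" "\<And>\<xi> a :: real ^ 'n. norm \<xi> = 1 \<Longrightarrow> norm a = 1 \<Longrightarrow>
      (LINT u|surface \<xi>. (u \<bullet> a) ^ (2 * j)) = c * (1 - (\<xi> \<bullet> a)\<^sup>2) ^ j"
    using equatorial_moment[OF n2] by blast
  \<comment> \<open>Then \<open>?k - 1 = 2 * j\<close> is the exponent in
    \<open>equatorial_moment\<close>.\<close>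
  let ?k = "2 * j + 1"
  let ?\<phi> = "\<lambda>x. (x \<bullet> a) ^ ?k"
  have z1: "\<bar>z i\<bar> \<le> 1" for i using z(3)[of i] by simp
  have gc: "continuous_on ?X g" using lip K by (rule lipschitz_sphere_continuous)
  have \<phi>c: "continuous_on ?X ?\<phi>" by (intro continuous_intros)
  have \<phi>lip: "\<bar>?\<phi> x - ?\<phi> y\<bar> \<le> real ?k * dist x y" if "norm x = 1" "norm y = 1" for x y
    using a that by (rule zonal_power_lipschitz)
  have \<phi>odd: "?\<phi> (- x) = - ?\<phi> x" for x by simp
  have \<phi>1: "\<bar>?\<phi> x\<bar> \<le> 1" if "norm x = 1" for x
    using Cauchy_Schwarz_ineq2[of x a] that a unfolding power_abs by (intro power_le_one) auto
  have "bounded (g ` ?X)"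
    using compact_continuous_image[OF gc compact_great_sphere] by (rule compact_imp_bounded)
  then obtain C where "\<forall>y\<in>g ` ?X. norm y \<le> C" unfolding bounded_iff by (elim exE)
  then have C: "\<bar>g x\<bar> \<le> C" if "norm x = 1" for x
    using that by (simp add: mem_great_sphere_0)
  have sb: "\<bar>slice (z i) q \<xi> / z i\<bar> \<le> 2 * B * \<kappa>"
    if "norm \<xi> = 1" "\<And>x y. norm x = 1 \<Longrightarrow> norm y = 1 \<Longrightarrow> \<bar>q x - q y\<bar> \<le> B * dist x y" "0 \<le> B"
      "\<And>x. norm x = 1 \<Longrightarrow> q (- x) = - q x"
    for q :: "real ^ 'n \<Rightarrow> real" and B \<xi> i
  proof -
    have zi: "0 < \<bar>z i\<bar>" using z(2) by simp
    have "\<bar>slice (z i) q \<xi>\<bar> \<le> 2 * B * \<bar>z i\<bar> * \<kappa>"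
      using slice_odd_bound[where q = q and K = B, OF n2 that(1) z1[of i] that(2,3,4)]
      unfolding \<kappa>(2)[OF that(1)] .
    also have "\<dots> = 2 * B * \<kappa> * \<bar>z i\<bar>" by (simp only: mult_ac)
    finally show ?thesis unfolding abs_divide pos_divide_le_eq[OF zi] .
  qed
  have meas: "(\<lambda>\<xi>. slice (z i) q \<xi> / z i) \<in> borel_measurable ?S" if "continuous_on ?X q" for q i
    by (intro borel_measurable_divide borel_measurable_const slice_measurable[OF n2 z(3) that])
  note [measurable] = S.borel_measurable_continuous[OF gc] S.borel_measurable_continuous[OF \<phi>c] meas[OF gc] meas[OF \<phi>c]
  have lim1: "(\<lambda>i. LINT \<xi>|?S. ?\<phi> \<xi> * (slice (z i) g \<xi> / z i)) \<longlonglongrightarrow> (LINT \<xi>|?S. 0)"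
  proof (rule integral_dominated_convergence[where w = "\<lambda>_. 1 * (2 * K * \<kappa>)"])
    show "AE \<xi> in ?S. (\<lambda>i. ?\<phi> \<xi> * (slice (z i) g \<xi> / z i)) \<longlonglongrightarrow> 0"
      using lim by eventually_elim (rule tendsto_mult_right_zero)
    show "AE \<xi> in ?S. norm (?\<phi> \<xi> * (slice (z i) g \<xi> / z i)) \<le> 1 * (2 * K * \<kappa>)" for i
    proof (rule AE_I2)
      fix \<xi> assume "\<xi> \<in> space ?S"
      then have xi: "norm \<xi> = 1" by (simp add: mem_great_sphere_0)
      have "\<bar>slice (z i) g \<xi> / z i\<bar> \<le> 2 * K * \<kappa>" using xi lip K odd by (rule sb)
      with \<phi>1[OF xi] show "norm (?\<phi> \<xi> * (slice (z i) g \<xi> / z i)) \<le> 1 * (2 * K * \<kappa>)"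
        unfolding real_norm_def abs_mult by (intro mult_mono) auto
    qed
    show "(\<lambda>\<xi>. ?\<phi> \<xi> * (slice (z i) g \<xi> / z i)) \<in> borel_measurable ?S" for i by measurable
  qed simp_all
  have lim2: "(\<lambda>i. LINT \<xi>|?S. g \<xi> * (slice (z i) ?\<phi> \<xi> / z i))
      \<longlonglongrightarrow> (LINT \<xi>|?S. g \<xi> * (real ?k * (\<xi> \<bullet> a) * (c * (1 - (\<xi> \<bullet> a)\<^sup>2) ^ j)))"
  proof (rule integral_dominated_convergence[where w = "\<lambda>_. C * (2 * real ?k * \<kappa>)"])
    show "AE \<xi> in ?S. (\<lambda>i. g \<xi> * (slice (z i) ?\<phi> \<xi> / z i)) \<longlonglongrightarrow> g \<xi> * (real ?k * (\<xi> \<bullet> a) * (c * (1 - (\<xi> \<bullet> a)\<^sup>2) ^ j))"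
    proof (rule AE_I2)
      fix \<xi> assume "\<xi> \<in> space ?S"
      then have xi: "norm \<xi> = 1" by (simp add: mem_great_sphere_0)
      have "(\<lambda>i. slice (z i) ?\<phi> \<xi> / z i) \<longlonglongrightarrow> real ?k * (\<xi> \<bullet> a) * (LINT u|surface \<xi>. (u \<bullet> a) ^ (?k - 1))"
        using z(1,2) z1 by (intro slice_odd_zonal_power[OF n2 xi a]) auto
      then show "(\<lambda>i. g \<xi> * (slice (z i) ?\<phi> \<xi> / z i)) \<longlonglongrightarrow> g \<xi> * (real ?k * (\<xi> \<bullet> a) * (c * (1 - (\<xi> \<bullet> a)\<^sup>2) ^ j))"
        using c(2)[OF xi a] by (intro tendsto_mult tendsto_const) simp
    qed
    show "AE \<xi> in ?S. norm (g \<xi> * (slice (z i) ?\<phi> \<xi> / z i)) \<le> C * (2 * real ?k * \<kappa>)" for i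
    proof (rule AE_I2)
      fix \<xi> assume "\<xi> \<in> space ?S"
      then have xi: "norm \<xi> = 1" by (simp add: mem_great_sphere_0)
      have "\<bar>slice (z i) ?\<phi> \<xi> / z i\<bar> \<le> 2 * real ?k * \<kappa>" using xi \<phi>lip of_nat_0_le_iff \<phi>odd by (rule sb)
      with C[OF xi] show "norm (g \<xi> * (slice (z i) ?\<phi> \<xi> / z i)) \<le> C * (2 * real ?k * \<kappa>)"
        unfolding real_norm_def abs_mult by (intro mult_mono) (auto intro: order_trans[OF abs_ge_zero])
    qed
    show "(\<lambda>\<xi>. g \<xi> * (slice (z i) ?\<phi> \<xi> / z i)) \<in> borel_measurable ?S" for i by measurable
    show "(\<lambda>\<xi>. g \<xi> * (real ?k * (\<xi> \<bullet> a) * (c * (1 - (\<xi> \<bullet> a)\<^sup>2) ^ j))) \<in> borel_measurable ?S"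
      by (intro S.borel_measurable_continuous continuous_intros gc)
  qed simp
  have swap: "(LINT \<xi>|?S. ?\<phi> \<xi> * (slice (z i) g \<xi> / z i)) = (LINT \<xi>|?S. g \<xi> * (slice (z i) ?\<phi> \<xi> / z i))" for i
    using slice_self_adjoint[OF n2 z(3) gc \<phi>c, of i] by (simp only: times_divide_eq_right integral_divide_zero)
  have "(LINT \<xi>|?S. g \<xi> * (real ?k * (\<xi> \<bullet> a) * (c * (1 - (\<xi> \<bullet> a)\<^sup>2) ^ j))) = 0"
    using LIMSEQ_unique[OF lim2 lim1[unfolded swap]] by (simp only: Bochner_Integration.integral_zero)
  moreover have "(LINT \<xi>|?S. g \<xi> * (real ?k * (\<xi> \<bullet> a) * (c * (1 - (\<xi> \<bullet> a)\<^sup>2) ^ j)))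
     = (LINT \<xi>|?S. (real ?k * c) * (g \<xi> * ((\<xi> \<bullet> a) * (1 - (\<xi> \<bullet> a)\<^sup>2) ^ j)))"
    by (intro Bochner_Integration.integral_cong refl) (simp add: mult_ac)
  ultimately have "(real ?k * c) * (LINT \<xi>|?S. g \<xi> * ((\<xi> \<bullet> a) * (1 - (\<xi> \<bullet> a)\<^sup>2) ^ j)) = 0"
    by (simp only: integral_mult_right_zero)
  moreover have "real ?k * c \<noteq> 0" using c(1) by simp
  ultimately show ?thesis by (simp only: mult_eq_0_iff) blast
qed

text \<open>
  By Weierstrass approximation \<open>g\<close> is orthogonal to \<open>x \<mapsto> t * max 0 (\<delta> - (1 - t\<^sup>2))\<close> with
  \<open>t = x \<bullet> a\<close>, an odd function that is concentrated near \<open>a\<close> and \<open>- a\<close>.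
\<close>

lemma odd_zonal_orthogonal_imp_nonpos:
  fixes g :: "real ^ 'n \<Rightarrow> real"
  assumes n2: "CARD('n) \<ge> 2" and a: "norm a = 1" and gc: "continuous_on (great_sphere 0) g"
    and odd: "\<And>x. norm x = 1 \<Longrightarrow> g (- x) = - g x"
    and orth: "\<And>j. (LINT x|surface 0. g x * ((x \<bullet> a) * (1 - (x \<bullet> a)\<^sup>2) ^ j)) = 0"
  shows "g a \<le> 0"
proof (rule ccontr)
  assume "\<not> g a \<le> 0"
  then have ga: "0 < g a" by simp
  let ?S = "surface 0 :: (real ^ 'n) measure" and ?X = "great_sphere 0 :: (real ^ 'n) set"
  interpret S: uniformly_distributed "surface 0" "great_sphere 0 :: (real ^ 'n) set"
    using n2 by (intro uniformly_distributed_surface) auto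
  have aX: "a \<in> ?X" using a by (simp add: mem_great_sphere_0)
  obtain r where r: "0 < r" "\<And>x. norm x = 1 \<Longrightarrow> dist x a < r \<Longrightarrow> 0 < g x"
  proof -
    obtain r where r: "0 < r" "\<forall>x\<in>?X. dist x a < r \<longrightarrow> dist (g x) (g a) < g a"
      using gc aX ga unfolding continuous_on_iff by blast
    have "0 < g x" if "norm x = 1" "dist x a < r" for x
    proof -
      have "\<bar>g x - g a\<bar> < g a" using r(2) that by (simp add: mem_great_sphere_0 dist_real_def)
      then show ?thesis by linarith
    qed
    then show ?thesis using that r(1) by blast
  qed
  \<comment> \<open>For \<open>t = x \<bullet> a > 0\<close> with
    \<open>1 - t\<^sup>2 < \<delta>\<close>, \<open>t\<^sup>2 \<le> t\<close> gives \<open>(dist x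
    a)\<^sup>2 = 2 - 2 * t \<le> 2 * (1 - t\<^sup>2) < r\<^sup>2\<close>.\<close>
  define \<delta> where "\<delta> = min (r\<^sup>2 / 2) 1"
  have \<delta>: "0 < \<delta>" "\<delta> \<le> 1" "2 * \<delta> \<le> r\<^sup>2" using r(1) by (auto simp: \<delta>_def)
  \<comment> \<open>A continuous cutoff in \<open>w = 1 - t\<^sup>2\<close>: polynomials in
    \<open>w\<close> times \<open>t\<close> are covered by \<open>orth\<close>, and \<open>H\<close>
    is their uniform limit on the unit interval.\<close>
  define H where "H w = max 0 (\<delta> - w)" for w :: real
  have xa: "\<bar>x \<bullet> a\<bar> \<le> 1" if "norm x = 1" for x using Cauchy_Schwarz_ineq2[of x a] that a by simp
  have w01: "1 - (x \<bullet> a)\<^sup>2 \<in> {0..1}" if "norm x = 1" for x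
    using xa[OF that] by (simp add: abs_square_le_1)
  have near: "0 < g x" if "norm x = 1" "0 < x \<bullet> a" "1 - (x \<bullet> a)\<^sup>2 < \<delta>" for x
  proof (rule r(2)[OF that(1)])
    have aa: "a \<bullet> a = 1" "x \<bullet> x = 1" using a that(1) unfolding norm_eq_1 by auto
    have "(x \<bullet> a)\<^sup>2 \<le> x \<bullet> a"
      using that(2) xa[OF that(1)] mult_left_le[of "x \<bullet> a" "x \<bullet> a"] by (simp add: power2_eq_square)
    moreover have "(dist x a)\<^sup>2 = 2 - 2 * (x \<bullet> a)"
      unfolding dist_norm power2_norm_eq_inner by (simp add: inner_diff_left inner_diff_right inner_commute aa)
    ultimately have "(dist x a)\<^sup>2 < r\<^sup>2" using that(3) \<delta>(3) by linarith
    then show "dist x a < r" by (rule power2_less_imp_less) (use r(1) in simp)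
  qed
  let ?h = "\<lambda>x. g x * ((x \<bullet> a) * H (1 - (x \<bullet> a)\<^sup>2))"
  have Hc: "continuous_on A (\<lambda>x. H (1 - (x \<bullet> a)\<^sup>2))" for A
    unfolding H_def by (intro continuous_intros)
  have hc: "continuous_on ?X ?h" by (intro continuous_intros gc Hc)
  have "0 < (LINT x|?S. ?h x)"
  proof (rule S.integral_continuous_pos[OF hc _ aX])
    show "measure ?S ?X \<noteq> 0" using measure_surface_pos[of "0 :: real ^ 'n"] n2 by simp
    have "a \<bullet> a = 1" using a unfolding norm_eq_1 .
    then show "0 < ?h a" using ga \<delta> by (simp add: H_def)
    fix x assume "x \<in> ?X"
    then have x: "norm x = 1" by (simp add: mem_great_sphere_0)
    show "0 \<le> ?h x"
    proof (cases "1 - (x \<bullet> a)\<^sup>2 < \<delta>")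
      case True
      have H0: "0 \<le> H (1 - (x \<bullet> a)\<^sup>2)" by (simp add: H_def)
      consider "0 < x \<bullet> a" | "x \<bullet> a = 0" | "x \<bullet> a < 0" by linarith
      then show ?thesis
      proof cases
        case 1
        then show ?thesis using near[OF x 1 True] H0 by simp
      next
        case 2
        then show ?thesis by simp
      next
        \<comment> \<open>Near \<open>- a\<close> both \<open>g\<close> and
          \<open>x \<bullet> a\<close> change sign, so the product stays nonnegative.\<close>
        case 3
        then have "0 < g (- x)" using near[of "- x"] x True by simp
        then have "g x \<le> 0" using odd[OF x] by simp
        moreover have "(x \<bullet> a) * H (1 - (x \<bullet> a)\<^sup>2) \<le> 0" using 3 H0 by (simp add: mult_nonpos_nonneg)
        ultimately show ?thesis by (rule mult_nonpos_nonpos)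
      qed
    qed (simp add: H_def)
  qed
  moreover have "\<bar>LINT x|?S. ?h x\<bar> \<le> e * (LINT x|?S. \<bar>g x\<bar>)" if "0 < e" for e
  proof -
    have "continuous_on {0..1} H" unfolding H_def by (intro continuous_intros)
    then obtain p where p: "real_polynomial_function p" "\<And>w. w \<in> {0..1} \<Longrightarrow> \<bar>H w - p w\<bar> < e"
      using Stone_Weierstrass_real_polynomial_function[of "{0..1 :: real}" H e] \<open>0 < e\<close> by blast
    then obtain b N where pN: "p = (\<lambda>w. \<Sum>i\<le>N. b i * w ^ i)"
      by (auto simp: real_polynomial_function_iff_sum)
    have pc: "continuous_on ?X (\<lambda>x. g x * ((x \<bullet> a) * p (1 - (x \<bullet> a)\<^sup>2)))"
      unfolding pN by (intro continuous_intros gc)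
    have "(LINT x|?S. g x * ((x \<bullet> a) * p (1 - (x \<bullet> a)\<^sup>2)))
        = (LINT x|?S. (\<Sum>i\<le>N. b i * (g x * ((x \<bullet> a) * (1 - (x \<bullet> a)\<^sup>2) ^ i))))"
      unfolding pN by (intro Bochner_Integration.integral_cong refl) (simp add: sum_distrib_left mult_ac)
    also have "\<dots> = (\<Sum>i\<le>N. LINT x|?S. b i * (g x * ((x \<bullet> a) * (1 - (x \<bullet> a)\<^sup>2) ^ i)))"
      by (intro Bochner_Integration.integral_sum S.integrable_continuous continuous_intros gc)
    also have "\<dots> = 0" by (simp add: orth)
    finally have p0: "(LINT x|?S. g x * ((x \<bullet> a) * p (1 - (x \<bullet> a)\<^sup>2))) = 0" .
    have "(LINT x|?S. ?h x) = (LINT x|?S. ?h x - g x * ((x \<bullet> a) * p (1 - (x \<bullet> a)\<^sup>2)))"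
      using p0 by (subst Bochner_Integration.integral_diff) (auto intro: S.integrable_continuous hc pc)
    also have "\<bar>\<dots>\<bar> \<le> (LINT x|?S. e * \<bar>g x\<bar>)"
    proof (rule integral_abs_le_integral)
      show "integrable ?S (\<lambda>x. ?h x - g x * ((x \<bullet> a) * p (1 - (x \<bullet> a)\<^sup>2)))"
        by (intro Bochner_Integration.integrable_diff S.integrable_continuous hc pc)
      show "integrable ?S (\<lambda>x. e * \<bar>g x\<bar>)"
        by (intro S.integrable_continuous continuous_intros gc)
      fix x assume "x \<in> space ?S"
      then have x: "norm x = 1" by (simp add: mem_great_sphere_0)
      have "?h x - g x * ((x \<bullet> a) * p (1 - (x \<bullet> a)\<^sup>2)) = g x * ((x \<bullet> a) * (H (1 - (x \<bullet> a)\<^sup>2) - p (1 - (x \<bullet> a)\<^sup>2)))"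
        by (simp add: right_diff_distrib)
      then have "\<bar>?h x - g x * ((x \<bullet> a) * p (1 - (x \<bullet> a)\<^sup>2))\<bar> = \<bar>g x\<bar> * (\<bar>x \<bullet> a\<bar> * \<bar>H (1 - (x \<bullet> a)\<^sup>2) - p (1 - (x \<bullet> a)\<^sup>2)\<bar>)"
        by (simp only: abs_mult)
      also have "\<dots> \<le> \<bar>g x\<bar> * (1 * e)"
        using xa[OF x] p(2)[OF w01[OF x]] by (intro mult_left_mono mult_mono) auto
      finally show "\<bar>?h x - g x * ((x \<bullet> a) * p (1 - (x \<bullet> a)\<^sup>2))\<bar> \<le> e * \<bar>g x\<bar>" by (simp add: mult.commute)
    qed
    finally show ?thesis by simp
  qed
  note est = this
  define V where "V = (LINT x|?S. \<bar>g x\<bar>)"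
  define I where "I = (LINT x|?S. ?h x)"
  have V: "0 \<le> V" by (simp add: V_def)
  have I: "0 < I" using \<open>0 < (LINT x|?S. ?h x)\<close> by (simp only: I_def)
  \<comment> \<open>This choice of \<open>e\<close> forces \<open>\<bar>I\<bar> \<le> I / 2\<close>;
    adding 1 avoids a zero denominator.\<close>
  have "0 < I / 2 / (V + 1)" using I V by simp
  then have "\<bar>I\<bar> \<le> I / 2 / (V + 1) * V" unfolding I_def V_def by (rule est)
  moreover have "I / 2 / (V + 1) * V \<le> I / 2 / (V + 1) * (V + 1)"
    using I V by (intro mult_left_mono) auto
  moreover have "V + 1 \<noteq> 0" using V by simp
  then have "I / 2 / (V + 1) * (V + 1) = I / 2" by (rule nonzero_eq_divide_eq[THEN iffD1]) (rule refl)
  ultimately show False using I by linarith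
qed

theorem mainTheorem1:
  fixes f :: "real ^ 'n \<Rightarrow> real"
  assumes "CARD('n) \<ge> 2"
    and "geodesic_lipschitz f"
    and "AE \<xi> in sphere_measure. (section_integral f \<xi> has_real_derivative 0) (at 0)"
  shows "\<forall>x\<in>sphere 0 1. f x = f (- x)"
proof -
  note n2 = assms(1)
  obtain L where L: "0 \<le> L" "\<And>x y. norm x = 1 \<Longrightarrow> norm y = 1 \<Longrightarrow> \<bar>f x - f y\<bar> \<le> L * angle x y"
    using assms(2) unfolding geodesic_lipschitz_def by auto
  have lip: "\<bar>f x - f y\<bar> \<le> (4 * L) * dist x y" if "norm x = 1" "norm y = 1" for x y
    using order_trans[OF L(2)[OF that] mult_left_mono[OF angle_le_dist[OF that] L(1)]] by simp
  have fc: "continuous_on (great_sphere 0) f"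
    by (rule lipschitz_sphere_continuous[OF lip]) (use L(1) in auto)
  define g where "g x = f x - f (- x)" for x
  have glip: "\<bar>g x - g y\<bar> \<le> (8 * L) * dist x y" if "norm x = 1" "norm y = 1" for x y
    using lip[OF that] lip[of "- x" "- y"] that by (simp add: g_def dist_minus)
  have odd: "g (- x) = - g x" for x by (simp add: g_def)
  have L8: "0 \<le> 8 * L" using L(1) by simp
  have gc: "continuous_on (great_sphere 0) g" using glip L8 by (rule lipschitz_sphere_continuous)
  \<comment> \<open>A sequence rather than a filter, to suit dominated convergence; it starts at
    \<open>1 / 2\<close> so that \<open>\<bar>z i\<bar> < 1\<close> throughout.\<close>
  define z where "z i = 1 / real (Suc (Suc i))" for i
  have z: "z \<longlonglongrightarrow> 0"
    unfolding z_def by (rule LIMSEQ_Suc[OF LIMSEQ_Suc[OF lim_1_over_n]])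
  have z': "\<And>i. z i \<noteq> 0" "\<And>i. \<bar>z i\<bar> < 1"
    unfolding z_def by auto
  have "AE \<xi> in surface 0. (\<lambda>i. slice (z i) g \<xi> / z i) \<longlonglongrightarrow> 0"
    using assms(3) unfolding sphere_measure_eq_surface
  proof (rule AE_mp[OF _ AE_I2], intro impI)
    fix \<xi> :: "real ^ 'n" assume "\<xi> \<in> space (surface 0)" and d: "(section_integral f \<xi> has_real_derivative 0) (at 0)"
    then have xi: "norm \<xi> = 1" by (simp add: mem_great_sphere_0)
    show "(\<lambda>i. slice (z i) g \<xi> / z i) \<longlonglongrightarrow> 0"
      using slice_odd_part_tendsto[OF n2 xi fc d z z'] by (simp add: g_def[abs_def])
  qed
  note lim = this
  have nonpos: "g a \<le> 0" if "norm a = 1" for a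
  proof (rule odd_zonal_orthogonal_imp_nonpos[OF n2 that gc odd])
    show "(LINT x|surface 0. g x * ((x \<bullet> a) * (1 - (x \<bullet> a)\<^sup>2) ^ j)) = 0" for j
      by (rule zonal_odd_orthogonal[where g = g and z = z and K = "8 * L"])
        (use n2 that L8 glip odd z z' lim in simp_all)
  qed
  show ?thesis
  proof
    fix x :: "real ^ 'n" assume "x \<in> sphere 0 1"
    \<comment> \<open>Nonpositivity at \<open>x\<close> and at \<open>- x\<close> forces
      \<open>g x = 0\<close>, because \<open>g\<close> is odd.\<close>
    then have "norm x = 1" "norm (- x) = 1" by simp_all
    from this[THEN nonpos] show "f x = f (- x)" unfolding g_def minus_minus by linarith
  qed
qed

end
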